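(* Let $G$ be a group and $R,S,T$ normal subgroups of $G$. Put ${\bf r}=(R-1)\mathbb Z[G]$, ${\bf s}=(S-1)\mathbb Z[G]$, ${\bf t}=(T-1)\mathbb Z[G]$, and $$\|R,S,T\|:=[R,S\cap T]\,[S,R\cap T]\,[T,R\cap S],$$ $$\|{\bf r},{\bf s},{\bf t}\|:={\bf r}({\bf s}\cap {\bf t})+({\bf s}\cap {\bf t}){\bf r}+{\bf s}({\bf r}\cap {\bf t})+({\bf r}\cap {\bf t}){\bf s}+{\bf t}({\bf r}\cap {\bf s})+({\bf r}\cap {\bf s}){\bf t}.$$ Then for every $g\in D(G,\|{\bf r},{\bf s},{\bf t}\|)$ one has $g^2\in \|R,S,T\|$; i.e. the quotient $$\frac{D(G,\|{\bf r},{\bf s},{\bf t}\|)}{\|R,S,T\|}$$ is a $\mathbb Z/2$-vector space.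
   Context: $\mathbb Z[G]$ is the integral group ring of $G$. For a normal subgroup $N$ of $G$, $(N-1)\mathbb Z[G]$ is the two-sided ideal of $\mathbb Z[G]$ generated by all $x-1$, $x\in N$ (the kernel of $\mathbb Z[G]\to\mathbb Z[G/N]$). For a two-sided ideal ${\bf a}$ of $\mathbb Z[G]$, the generalized dimension subgroup is the normal subgroup $D(G,{\bf a}):=G\cap(1+{\bf a})=\{g\in G: g-1\in{\bf a}\}$. The product ${\bf a}{\bf b}$ of ideals is the additive subgroup generated by products $ab$ with $a\in{\bf a}$, $b\in{\bf b}$. $[A,B]$ denotes the commutator subgroup of the subgroups $A,B$ of $G$. One has $\|R,S,T\|\subseteq D(G,\|{\bf r},{\bf s},{\bf t}\|)$. *)

theory Defs
  imports "HOL-Algebra.Algebra" "HOL-Number_Theory.Residues"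
begin

text \<open>Elements of the integral group ring are finitely supported integer-valued functions whose
  support lies in the carrier of the group; the group element \<open>g\<close> is \<open>frag_of g\<close>.\<close>

definition group_ring_mult ::
    "('a, 'b) monoid_scheme \<Rightarrow> ('a \<Rightarrow>\<^sub>0 int) \<Rightarrow> ('a \<Rightarrow>\<^sub>0 int) \<Rightarrow> ('a \<Rightarrow>\<^sub>0 int)" where
  "group_ring_mult G x y =
    (\<Sum>g \<in> Poly_Mapping.keys x. \<Sum>h \<in> Poly_Mapping.keys y.
       Poly_Mapping.single (g \<otimes>\<^bsub>G\<^esub> h) (Poly_Mapping.lookup x g * Poly_Mapping.lookup y h))"

definition group_ring :: "('a, 'b) monoid_scheme \<Rightarrow> ('a \<Rightarrow>\<^sub>0 int) ring" where
  "group_ring G =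
    \<lparr>carrier = {x. Poly_Mapping.keys x \<subseteq> carrier G},
     monoid.mult = group_ring_mult G, one = frag_of \<one>\<^bsub>G\<^esub>, ring.zero = 0, ring.add = (+)\<rparr>"

definition relative_augmentation_ideal ::
    "('a, 'b) monoid_scheme \<Rightarrow> 'a set \<Rightarrow> ('a \<Rightarrow>\<^sub>0 int) set" where
  "relative_augmentation_ideal G N =
    Idl\<^bsub>group_ring G\<^esub> {frag_of x \<ominus>\<^bsub>group_ring G\<^esub> \<one>\<^bsub>group_ring G\<^esub> |x. x \<in> N}"

definition dimension_subgroup ::
    "('a, 'b) monoid_scheme \<Rightarrow> ('a \<Rightarrow>\<^sub>0 int) set \<Rightarrow> 'a set" where
  "dimension_subgroup G \<aa> =
    {g \<in> carrier G. frag_of g \<ominus>\<^bsub>group_ring G\<^esub> \<one>\<^bsub>group_ring G\<^esub> \<in> \<aa>}"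

text \<open>For subgroups \<open>A\<close> and \<open>B\<close> the generated subgroup does not depend on which of the usual
  conventions for the commutator of two elements is chosen.\<close>

definition commutator_subgroup ::
    "('a, 'b) monoid_scheme \<Rightarrow> 'a set \<Rightarrow> 'a set \<Rightarrow> 'a set" where
  "commutator_subgroup G A B =
    generate G {a \<otimes>\<^bsub>G\<^esub> b \<otimes>\<^bsub>G\<^esub> inv\<^bsub>G\<^esub> a \<otimes>\<^bsub>G\<^esub> inv\<^bsub>G\<^esub> b |a b. a \<in> A \<and> b \<in> B}"

definition commutator_triple ::
    "('a, 'b) monoid_scheme \<Rightarrow> 'a set \<Rightarrow> 'a set \<Rightarrow> 'a set \<Rightarrow> 'a set" where
  "commutator_triple G R S T =
     commutator_subgroup G R (S \<inter> T) <#>\<^bsub>G\<^esub>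
     commutator_subgroup G S (R \<inter> T) <#>\<^bsub>G\<^esub>
     commutator_subgroup G T (R \<inter> S)"

definition ideal_triple ::
    "('r, 'm) ring_scheme \<Rightarrow> 'r set \<Rightarrow> 'r set \<Rightarrow> 'r set \<Rightarrow> 'r set" where
  "ideal_triple A \<rr> \<ss> \<tt> =
     ideal_prod A \<rr> (\<ss> \<inter> \<tt>) <+>\<^bsub>A\<^esub> ideal_prod A (\<ss> \<inter> \<tt>) \<rr> <+>\<^bsub>A\<^esub>
     ideal_prod A \<ss> (\<rr> \<inter> \<tt>) <+>\<^bsub>A\<^esub> ideal_prod A (\<rr> \<inter> \<tt>) \<ss> <+>\<^bsub>A\<^esub>
     ideal_prod A \<tt> (\<rr> \<inter> \<ss>) <+>\<^bsub>A\<^esub> ideal_prod A (\<rr> \<inter> \<ss>) \<tt>"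

text \<open>The multiplicatively written group \<open>Q\<close> as an additive group with integer scalars acting by
  powers, the only scalar action a module structure over \<open>\<int>/n\<close> on \<open>Q\<close> can have.  The
  record fields \<open>mult\<close> and \<open>one\<close> play no role in the locale \<open>module\<close>.\<close>

definition power_module :: "('a, 'b) monoid_scheme \<Rightarrow> (int, 'a) module" where
  "power_module Q =
    \<lparr>carrier = carrier Q, monoid.mult = monoid.mult Q, one = \<one>\<^bsub>Q\<^esub>, ring.zero = \<one>\<^bsub>Q\<^esub>, ring.add = monoid.mult Q,
     smult = (\<lambda>k x. x [^]\<^bsub>Q\<^esub> k)\<rparr>"


lemma group_ring_mult_superset:
  assumes "finite A" "finite B" "Poly_Mapping.keys x \<subseteq> A" "Poly_Mapping.keys y \<subseteq> B"
  shows "group_ring_mult G x y =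
    (\<Sum>g\<in>A. \<Sum>h\<in>B.
       Poly_Mapping.single (g \<otimes>\<^bsub>G\<^esub> h) (Poly_Mapping.lookup x g * Poly_Mapping.lookup y h))"
proof -
  have "(\<Sum>h\<in>B. Poly_Mapping.single (g \<otimes>\<^bsub>G\<^esub> h) (Poly_Mapping.lookup x g * Poly_Mapping.lookup y h))
     = (\<Sum>h\<in>Poly_Mapping.keys y.
          Poly_Mapping.single (g \<otimes>\<^bsub>G\<^esub> h) (Poly_Mapping.lookup x g * Poly_Mapping.lookup y h))" for g
    by (rule sum.mono_neutral_right) (use assms in \<open>auto simp: in_keys_iff\<close>)
  moreover have "group_ring_mult G x y =
    (\<Sum>g\<in>A. \<Sum>h\<in>Poly_Mapping.keys y.
       Poly_Mapping.single (g \<otimes>\<^bsub>G\<^esub> h) (Poly_Mapping.lookup x g * Poly_Mapping.lookup y h))"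
    unfolding group_ring_mult_def
    by (rule sum.mono_neutral_left) (use assms in \<open>auto simp: in_keys_iff\<close>)
  ultimately show ?thesis by simp
qed

lemma group_ring_mult_add_left:
  "group_ring_mult G (x + y) z = group_ring_mult G x z + group_ring_mult G y z"
proof -
  let ?A = "Poly_Mapping.keys x \<union> Poly_Mapping.keys y" and ?B = "Poly_Mapping.keys z"
  have k: "Poly_Mapping.keys (x + y) \<subseteq> ?A" by (rule Poly_Mapping.keys_add)
  show ?thesis
    using k by (simp add: group_ring_mult_superset[of ?A ?B] lookup_add distrib_right single_add
        sum.distrib)
qed

lemma group_ring_mult_add_right:
  "group_ring_mult G z (x + y) = group_ring_mult G z x + group_ring_mult G z y"
proof -
  let ?A = "Poly_Mapping.keys x \<union> Poly_Mapping.keys y" and ?B = "Poly_Mapping.keys z"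
  have k: "Poly_Mapping.keys (x + y) \<subseteq> ?A" by (rule Poly_Mapping.keys_add)
  show ?thesis
    using k by (simp add: group_ring_mult_superset[of ?B ?A] lookup_add distrib_left single_add
        sum.distrib)
qed

lemma group_ring_mult_diff_left:
  "group_ring_mult G (x - y) z = group_ring_mult G x z - group_ring_mult G y z"
  using group_ring_mult_add_left[of G "x - y" y z] by simp

lemma group_ring_mult_diff_right:
  "group_ring_mult G z (x - y) = group_ring_mult G z x - group_ring_mult G z y"
  using group_ring_mult_add_right[of G z "x - y" y] by simp

lemma group_ring_mult_zero [simp]:
  "group_ring_mult G 0 x = 0" "group_ring_mult G x 0 = 0"
  by (simp_all add: group_ring_mult_def)

lemma group_ring_mult_frag_of [simp]:
  "group_ring_mult G (frag_of g) (frag_of h) = frag_of (g \<otimes>\<^bsub>G\<^esub> h)"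
  by (simp add: group_ring_mult_def)

lemma (in monoid) group_ring_mult_closed:
  assumes "Poly_Mapping.keys x \<subseteq> carrier G" "Poly_Mapping.keys y \<subseteq> carrier G"
  shows "Poly_Mapping.keys (group_ring_mult G x y) \<subseteq> carrier G"
  unfolding group_ring_mult_def
  by (intro order_trans[OF keys_sum] UN_least) (use assms in \<open>auto simp: subset_iff\<close>)

lemma (in monoid) group_ring_mult_one:
  assumes "Poly_Mapping.keys x \<subseteq> carrier G"
  shows "group_ring_mult G (frag_of \<one>) x = x" "group_ring_mult G x (frag_of \<one>) = x"
  using assms
  by (induction x rule: frag_induction)
     (auto simp: group_ring_mult_diff_left group_ring_mult_diff_right)

lemma (in monoid) group_ring_mult_assoc:
  assumes "Poly_Mapping.keys x \<subseteq> carrier G" "Poly_Mapping.keys y \<subseteq> carrier G"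
    "Poly_Mapping.keys z \<subseteq> carrier G"
  shows "group_ring_mult G (group_ring_mult G x y) z = group_ring_mult G x (group_ring_mult G y z)"
  using assms(1)
proof (induction x rule: frag_induction)
  case (one g)
  show ?case
    using assms(2)
  proof (induction y rule: frag_induction)
    case (one h)
    show ?case
      using assms(3)
      by (induction z rule: frag_induction)
         (use one \<open>g \<in> carrier G\<close> in \<open>auto simp: m_assoc group_ring_mult_diff_right\<close>)
  qed (auto simp: group_ring_mult_diff_left group_ring_mult_diff_right)
qed (auto simp: group_ring_mult_diff_left)

lemma (in monoid) ring_group_ring: "ring (group_ring G)"
proof (rule ringI)
  show "abelian_group (group_ring G)"
  proof (rule abelian_groupI)
    fix x assume "x \<in> carrier (group_ring G)"
    then show "\<exists>y\<in>carrier (group_ring G). y \<oplus>\<^bsub>group_ring G\<^esub> x = \<zero>\<^bsub>group_ring G\<^esub>"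
      by (intro bexI[of _ "- x"]) (auto simp: group_ring_def)
  qed (use Poly_Mapping.keys_add in \<open>fastforce simp: group_ring_def ac_simps\<close>)+
  show "Group.monoid (group_ring G)"
    by (rule monoidI)
       (use group_ring_mult_closed in
         \<open>auto simp: group_ring_def group_ring_mult_one group_ring_mult_assoc\<close>)
qed (auto simp: group_ring_def group_ring_mult_add_left group_ring_mult_add_right)

lemma (in monoid) group_ring_minus:
  assumes "x \<in> carrier (group_ring G)" "y \<in> carrier (group_ring G)"
  shows "x \<ominus>\<^bsub>group_ring G\<^esub> y = x - y"
proof -
  interpret ring "group_ring G" by (rule ring_group_ring)
  have "\<ominus>\<^bsub>group_ring G\<^esub> y = - y"
    by (rule minus_equality) (use assms in \<open>auto simp: group_ring_def\<close>)
  then show ?thesis by (simp add: a_minus_def) (simp add: group_ring_def)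
qed

lemma (in group) ideal_relative_augmentation_ideal:
  assumes "N \<subseteq> carrier G"
  shows "ideal (relative_augmentation_ideal G N) (group_ring G)"
proof -
  interpret ZG: ring "group_ring G" by (rule ring_group_ring)
  have "frag_of x \<in> carrier (group_ring G)" if "x \<in> carrier G" for x
    using that by (simp add: group_ring_def)
  then show ?thesis
    unfolding relative_augmentation_ideal_def
    using assms by (intro ZG.genideal_ideal) auto
qed

end

theory Submission imports Defs "HOL-Combinatorics.Permutations" begin

text \<open>Modulo \<open>\<parallel>R, S, T\<parallel>\<close> the groups \<open>R\<close>, \<open>S\<close>, \<open>T\<close> centralize \<open>S \<inter> T\<close>, \<open>R \<inter> T\<close>, \<open>R \<inter> S\<close> respectively,
  and an element \<open>c\<close> of the dimension subgroup lies in \<open>C = R \<inter> S \<inter> T\<close>.  To get \<open>c\<^sup>2 = 1\<close> it suffices to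
  find a function \<open>\<phi>\<close> from \<open>G\<close> to an abelian group of permutations whose additive extension to the
  group ring kills the ideal and for which \<open>\<phi> c = L c \<circ> \<phi> 1\<close> with \<open>L c\<close> trivial only if \<open>c\<^sup>2 = 1\<close>.

  The permutations act on states, which contain a pair of elements of \<open>S \<inter> T\<close> modulo the antidiagonal
  action of \<open>C\<close>.  The permutation \<open>L c\<close> multiplies both entries by \<open>c\<close>, and \<open>(c, c) ~ (c\<^sup>2, 1)\<close>; this is the
  source of the square.  Pairs are needed because an element \<open>x\<close> of \<open>T \<inter> RS\<close>, congruent modulo \<open>R\<close> to \<open>s x\<close>
  in \<open>S\<close>, is to act by an operator such that the operators of \<open>x\<close> and \<open>y\<close> commute up to \<open>[s x, y]\<close> and
  up to \<open>[x, s y]\<close> at the same time.  These two commutators agree only modulo \<open>C\<close>.  On a single element of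
  \<open>S \<inter> T\<close> a linear order decides which one of them occurs, and the opposite order on the second entry
  makes the outcome symmetric.

  The values of \<open>\<phi>\<close> are discrepancies between two systems of operators attached to elements of \<open>T \<inter> RS\<close>,
  one constant on the cosets of \<open>R \<inter> T\<close>, the other equivariant under \<open>S \<inter> T\<close>.\<close>

text \<open>The extension of \<open>\<phi>\<close> must vanish on products with an intersection such
  as \<open>aug G S \<inter> aug G T\<close>, which contains every \<open>(s - 1)(t - 1)\<close>
  besides the ideal of \<open>S \<inter> T\<close>. The intersection is reached only through
  functions: a product of an \<open>S\<close>-invariant and a \<open>T\<close>-invariant function
  kills it. This turns the task into conditions on \<open>\<phi>\<close>: the second differences in
  \<open>A\<close> and \<open>R\<close>, in \<open>B\<close> and \<open>S\<close>, in
  \<open>E\<close> and \<open>T\<close> vanish, and so do the third differences in \<open>R\<close>,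
  \<open>S\<close>, \<open>T\<close>. A discrepancy of the shape
  \<open>i (t \<theta>)^-1 j t i \<theta>\<close> meets them because its factors see different data.
  Shifting \<open>t\<close> by \<open>A\<close> changes it by an amount that depends only on the
  \<open>B\<close>-coset of \<open>t \<theta>\<close>, shifting \<open>t\<close> by \<open>B\<close>
  by an amount that depends only on the \<open>A\<close>-coset of \<open>t\<close>, and the
  coordinates on \<open>G\<close> are chosen so that \<open>R\<close> preserves the first coset and
  \<open>S\<close> the second. An element \<open>c\<close> of \<open>C\<close> belongs to both
  \<open>A\<close> and \<open>B\<close>: the system \<open>i\<close> ignores it while
  \<open>j\<close> absorbs it as \<open>L c\<close>, so \<open>L c\<close> survives.\<close>

context group begin

section \<open>Commutator identities\<close>

definition comm :: "'a \<Rightarrow> 'a \<Rightarrow> 'a" where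
  "comm x y = x \<otimes> y \<otimes> inv x \<otimes> inv y"

lemma inv_mult_cancel_left: "\<lbrakk>x \<in> carrier G; y \<in> carrier G\<rbrakk> \<Longrightarrow> inv x \<otimes> (x \<otimes> y) = y"
  by (simp flip: m_assoc)

lemma mult_inv_cancel_left: "\<lbrakk>x \<in> carrier G; y \<in> carrier G\<rbrakk> \<Longrightarrow> x \<otimes> (inv x \<otimes> y) = y"
  by (simp flip: m_assoc)

lemmas word_simps = m_assoc inv_mult_group inv_mult_cancel_left mult_inv_cancel_left comm_def

lemma comm_closed [simp]: "\<lbrakk>x \<in> carrier G; y \<in> carrier G\<rbrakk> \<Longrightarrow> comm x y \<in> carrier G"
  by (simp add: comm_def)

lemma comm_mult_right:
  assumes "x \<in> carrier G" "y \<in> carrier G" "z \<in> carrier G"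
  shows "comm x (y \<otimes> z) = comm x y \<otimes> (y \<otimes> comm x z \<otimes> inv y)"
  using assms by (simp add: word_simps)

lemma comm_mult_left:
  assumes "x \<in> carrier G" "y \<in> carrier G" "z \<in> carrier G"
  shows "comm (x \<otimes> y) z = x \<otimes> comm y z \<otimes> inv x \<otimes> comm x z"
  using assms by (simp add: word_simps)

lemma inv_comm:
  assumes "x \<in> carrier G" "y \<in> carrier G"
  shows "inv (comm x y) = comm y x"
  using assms by (simp add: word_simps)

lemma conj_eq_self:
  assumes "x \<in> carrier G" "y \<in> carrier G" "x \<otimes> y = y \<otimes> x"
  shows "x \<otimes> y \<otimes> inv x = y"
  using assms by (simp add: m_assoc)

lemma comm_eq_one:
  assumes "x \<in> carrier G" "y \<in> carrier G" "x \<otimes> y = y \<otimes> x"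
  shows "comm x y = \<one>"
  using assms conj_eq_self[of x y] by (simp add: comm_def)

lemma commutator_in_normal:
  assumes "N \<lhd> G" "x \<in> carrier G" "y \<in> carrier G" "x \<in> N \<or> y \<in> N"
  shows "x \<otimes> y \<otimes> inv x \<otimes> inv y \<in> N"
proof -
  interpret N: normal N G by (rule assms)
  show ?thesis using assms(4)
  proof
    assume "x \<in> N"
    then have "x \<otimes> (y \<otimes> inv x \<otimes> inv y) \<in> N" using assms by (simp add: N.inv_op_closed2)
    then show ?thesis using assms by (simp add: m_assoc)
  next
    assume "y \<in> N"
    then show ?thesis using assms by (simp add: N.inv_op_closed2)
  qed
qed

lemma comm_normal_left: "\<lbrakk>N \<lhd> G; x \<in> N; y \<in> carrier G\<rbrakk> \<Longrightarrow> comm x y \<in> N"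
  and comm_normal_right: "\<lbrakk>N \<lhd> G; y \<in> carrier G; x \<in> N\<rbrakk> \<Longrightarrow> comm y x \<in> N"
  using commutator_in_normal subgroup.mem_carrier[OF normal_imp_subgroup] unfolding comm_def by metis+

end

section \<open>Operators with prescribed commutation relations\<close>

locale commuting_triple = group G for G (structure) +
  fixes R S T :: "'a set"
  assumes normal_R: "R \<lhd> G" and normal_S: "S \<lhd> G" and normal_T: "T \<lhd> G"
    and commute_R: "\<And>r x. \<lbrakk>r \<in> R; x \<in> S; x \<in> T\<rbrakk> \<Longrightarrow> r \<otimes> x = x \<otimes> r"
    and commute_S: "\<And>s x. \<lbrakk>s \<in> S; x \<in> R; x \<in> T\<rbrakk> \<Longrightarrow> s \<otimes> x = x \<otimes> s"
    and commute_T: "\<And>t x. \<lbrakk>t \<in> T; x \<in> R; x \<in> S\<rbrakk> \<Longrightarrow> t \<otimes> x = x \<otimes> t"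
begin

sublocale R: normal R G by (rule normal_R)
sublocale S: normal S G by (rule normal_S)
sublocale T: normal T G by (rule normal_T)

lemma carr [simp]: "x \<in> R \<Longrightarrow> x \<in> carrier G" "x \<in> S \<Longrightarrow> x \<in> carrier G" "x \<in> T \<Longrightarrow> x \<in> carrier G"
  by auto

abbreviation A where "A \<equiv> S \<inter> T"
abbreviation B where "B \<equiv> R \<inter> T"
abbreviation E where "E \<equiv> R \<inter> S"
abbreviation C where "C \<equiv> R \<inter> S \<inter> T"

text \<open>\<open>T0\<close> is \<open>T \<inter> RS\<close>.  If \<open>sim s x\<close>, then \<open>[t, s]\<close> for \<open>t \<in> T\<close> depends only on \<open>x\<close> (lemma \<open>sim_unique\<close>).\<close>

definition T0 where "T0 = {t \<in> T. \<exists>s\<in>S. inv s \<otimes> t \<in> R}"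

definition sim where "sim s x \<longleftrightarrow> s \<in> S \<and> x \<in> T \<and> inv s \<otimes> x \<in> R"

lemma sim_imp: "sim s x \<Longrightarrow> s \<in> S \<and> x \<in> T \<and> x \<in> T0 \<and> inv s \<otimes> x \<in> R"
  by (auto simp: sim_def T0_def)

lemma T0_in_T [simp]: "x \<in> T0 \<Longrightarrow> x \<in> T"
  by (simp add: T0_def)

lemma comm_S_T: "\<lbrakk>s \<in> S; t \<in> T\<rbrakk> \<Longrightarrow> comm s t \<in> A"
  using comm_normal_left[OF normal_S, of s t] comm_normal_right[OF normal_T, of s t] by simp

lemma comm_T_S: "\<lbrakk>s \<in> S; t \<in> T\<rbrakk> \<Longrightarrow> comm t s \<in> A"
  using comm_normal_left[OF normal_T, of t s] comm_normal_right[OF normal_S, of t s] by simp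

lemma C_central:
  assumes "c \<in> C" "x \<in> R \<or> x \<in> S \<or> x \<in> T"
  shows "x \<otimes> c = c \<otimes> x"
  using assms commute_R commute_S commute_T by blast

lemma conj_A_closed: "\<lbrakk>x \<in> carrier G; a \<in> A\<rbrakk> \<Longrightarrow> x \<otimes> a \<otimes> inv x \<in> A"
  by (simp add: S.inv_op_closed2 T.inv_op_closed2)

lemma A_m_closed: "\<lbrakk>a \<in> A; b \<in> A\<rbrakk> \<Longrightarrow> a \<otimes> b \<in> A" and A_inv_closed: "a \<in> A \<Longrightarrow> inv a \<in> A"
  by auto

text \<open>The elements \<open>x\<close> and \<open>s\<close> differ by a factor in
  \<open>R\<close>, which centralizes \<open>A\<close>.\<close>

lemma sim_conj:
  assumes "sim s x" "a \<in> A"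
  shows "x \<otimes> a \<otimes> inv x = s \<otimes> a \<otimes> inv s"
proof -
  define r where "r = inv s \<otimes> x"
  have [simp]: "s \<in> carrier G" "x \<in> carrier G" "a \<in> carrier G" and r: "r \<in> R" "r \<in> carrier G"
    using assms sim_imp[OF assms(1)] by (auto simp: r_def)
  have x: "x = s \<otimes> r" by (simp add: r_def word_simps)
  have "x \<otimes> a \<otimes> inv x = s \<otimes> (r \<otimes> a \<otimes> inv r) \<otimes> inv s"
    using r by (simp add: x word_simps)
  also have "r \<otimes> a \<otimes> inv r = a"
    using r assms(2) commute_R by (intro conj_eq_self) auto
  finally show ?thesis .
qed

text \<open>Writing \<open>x = s r\<close> splits off \<open>s [r, u] s^-1\<close>, which lies in
  \<open>R\<close> by normality, and both commutators lie in \<open>T\<close>. So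
  \<open>[x, u]\<close> may be replaced by \<open>[s, u]\<close>, an element of \<open>A\<close>, at
  the cost of a factor in \<open>B\<close>.\<close>

lemma sim_comm:
  assumes "sim s x" "u \<in> T"
  shows "inv (comm s u) \<otimes> comm x u \<in> B"
proof -
  define r where "r = inv s \<otimes> x"
  have [simp]: "s \<in> carrier G" "x \<in> carrier G" "u \<in> carrier G" and r: "r \<in> R" "r \<in> carrier G"
    and s: "s \<in> S" "x \<in> T"
    using assms sim_imp[OF assms(1)] by (auto simp: r_def)
  have x: "x = s \<otimes> r" by (simp add: r_def word_simps)
  have "comm x u = s \<otimes> comm r u \<otimes> inv s \<otimes> comm s u"
    using r unfolding x by (simp add: comm_mult_left)
  then have "inv (comm s u) \<otimes> comm x u = inv (comm s u) \<otimes> (s \<otimes> comm r u \<otimes> inv s) \<otimes> comm s u"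
    using r by (simp add: m_assoc)
  moreover have "s \<otimes> comm r u \<otimes> inv s \<in> R"
    using r comm_normal_left[OF normal_R, of r u] by (simp add: R.inv_op_closed2)
  ultimately have "inv (comm s u) \<otimes> comm x u \<in> R"
    by (simp add: R.inv_op_closed1)
  moreover have "inv (comm s u) \<otimes> comm x u \<in> T"
    using comm_normal_left[OF normal_T, of x u] comm_S_T[of s u] s assms by simp
  ultimately show ?thesis by simp
qed

text \<open>\<open>S\<close> commutes with \<open>b\<close>, and \<open>b\<close>, being in
  \<open>R\<close>, commutes with the value \<open>[s, w]\<close> in \<open>A\<close>. Hence
  \<open>[s, _]\<close> is a function of the \<open>B\<close>-coset, which later makes lifts
  insensitive to \<open>B\<close>.\<close>

lemma comm_A_T:
  assumes "s \<in> S" "b \<in> B" "w \<in> T"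
  shows "comm s (b \<otimes> w) = comm s w"
proof -
  have [simp]: "s \<in> carrier G" "b \<in> carrier G" "w \<in> carrier G" using assms by auto
  have "comm s b = \<one>" using assms commute_S by (intro comm_eq_one) auto
  moreover have "b \<otimes> comm s w \<otimes> inv b = comm s w"
    using assms comm_S_T[of s w] commute_R[of b "comm s w"] by (intro conj_eq_self) auto
  ultimately show ?thesis by (simp add: comm_mult_right)
qed

text \<open>Both sides equal \<open>comm s' (x \<otimes> v) \<otimes> comm s u\<close>. The left
  side expands the product \<open>x v\<close> directly. The right side first rewrites
  \<open>x v\<close> as \<open>[x, u] w\<close> with \<open>w = u x u^-1 v\<close> and replaces
  \<open>[x, u]\<close> by \<open>[s, u] b\<close>, where \<open>b\<close> in \<open>B\<close>
  disappears by \<open>comm_A_T\<close>.\<close>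

lemma key_identity:
  assumes "sim s x" "sim s' y" "u \<in> T" "v \<in> T"
  shows "comm s' x \<otimes> (x \<otimes> comm s' v \<otimes> inv x) \<otimes> comm s u =
    (y \<otimes> comm s u \<otimes> inv y) \<otimes> comm s' (u \<otimes> x \<otimes> inv u \<otimes> v)"
proof -
  define z b w where "z = comm s u" and "b = inv z \<otimes> comm x u" and "w = u \<otimes> x \<otimes> inv u \<otimes> v"
  have s: "s \<in> S" "s' \<in> S" "x \<in> T" "y \<in> T" using assms sim_imp by auto
  have c [simp]: "s \<in> carrier G" "s' \<in> carrier G" "x \<in> carrier G" "y \<in> carrier G" "u \<in> carrier G" "v \<in> carrier G"
    using s assms by auto
  have z: "z \<in> A" "z \<in> carrier G" unfolding z_def using comm_S_T s assms by auto
  have b: "b \<in> B" "b \<in> carrier G" using sim_comm[OF assms(1,3)] by (auto simp: b_def z_def)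
  have w: "w \<in> T" "w \<in> carrier G" using s assms by (auto simp: w_def)
  have "x \<otimes> v = comm x u \<otimes> w" by (simp add: w_def word_simps)
  also have "comm x u = z \<otimes> b" using z by (simp add: b_def mult_inv_cancel_left)
  finally have xv: "x \<otimes> v = z \<otimes> (b \<otimes> w)" using z b w by (simp add: m_assoc)
  have "comm s' x \<otimes> (x \<otimes> comm s' v \<otimes> inv x) \<otimes> z = comm s' (x \<otimes> v) \<otimes> z"
    by (simp add: comm_mult_right)
  also have "\<dots> = comm s' z \<otimes> (z \<otimes> comm s' w \<otimes> inv z) \<otimes> z"
    unfolding xv using z b w comm_A_T[OF s(2) b(1) w(1)] by (simp add: comm_mult_right)
  also have "\<dots> = s' \<otimes> z \<otimes> inv s' \<otimes> comm s' w"
    using z w by (simp add: word_simps)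
  also have "s' \<otimes> z \<otimes> inv s' = y \<otimes> z \<otimes> inv y"
    using sim_conj[OF assms(2) z(1)] by simp
  finally show ?thesis by (simp add: z_def w_def)
qed

text \<open>Let \<open>X_u\<close> be the map sending \<open>p\<close> to
  \<open>x p x^-1 [s, u]\<close>, and \<open>Y_v\<close> the one sending \<open>p\<close> to
  \<open>y p y^-1 [s', v]\<close>. The identity says that \<open>X_u Y_v\<close> is
  \<open>Y_v' X_u\<close> followed by left multiplication by \<open>[x, s']\<close>, where
  \<open>v' = u x u^-1 v\<close>. So two such maps commute up to a left factor, provided that the
  parameter of one of them is updated; the records in the states exist to carry this update.\<close>

lemma exchange:
  assumes "sim s x" "sim s' y" "u \<in> T" "v \<in> T" "p \<in> A"
  shows "x \<otimes> (y \<otimes> p \<otimes> (inv y \<otimes> comm s' v)) \<otimes> (inv x \<otimes> comm s u) =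
    comm x s' \<otimes> (y \<otimes> (x \<otimes> p \<otimes> (inv x \<otimes> comm s u)) \<otimes> (inv y \<otimes> comm s' (u \<otimes> x \<otimes> inv u \<otimes> v)))"
proof -
  have s: "s \<in> S" "s' \<in> S" "x \<in> T" "y \<in> T" using assms sim_imp by auto
  have [simp]: "s \<in> carrier G" "s' \<in> carrier G" "x \<in> carrier G" "y \<in> carrier G" "u \<in> carrier G" "v \<in> carrier G" "p \<in> carrier G"
    using s assms by auto
  define w where "w = u \<otimes> x \<otimes> inv u \<otimes> v"
  have w [simp]: "w \<in> carrier G" by (simp add: w_def)
  define q where "q = x \<otimes> p \<otimes> inv x"
  have q: "q \<in> A" "q \<in> carrier G" unfolding q_def using conj_A_closed[of x p] assms by auto
  have 1: "y \<otimes> q \<otimes> inv y = s' \<otimes> q \<otimes> inv s'" using sim_conj[OF assms(2) q(1)] .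
  have 2: "y \<otimes> p \<otimes> inv y = s' \<otimes> p \<otimes> inv s'" using sim_conj[OF assms(2,5)] .
  have "comm x s' \<otimes> (y \<otimes> (x \<otimes> p \<otimes> (inv x \<otimes> comm s u)) \<otimes> (inv y \<otimes> comm s' w))
     = comm x s' \<otimes> (y \<otimes> q \<otimes> inv y) \<otimes> ((y \<otimes> comm s u \<otimes> inv y) \<otimes> comm s' w)"
    by (simp add: q_def word_simps)
  also have "(y \<otimes> comm s u \<otimes> inv y) \<otimes> comm s' w = comm s' x \<otimes> (x \<otimes> comm s' v \<otimes> inv x) \<otimes> comm s u"
    using key_identity[OF assms(1-4)] by (simp add: w_def)
  also have "comm x s' \<otimes> (y \<otimes> q \<otimes> inv y) \<otimes> (comm s' x \<otimes> (x \<otimes> comm s' v \<otimes> inv x) \<otimes> comm s u)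
     = x \<otimes> (s' \<otimes> p \<otimes> inv s') \<otimes> comm s' v \<otimes> inv x \<otimes> comm s u"
    unfolding 1 by (simp add: q_def word_simps)
  also have "\<dots> = x \<otimes> (y \<otimes> p \<otimes> (inv y \<otimes> comm s' v)) \<otimes> (inv x \<otimes> comm s u)"
    unfolding 2[symmetric] by (simp add: word_simps)
  finally show ?thesis by (simp add: w_def)
qed

lemma simI: "\<lbrakk>s \<in> S; x \<in> T; inv s \<otimes> x \<in> R\<rbrakk> \<Longrightarrow> sim s x"
  by (simp add: sim_def)

text \<open>Congruence modulo the normal subgroup \<open>R\<close> is compatible with products, so
  \<open>sim\<close> is a subgroup of \<open>S\<close> times \<open>T\<close>, and \<open>T0\<close>
  is its projection to \<open>T\<close>.\<close>

lemma sim_mult: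
  assumes "sim s x" "sim s' y"
  shows "sim (s \<otimes> s') (x \<otimes> y)"
proof (rule simI)
  have [simp]: "s \<in> carrier G" "s' \<in> carrier G" "x \<in> carrier G" "y \<in> carrier G"
    using assms sim_imp by auto
  show "s \<otimes> s' \<in> S" "x \<otimes> y \<in> T" using assms sim_imp by auto
  have "inv (s \<otimes> s') \<otimes> (x \<otimes> y) = (inv s' \<otimes> (inv s \<otimes> x) \<otimes> s') \<otimes> (inv s' \<otimes> y)"
    by (simp add: word_simps)
  then show "inv (s \<otimes> s') \<otimes> (x \<otimes> y) \<in> R"
    using assms sim_imp by (simp add: R.inv_op_closed1)
qed

lemma sim_inv:
  assumes "sim s x"
  shows "sim (inv s) (inv x)"
proof (rule simI)
  have [simp]: "s \<in> carrier G" "x \<in> carrier G" using assms sim_imp by auto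
  show "inv s \<in> S" "inv x \<in> T" using assms sim_imp by auto
  have "inv (inv s) \<otimes> inv x = s \<otimes> inv (inv s \<otimes> x) \<otimes> inv s"
    by (simp add: word_simps)
  then show "inv (inv s) \<otimes> inv x \<in> R"
    using sim_imp[OF assms] by (simp add: R.inv_op_closed2)
qed

lemma sim_A: "a \<in> A \<Longrightarrow> sim a a"
  by (rule simI) auto

lemma sim_B: "b \<in> B \<Longrightarrow> sim \<one> b"
  by (rule simI) auto

lemma T0_iff: "x \<in> T0 \<longleftrightarrow> (\<exists>s. sim s x)"
  unfolding T0_def sim_def by blast

lemma subgroup_T0: "subgroup T0 G"
proof (rule subgroupI)
  show "T0 \<subseteq> carrier G" using T0_in_T by auto
  show "T0 \<noteq> {}" using sim_A[of \<one>] T0_iff by auto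
next
  fix x y assume "x \<in> T0" "y \<in> T0"
  then show "x \<otimes> y \<in> T0" unfolding T0_iff using sim_mult by blast
next
  fix x assume "x \<in> T0"
  then show "inv x \<in> T0" unfolding T0_iff using sim_inv by blast
qed

sublocale T0: subgroup T0 G by (rule subgroup_T0)

lemma A_in_T0: "a \<in> A \<Longrightarrow> a \<in> T0"
  using sim_A T0_iff by blast

lemma B_in_T0: "b \<in> B \<Longrightarrow> b \<in> T0"
  using sim_B T0_iff by blast

lemma sim_comm_right:
  assumes "sim s x" "u \<in> T"
  shows "inv (comm u s) \<otimes> comm u x \<in> R"
proof -
  have [simp]: "s \<in> carrier G" "x \<in> carrier G" "u \<in> carrier G" using assms sim_imp[OF assms(1)] by auto
  have r: "inv s \<otimes> x \<in> R" using sim_imp[OF assms(1)] by simp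
  have "comm u x = comm u s \<otimes> (s \<otimes> comm u (inv s \<otimes> x) \<otimes> inv s)"
    using comm_mult_right[of u s "inv s \<otimes> x"] by (simp add: mult_inv_cancel_left)
  then have "inv (comm u s) \<otimes> comm u x = s \<otimes> comm u (inv s \<otimes> x) \<otimes> inv s"
    by (simp add: inv_mult_cancel_left)
  also have "\<dots> \<in> R"
    using comm_normal_right[OF normal_R _ r, of u] by (simp add: R.inv_op_closed2)
  finally show ?thesis .
qed

text \<open>Two choices of \<open>s\<close> are congruent to the same \<open>x\<close> modulo
  \<open>R\<close>, so they differ by an element of \<open>E\<close>, and \<open>T\<close>
  centralizes \<open>E\<close>.\<close>

lemma sim_unique:
  assumes "sim s x" "sim s' x" "t \<in> T"
  shows "comm t s = comm t s'"
proof -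
  have [simp]: "s \<in> carrier G" "s' \<in> carrier G" "x \<in> carrier G" "t \<in> carrier G"
    and s: "s \<in> S" "s' \<in> S" and r: "inv s \<otimes> x \<in> R" "inv s' \<otimes> x \<in> R"
    using assms sim_imp by auto
  define e where "e = inv s' \<otimes> s"
  have "e = (inv s' \<otimes> x) \<otimes> inv (inv s \<otimes> x)" by (simp add: e_def word_simps)
  moreover have "(inv s' \<otimes> x) \<otimes> inv (inv s \<otimes> x) \<in> R" using r by blast
  moreover have "e \<in> S" using s by (simp add: e_def)
  ultimately have e: "e \<in> R" "e \<in> S" by simp_all
  have "comm t e = \<one>" using e assms commute_T by (intro comm_eq_one) auto
  moreover have "s = s' \<otimes> e" by (simp add: e_def mult_inv_cancel_left)
  ultimately show ?thesis using e by (simp add: comm_mult_right)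
qed

section \<open>States and the elementary operations on them\<close>

definition orb where "orb p p' = (\<lambda>c. (p \<otimes> c, p' \<otimes> inv c)) ` C"

text \<open>States: an antidiagonal orbit of \<open>C\<close> on \<open>A \<times> A\<close>, and for each of the two coordinates a function that
  records, for every \<open>y\<close>, an ordered product of conjugates of the group elements that have acted so far.\<close>

definition St :: "(('a \<times> 'a) set \<times> ('a \<Rightarrow> 'a) \<times> ('a \<Rightarrow> 'a)) set" where
  "St = {(P, U, V). (\<exists>p\<in>A. \<exists>p'\<in>A. P = orb p p') \<and> (\<forall>y. U y \<in> T0) \<and> (\<forall>y. V y \<in> T0)}"

text \<open>It acts on an orbit as a set of pairs, so that no representative has to be chosen. That
  the image is again an orbit is \<open>mv_orb\<close>, which rests on \<open>C\<close> being
  central in \<open>T\<close>.\<close>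

definition mv where "mv g g' h h' P = (\<lambda>(p, p'). (g \<otimes> p \<otimes> h, g' \<otimes> p' \<otimes> h')) ` P"

text \<open>For \<open>g = x\<close> the new entry at \<open>y\<close> is the parameter
  \<open>u x u^-1 v\<close> demanded by \<open>exchange\<close>, with \<open>u = U x\<close> and
  \<open>v = U y\<close>. The relation \<open>r\<close> decides which of two elements has its
  parameter updated by the other; when \<open>r\<close> is irreflexive the entry at \<open>x\<close>
  itself stays.\<close>

definition ins :: "('a \<Rightarrow> 'a \<Rightarrow> bool) \<Rightarrow> 'a \<Rightarrow> 'a \<Rightarrow> ('a \<Rightarrow> 'a) \<Rightarrow> ('a \<Rightarrow> 'a)" where
  "ins r x g U = (\<lambda>y. if r x y then U x \<otimes> g \<otimes> inv (U x) \<otimes> U y else U y)"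

text \<open>Being the identity outside \<open>St\<close>, the operator is a permutation of the whole
  type, and relations between operators are plain equations of functions.\<close>

definition lop where
  "lop a a' = (\<lambda>(P, U, V). if (P, U, V) \<in> St then (mv a a' \<one> \<one> P, U, V) else (P, U, V))"

lemma C_commute: "\<lbrakk>c \<in> C; x \<in> T\<rbrakk> \<Longrightarrow> c \<otimes> x = x \<otimes> c"
  using C_central by simp

lemma mv_orb:
  assumes "g \<in> T" "g' \<in> T" "h \<in> T" "h' \<in> T" "p \<in> T" "p' \<in> T"
  shows "mv g g' h h' (orb p p') = orb (g \<otimes> p \<otimes> h) (g' \<otimes> p' \<otimes> h')"
proof -
  have "g \<otimes> (p \<otimes> c) \<otimes> h = g \<otimes> p \<otimes> h \<otimes> c" "g' \<otimes> (p' \<otimes> inv c) \<otimes> h' = g' \<otimes> p' \<otimes> h' \<otimes> inv c" if "c \<in> C" for c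
    using assms that C_commute[of c h] C_commute[of "inv c" h'] by (simp_all add: m_assoc)
  then show ?thesis by (simp add: mv_def orb_def image_image)
qed

text \<open>Multiplication by \<open>c\<close> permutes \<open>C\<close>, so the orbit may be
  reindexed by \<open>d \<mapsto> c \<otimes> d\<close>; centrality of \<open>C\<close> then moves
  \<open>c\<close> to the other coordinate.\<close>

lemma orb_shift:
  assumes "p \<in> T" "p' \<in> T" "c \<in> C"
  shows "orb (c \<otimes> p) p' = orb p (c \<otimes> p')"
proof -
  define f where "f = (\<lambda>d. (p \<otimes> d, c \<otimes> p' \<otimes> inv d))"
  have c: "c \<in> C" "c \<in> carrier G" "p \<in> carrier G" "p' \<in> carrier G" using assms by auto
  have 1: "c \<otimes> p \<otimes> d = p \<otimes> (c \<otimes> d)" if "d \<in> C" for d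
    using c that C_commute[OF c(1) assms(1)] by (simp add: m_assoc)
  have 2: "p' \<otimes> inv d = c \<otimes> p' \<otimes> inv (c \<otimes> d)" if d: "d \<in> C" for d
  proof -
    have [simp]: "d \<in> carrier G" using d by auto
    have "c \<otimes> p' \<otimes> inv (c \<otimes> d) = p' \<otimes> c \<otimes> inv (d \<otimes> c)"
      using C_commute[OF c(1), of p'] C_commute[OF c(1), of d] assms d by simp
    also have "\<dots> = p' \<otimes> inv d" using c by (simp add: word_simps)
    finally show ?thesis by simp
  qed
  have C_eq: "(\<lambda>d. c \<otimes> d) ` C = C"
  proof (intro equalityI subsetI)
    fix d assume d: "d \<in> C"
    then have "d = c \<otimes> (inv c \<otimes> d)" using c by (simp add: mult_inv_cancel_left)
    moreover have "inv c \<otimes> d \<in> C" using d c by auto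
    ultimately show "d \<in> (\<lambda>d. c \<otimes> d) ` C" by blast
  qed (use c in auto)
  have "orb (c \<otimes> p) p' = f ` ((\<lambda>d. c \<otimes> d) ` C)"
    unfolding orb_def f_def image_image by (rule image_cong) (use 1 2 in simp_all)
  also have "\<dots> = orb p (c \<otimes> p')"
    unfolding C_eq by (simp only: f_def orb_def)
  finally show ?thesis .
qed

text \<open>Since \<open>d = c d'\<close> with \<open>c\<close> in \<open>C\<close>, the two pairs
  differ only in the coordinate that carries \<open>c\<close>.\<close>

lemma orb_swap:
  assumes "p \<in> T" "p' \<in> T" "d \<in> T" "d' \<in> T" "inv d' \<otimes> d \<in> C"
  shows "orb (d \<otimes> p) (d' \<otimes> p') = orb (d' \<otimes> p) (d \<otimes> p')"
proof -
  define c where "c = inv d' \<otimes> d"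
  have c: "c \<in> C" using assms by (simp add: c_def)
  have "d = d' \<otimes> c" using assms by (simp add: c_def mult_inv_cancel_left)
  then have d: "d = c \<otimes> d'" using C_commute[OF c, of d'] assms by simp
  show ?thesis
    unfolding d using orb_shift[of "d' \<otimes> p" "d' \<otimes> p'" c] assms c by (simp add: m_assoc)
qed

lemma StE:
  assumes "w \<in> St"
  obtains p p' U V where "w = (orb p p', U, V)" "p \<in> A" "p' \<in> A" "\<forall>y. U y \<in> T0" "\<forall>y. V y \<in> T0"
  using assms unfolding St_def by blast

lemma StI: "\<lbrakk>p \<in> A; p' \<in> A; \<And>y. U y \<in> T0; \<And>y. V y \<in> T0\<rbrakk> \<Longrightarrow> (orb p p', U, V) \<in> St"
  by (auto simp: St_def)

lemma lop_orb:
  assumes "p \<in> A" "p' \<in> A" "\<And>y. U y \<in> T0" "\<And>y. V y \<in> T0" "a \<in> A" "a' \<in> A"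
  shows "lop a a' (orb p p', U, V) = (orb (a \<otimes> p) (a' \<otimes> p'), U, V)"
  using assms by (simp add: lop_def StI mv_orb)

lemma ins_closed: "\<lbrakk>\<And>y. U y \<in> T0; g \<in> T0\<rbrakk> \<Longrightarrow> ins r x g U y \<in> T0"
  by (auto simp: ins_def)

text \<open>Put \<open>c = U x g (U x)^-1\<close>. Inserting at \<open>y\<close> leaves
  \<open>U x\<close> alone, and inserting at \<open>x\<close> multiplies \<open>U y\<close> on the
  left by \<open>c\<close>, as well as, by transitivity, each \<open>U z\<close> with
  \<open>z\<close> behind \<open>y\<close>. In either order such an entry becomes
  \<open>c U y h (U y)^-1 U z\<close>, because the inner \<open>c^-1 c\<close> cancels. This is why
  \<open>ins\<close> inserts a conjugate and not \<open>g\<close> itself.\<close>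

lemma ins_commute:
  assumes "r x y" "\<And>x y. r x y \<Longrightarrow> \<not> r y x" "\<And>x y z. \<lbrakk>r x y; r y z\<rbrakk> \<Longrightarrow> r x z"
    and "\<And>y. U y \<in> T0" "g \<in> T0" "h \<in> T0"
  shows "ins r x g (ins r y h U) = ins r y h (ins r x g U)"
proof
  fix z
  have [simp]: "U v \<in> carrier G" "g \<in> carrier G" "h \<in> carrier G" for v
    using assms(4-6) by auto
  have "\<not> r y x" "\<not> r x x" "\<not> r y y" "r y z \<longrightarrow> r x z" using assms(1-3) by blast+
  then show "ins r x g (ins r y h U) z = ins r y h (ins r x g U) z"
    using assms(1) by (auto simp: ins_def word_simps)
qed

lemma ins_inverse:
  assumes "\<And>y. U y \<in> T0" "g \<in> T0" "\<not> r x x"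
  shows "ins r x (inv g) (ins r x g U) = U" "ins r x g (ins r x (inv g) U) = U"
proof -
  have [simp]: "U v \<in> carrier G" "g \<in> carrier G" for v
    using assms by auto
  show "ins r x (inv g) (ins r x g U) = U" "ins r x g (ins r x (inv g) U) = U"
    using assms(3) by (auto simp: ins_def word_simps fun_eq_iff)
qed

end

text \<open>Each map carries \<open>l\<close> to \<open>l'\<close>, so going forth with one and back
  with the other fixes \<open>l\<close>. It turns shared relations of two lifts into commutation
  relations of their quotient.\<close>

lemma permutes_inv_comp_commute:
  assumes "f permutes Y" "f' permutes Y" "f \<circ> l = l' \<circ> f" "f' \<circ> l = l' \<circ> f'"
  shows "(inv_into UNIV f \<circ> f') \<circ> l = l \<circ> (inv_into UNIV f \<circ> f')"
proof -
  have "inv_into UNIV f \<circ> (l' \<circ> f) = l"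
    unfolding assms(3)[symmetric] by (simp add: permutes_inv_o(2)[OF assms(1)] flip: comp_assoc)
  then have "inv_into UNIV f \<circ> l' = l \<circ> inv_into UNIV f"
    by (metis comp_assoc comp_id permutes_inv_o(1)[OF assms(1)])
  then show ?thesis
    by (metis comp_assoc assms(4))
qed

section \<open>The operators attached to elements of \<open>T0\<close> and their exchange
  relation\<close>

locale ordered_commuting_triple = commuting_triple G R S T for G (structure) and R S T +
  fixes lt :: "'a \<Rightarrow> 'a \<Rightarrow> bool" and lift :: "'a \<Rightarrow> 'a"
  assumes lt_asym: "lt x y \<Longrightarrow> \<not> lt y x"
    and lt_trans: "\<lbrakk>lt x y; lt y z\<rbrakk> \<Longrightarrow> lt x z"
    and lt_total: "x \<noteq> y \<Longrightarrow> lt x y \<or> lt y x"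
    and lift: "x \<in> T0 \<Longrightarrow> sim (lift x) x"
begin

text \<open>Each coordinate undergoes the map of \<open>exchange\<close> with the parameter
  \<open>u\<close> read from its record at \<open>x\<close>. The simultaneous insertion of
  \<open>x\<close> into the records prepares the parameters of the operators applied
  afterwards.\<close>

definition xop where
  "xop x = (\<lambda>(P, U, V). if (P, U, V) \<in> St
     then (mv x x (inv x \<otimes> comm (lift x) (U x)) (inv x \<otimes> comm (lift x) (V x)) P,
       ins lt x x U, ins (\<lambda>a b. lt b a) x x V)
     else (P, U, V))"

definition xop_inv where
  "xop_inv x = (\<lambda>(P, U, V).
     (mv (inv x) (inv x) (inv (comm (lift x) (U x)) \<otimes> x) (inv (comm (lift x) (V x)) \<otimes> x) P,
       ins lt x (inv x) U, ins (\<lambda>a b. lt b a) x (inv x) V))"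

lemma lift_S: "x \<in> T0 \<Longrightarrow> lift x \<in> S"
  using lift sim_imp by blast

lemma comm_lift: "\<lbrakk>x \<in> T0; u \<in> T\<rbrakk> \<Longrightarrow> comm (lift x) u \<in> A"
  using lift_S comm_S_T by blast

lemma conj_comm_A:
  assumes "x \<in> T0" "p \<in> A" "u \<in> T"
  shows "x \<otimes> p \<otimes> (inv x \<otimes> comm (lift x) u) \<in> A"
proof -
  have "x \<otimes> p \<otimes> (inv x \<otimes> comm (lift x) u) = (x \<otimes> p \<otimes> inv x) \<otimes> comm (lift x) u"
    using assms comm_lift[of x u] by (simp add: m_assoc)
  then show ?thesis using A_m_closed[OF conj_A_closed[of x p] comm_lift[of x u]] assms by simp
qed

lemma xop_orb:
  assumes "x \<in> T0" "p \<in> A" "p' \<in> A" "\<And>y. U y \<in> T0" "\<And>y. V y \<in> T0"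
  shows "xop x (orb p p', U, V) =
    (orb (x \<otimes> p \<otimes> (inv x \<otimes> comm (lift x) (U x))) (x \<otimes> p' \<otimes> (inv x \<otimes> comm (lift x) (V x))),
      ins lt x x U, ins (\<lambda>a b. lt b a) x x V)"
proof -
  have "comm (lift x) (U x) \<in> T" "comm (lift x) (V x) \<in> T"
    using comm_lift[of x] assms by auto
  then show ?thesis using assms by (simp add: xop_def StI mv_orb)
qed

lemma xop_inv_orb:
  assumes "x \<in> T0" "p \<in> A" "p' \<in> A" "\<And>y. U y \<in> T0" "\<And>y. V y \<in> T0"
  shows "xop_inv x (orb p p', U, V) =
    (orb (inv x \<otimes> p \<otimes> (inv (comm (lift x) (U x)) \<otimes> x)) (inv x \<otimes> p' \<otimes> (inv (comm (lift x) (V x)) \<otimes> x)),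
      ins lt x (inv x) U, ins (\<lambda>a b. lt b a) x (inv x) V)"
proof -
  have "comm (lift x) (U x) \<in> T" "comm (lift x) (V x) \<in> T"
    using comm_lift[of x] assms by auto
  then show ?thesis using assms by (simp add: xop_inv_def mv_orb)
qed

lemma xop_permutes:
  assumes x: "x \<in> T0"
  shows "xop x permutes St"
proof (rule bij_imp_permutes)
  have irr: "\<not> lt x x" using lt_asym by blast
  have xT: "x \<in> T" "x \<in> carrier G" using x by auto
  have A: "inv x \<otimes> p \<otimes> (inv (comm (lift x) u) \<otimes> x) \<in> A" if "p \<in> A" "u \<in> T" for p u
  proof -
    have "inv x \<otimes> p \<otimes> (inv (comm (lift x) u) \<otimes> x) = inv x \<otimes> (p \<otimes> inv (comm (lift x) u)) \<otimes> inv (inv x)"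
      using that comm_lift[OF x that(2)] xT by (simp add: m_assoc)
    also have "\<dots> \<in> A"
      using that comm_lift[OF x that(2)] xT by (intro conj_A_closed A_m_closed A_inv_closed) auto
    finally show ?thesis .
  qed
  have inv_inv': "x \<otimes> (inv x \<otimes> p \<otimes> (inv z \<otimes> x)) \<otimes> (inv x \<otimes> z) = p"
    "inv x \<otimes> (x \<otimes> p \<otimes> (inv x \<otimes> z)) \<otimes> (inv z \<otimes> x) = p"
    if "p \<in> carrier G" "z \<in> carrier G" for p z
    using xT that by (simp_all add: word_simps)
  \<comment> \<open>Insertion at \<open>x\<close> does not touch the entry at \<open>x\<close>, so
    \<open>xop_inv x\<close> reads back the very commutator that \<open>xop x\<close> multiplied by,
    and conversely.\<close>
  have insx: "ins r x g U x = U x" if "\<not> r x x" for r g U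
    using that by (simp add: ins_def)
  show "bij_betw (xop x) St St"
  proof (rule bij_betw_byWitness[where f' = "xop_inv x"])
    show "\<forall>w\<in>St. xop_inv x (xop x w) = w"
    proof
      fix w assume "w \<in> St"
      then obtain p p' U V where w: "w = (orb p p', U, V)" and p: "p \<in> A" "p' \<in> A"
        and U: "\<forall>y. U y \<in> T0" and V: "\<forall>y. V y \<in> T0" by (rule StE)
      have c: "comm (lift x) (U x) \<in> carrier G" "comm (lift x) (V x) \<in> carrier G"
        using comm_lift[OF x] U V by auto
      note U' = U[rule_format] and V' = V[rule_format]
      note q = conj_comm_A[OF x p(1) T0_in_T[OF U'], of x] conj_comm_A[OF x p(2) T0_in_T[OF V'], of x]
      have "p \<in> carrier G" "p' \<in> carrier G" using p by auto
      then show "xop_inv x (xop x w) = w"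
        unfolding w xop_orb[OF x p U' V'] xop_inv_orb[OF x q ins_closed[OF U' x] ins_closed[OF V' x]]
        by (simp add: ins_inverse[OF U' x] ins_inverse[OF V' x] insx irr inv_inv' c)
    qed
    show "\<forall>w\<in>St. xop x (xop_inv x w) = w"
    proof
      fix w assume "w \<in> St"
      then obtain p p' U V where w: "w = (orb p p', U, V)" and p: "p \<in> A" "p' \<in> A"
        and U: "\<forall>y. U y \<in> T0" and V: "\<forall>y. V y \<in> T0" by (rule StE)
      have c: "comm (lift x) (U x) \<in> carrier G" "comm (lift x) (V x) \<in> carrier G"
        using comm_lift[OF x] U V by auto
      note U' = U[rule_format] and V' = V[rule_format]
      note q = A[OF p(1) T0_in_T[OF U'], of x] A[OF p(2) T0_in_T[OF V'], of x]
      have xi: "inv x \<in> T0" using x by simp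
      have "p \<in> carrier G" "p' \<in> carrier G" using p by auto
      then show "xop x (xop_inv x w) = w"
        unfolding w xop_inv_orb[OF x p U' V'] xop_orb[OF x q ins_closed[OF U' xi] ins_closed[OF V' xi]]
        by (simp add: ins_inverse[OF U' x] ins_inverse[OF V' x] insx irr inv_inv' c)
    qed
    show "xop x ` St \<subseteq> St"
    proof
      fix w' assume "w' \<in> xop x ` St"
      then obtain w where w': "w' = xop x w" and "w \<in> St" by blast
      then obtain p p' U V where w: "w = (orb p p', U, V)" and p: "p \<in> A" "p' \<in> A"
        and U: "\<forall>y. U y \<in> T0" and V: "\<forall>y. V y \<in> T0" using StE by blast
      note U' = U[rule_format] and V' = V[rule_format]
      show "w' \<in> St"
        unfolding w' w xop_orb[OF x p U' V']
        by (intro StI conj_comm_A ins_closed T0_in_T x p U' V')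
    qed
    show "xop_inv x ` St \<subseteq> St"
    proof
      fix w' assume "w' \<in> xop_inv x ` St"
      then obtain w where w': "w' = xop_inv x w" and "w \<in> St" by blast
      then obtain p p' U V where w: "w = (orb p p', U, V)" and p: "p \<in> A" "p' \<in> A"
        and U: "\<forall>y. U y \<in> T0" and V: "\<forall>y. V y \<in> T0" using StE by blast
      note U' = U[rule_format] and V' = V[rule_format]
      have xi: "inv x \<in> T0" using x by simp
      show "w' \<in> St"
        unfolding w' w xop_inv_orb[OF x p U' V']
        by (intro StI A ins_closed T0_in_T xi p U' V')
    qed
  qed
qed (auto simp: xop_def)

lemma lop_mult:
  assumes "a \<in> A" "a' \<in> A" "b \<in> A" "b' \<in> A"
  shows "lop a a' \<circ> lop b b' = lop (a \<otimes> b) (a' \<otimes> b')"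
proof
  fix w
  have ab: "a \<otimes> b \<in> A" "a' \<otimes> b' \<in> A" using assms A_m_closed by blast+
  show "(lop a a' \<circ> lop b b') w = lop (a \<otimes> b) (a' \<otimes> b') w"
  proof (cases "w \<in> St")
    case True
    then obtain p p' U V where w: "w = (orb p p', U, V)" and p: "p \<in> A" "p' \<in> A"
        and U: "\<forall>y. U y \<in> T0" and V: "\<forall>y. V y \<in> T0" using StE by blast
    note U' = U[rule_format] and V' = V[rule_format]
    have q: "b \<otimes> p \<in> A" "b' \<otimes> p' \<in> A" using assms p A_m_closed by blast+
    have "p \<in> carrier G" "p' \<in> carrier G" "a \<in> carrier G" "a' \<in> carrier G" "b \<in> carrier G" "b' \<in> carrier G"
      using p assms by auto
    then show ?thesis
      unfolding w comp_apply lop_orb[OF p U' V' assms(3,4)] lop_orb[OF q U' V' assms(1,2)]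
        lop_orb[OF p U' V' ab]
      by (simp add: m_assoc)
  next
    case False
    then show ?thesis by (cases w) (simp add: lop_def)
  qed
qed

lemma lop_one: "lop \<one> \<one> = id"
proof
  fix w
  have 1: "\<one> \<in> A" by simp
  show "lop \<one> \<one> w = id w"
  proof (cases "w \<in> St")
    case True
    then obtain p p' U V where w: "w = (orb p p', U, V)" and p: "p \<in> A" "p' \<in> A"
        and U: "\<forall>y. U y \<in> T0" and V: "\<forall>y. V y \<in> T0" using StE by blast
    have "p \<in> carrier G" "p' \<in> carrier G" using p by auto
    then show ?thesis
      unfolding w lop_orb[OF p U[rule_format] V[rule_format] 1 1] by simp
  next
    case False
    then show ?thesis by (cases w) (simp add: lop_def)
  qed
qed

lemma lop_permutes:
  assumes "a \<in> A" "a' \<in> A"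
  shows "lop a a' permutes St"
proof -
  have c: "a \<in> carrier G" "a' \<in> carrier G" using assms by auto
  have inv: "inv a \<in> A" "inv a' \<in> A" using assms A_inv_closed by blast+
  have "lop (inv a) (inv a') \<circ> lop a a' = id" "lop a a' \<circ> lop (inv a) (inv a') = id"
    using lop_mult[OF inv assms] lop_mult[OF assms inv] lop_one c by simp_all
  then have "bij (lop a a')" by (rule o_bij)
  moreover have "lop a a' w = w" if "w \<notin> St" for w
    using that by (cases w) (simp add: lop_def)
  ultimately show ?thesis unfolding permutes_def bij_iff by blast
qed

text \<open>\<open>(c, c)\<close> is an antidiagonal translate of \<open>(\<one>, \<one>)\<close> only if \<open>c = inv c\<close>.\<close>

lemma lop_square:
  assumes "c \<in> C" "lop c c = id"
  shows "c \<otimes> c = \<one>"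
proof -
  have c: "c \<in> A" "c \<in> carrier G" and 1: "\<one> \<in> A" using assms by auto
  have U: "\<And>y. (\<lambda>_. \<one>) y \<in> T0" by simp
  have "orb c c = orb \<one> \<one>"
    using lop_orb[OF 1 1 U U c(1) c(1)] assms(2) c by simp
  moreover have "(c \<otimes> \<one>, c \<otimes> inv \<one>) \<in> orb c c"
    unfolding orb_def by (rule image_eqI[of _ _ \<one>]) auto
  ultimately have "(c, c) \<in> orb \<one> \<one>" using c by simp
  then obtain d where "d \<in> C" "c = \<one> \<otimes> d" "c = \<one> \<otimes> inv d" unfolding orb_def by blast
  then show ?thesis by (metis Int_iff carr(1) inv_closed l_one r_inv)
qed

text \<open>In the coordinate whose order puts \<open>x\<close> before \<open>y\<close> the lemma \<open>exchange\<close> produces \<open>[x, s\<^sub>y]\<close>, in the other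
  one \<open>[s\<^sub>x, y]\<close>.  As these agree modulo \<open>C\<close>, \<open>orb_swap\<close> allows the two coordinates to be interchanged.\<close>

lemma xop_exchange:
  assumes x: "x \<in> T0" and y: "y \<in> T0"
  shows "xop x \<circ> xop y = lop (comm (lift x) y) (comm x (lift y)) \<circ> (xop y \<circ> xop x)"
proof
  fix w
  define d d' where "d = comm (lift x) y" and "d' = comm x (lift y)"
  have yT: "x \<in> T" "y \<in> T" using x y by auto
  have carr': "x \<in> carrier G" "y \<in> carrier G" "lift x \<in> carrier G" "lift y \<in> carrier G"
    using x y lift_S by auto
  have d: "d \<in> A" "d' \<in> A"
    unfolding d_def d'_def using comm_S_T[OF lift_S[OF x] yT(2)] comm_T_S[OF lift_S[OF y] yT(1)] .
  have dT: "d \<in> T" "d' \<in> T" "d \<in> S" "d' \<in> S" "d \<in> carrier G" "d' \<in> carrier G" using d by auto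
  \<comment> \<open>Both \<open>[s_x, y]\<close> and \<open>[x, s_y]\<close> are congruent to
    \<open>[x, y]\<close> modulo \<open>R\<close>, by \<open>sim_comm\<close> and
    \<open>sim_comm_right\<close>. As they also lie in \<open>A\<close>, they agree modulo
    \<open>C\<close>.\<close>
  have dR: "inv d \<otimes> d' \<in> R" "inv d' \<otimes> d \<in> R"
  proof -
    have e: "inv d \<otimes> comm x y \<in> R" "inv d' \<otimes> comm x y \<in> R"
      using sim_comm[OF lift[OF x] yT(2)] sim_comm_right[OF lift[OF y] yT(1)] by (auto simp: d_def d'_def)
    have f: "inv d \<otimes> d' = (inv d \<otimes> comm x y) \<otimes> inv (inv d' \<otimes> comm x y)"
      "inv d' \<otimes> d = (inv d' \<otimes> comm x y) \<otimes> inv (inv d \<otimes> comm x y)"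
      using dT(5,6) comm_closed[OF carr'(1,2)]
      by (simp_all add: inv_mult_group m_assoc mult_inv_cancel_left)
    show "inv d \<otimes> d' \<in> R" "inv d' \<otimes> d \<in> R" unfolding f using e by blast+
  qed
  have dC: "inv d \<otimes> d' \<in> C" "inv d' \<otimes> d \<in> C" using dR dT by auto
  show "(xop x \<circ> xop y) w = (lop (comm (lift x) y) (comm x (lift y)) \<circ> (xop y \<circ> xop x)) w"
  proof (cases "w \<in> St")
    case False
    then show ?thesis by (cases w) (simp add: lop_def xop_def)
  next
    case True
    then obtain p p' U V where w: "w = (orb p p', U, V)" and p: "p \<in> A" "p' \<in> A"
        and U: "\<forall>y. U y \<in> T0" and V: "\<forall>y. V y \<in> T0" using StE by blast
    note U' = U[rule_format] and V' = V[rule_format]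
    let ?gt = "\<lambda>a b. lt b a"
    define pr where "pr g h q W W' = g \<otimes> (h \<otimes> q \<otimes> (inv h \<otimes> comm (lift h) (W h))) \<otimes> (inv g \<otimes> comm (lift g) (W' g))"
      for g h q and W W' :: "'a \<Rightarrow> 'a"
    note qx = conj_comm_A[OF x p(1) T0_in_T[OF U'], of x] conj_comm_A[OF x p(2) T0_in_T[OF V'], of x]
    note qy = conj_comm_A[OF y p(1) T0_in_T[OF U'], of y] conj_comm_A[OF y p(2) T0_in_T[OF V'], of y]
    have pr_A: "pr g h q W W' \<in> A" if "g \<in> T0" "h \<in> T0" "q \<in> A" "\<And>y. W y \<in> T0" "\<And>y. W' y \<in> T0" for g h q W W'
      unfolding pr_def using that by (intro conj_comm_A T0_in_T)
    have L: "(xop x \<circ> xop y) w = (orb (pr x y p U (ins lt y y U)) (pr x y p' V (ins ?gt y y V)),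
        ins lt x x (ins lt y y U), ins ?gt x x (ins ?gt y y V))"
      unfolding w comp_apply xop_orb[OF y p U' V'] xop_orb[OF x qy ins_closed[OF U' y] ins_closed[OF V' y]] pr_def ..
    have R: "(lop d d' \<circ> (xop y \<circ> xop x)) w =
       (orb (d \<otimes> pr y x p U (ins lt x x U)) (d' \<otimes> pr y x p' V (ins ?gt x x V)),
        ins lt y y (ins lt x x U), ins ?gt y y (ins ?gt x x V))"
      unfolding w comp_apply xop_orb[OF x p U' V'] xop_orb[OF y qx ins_closed[OF U' x] ins_closed[OF V' x]]
      by (subst lop_orb[OF _ _ _ _ d]) (intro conj_comm_A T0_in_T qx ins_closed U' V' x y | simp add: pr_def)+
    \<comment> \<open>This is \<open>exchange\<close> in a coordinate whose order puts
      \<open>g\<close> before \<open>h\<close>: inserting \<open>h\<close> keeps the parameter of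
      \<open>g\<close>, while inserting \<open>g\<close> changes the parameter of \<open>h\<close>
      exactly as \<open>exchange\<close> prescribes.\<close>
    have ex: "pr g h q W (ins r h h W) = comm g (lift h) \<otimes> pr h g q W (ins r g g W)"
      if "g \<in> T0" "h \<in> T0" "q \<in> A" "\<And>y. W y \<in> T0" "r g h" "\<not> r h g" for g h q W r
    proof -
      have "ins r h h W g = W g" "ins r g g W h = W g \<otimes> g \<otimes> inv (W g) \<otimes> W h"
        using that by (auto simp: ins_def)
      then show ?thesis
        unfolding pr_def using exchange[OF lift[OF that(1)] lift[OF that(2)] T0_in_T[OF that(4)] T0_in_T[OF that(4)] that(3)]
        by simp
    qed
    have inv_d: "inv d = comm y (lift x)" "inv d' = comm (lift y) x"
      using carr' by (simp_all add: d_def d'_def inv_comm)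
    have comm_ins: "ins r x x (ins r y y W) = ins r y y (ins r x x W)"
      if "r = lt \<or> r = ?gt" "\<And>y. W y \<in> T0" for r W
    proof (cases "x = y")
      case False
      have r: "\<And>x y. r x y \<Longrightarrow> \<not> r y x" "\<And>x y z. \<lbrakk>r x y; r y z\<rbrakk> \<Longrightarrow> r x z" "r x y \<or> r y x"
        using that(1) lt_asym lt_trans lt_total[OF False] by blast+
      then show ?thesis
        using ins_commute[of r x y W x y] ins_commute[of r y x W y x] that(2) x y by metis
    qed simp
    have cancel: "q = d1 \<otimes> q'" if "q' = inv d1 \<otimes> q" "d1 \<in> carrier G" "q \<in> carrier G" for q q' d1
      using that by (simp add: mult_inv_cancel_left)
    let ?Z = "pr y x p U (ins lt x x U)" and ?Z' = "pr y x p' V (ins ?gt x x V)"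
    have Z: "?Z \<in> A" "?Z' \<in> A" by (intro pr_A ins_closed x y p U' V')+
    have Z': "?Z \<in> T" "?Z' \<in> T" "?Z \<in> carrier G" "?Z' \<in> carrier G" using Z by auto
    have W: "pr x y p U (ins lt y y U) \<in> A" "pr x y p' V (ins ?gt y y V) \<in> A"
      by (intro pr_A ins_closed x y p U' V')+
    have W': "pr x y p U (ins lt y y U) \<in> carrier G" "pr x y p' V (ins ?gt y y V) \<in> carrier G"
      using W by auto
    have "orb (pr x y p U (ins lt y y U)) (pr x y p' V (ins ?gt y y V)) = orb (d \<otimes> ?Z) (d' \<otimes> ?Z')"
    proof -
      consider "x = y" | "lt x y" | "lt y x" using lt_total by blast
      then show ?thesis
      proof cases
        \<comment> \<open>Here the order decides nothing. But \<open>d\<close> and \<open>d'\<close>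
          are inverse to each other, and \<open>[x, x] = 1\<close> forces \<open>d\<close> into
          \<open>C\<close>; so \<open>d\<close> can be shifted to the second coordinate, where it
          cancels \<open>d'\<close>.\<close>
        case 1
        have d1: "d = inv d'" using inv_d(2) dT(6) unfolding d_def 1 by simp
        have "d' \<otimes> d = \<one>" "d \<otimes> d' = \<one>" unfolding d1 using dT by simp_all
        have "inv d \<otimes> comm x y \<in> R" using sim_comm[OF lift[OF x] yT(2)] by (simp add: d_def)
        then have "inv d \<in> R" using carr' dT by (simp add: 1 comm_eq_one)
        then have dC: "d \<in> C" using R.m_inv_closed[of "inv d"] dT by simp
        have "orb (d \<otimes> ?Z) (d' \<otimes> ?Z') = orb ?Z (d \<otimes> (d' \<otimes> ?Z'))"
          using orb_shift[OF _ _ dC, of ?Z "d' \<otimes> ?Z'"] Z' dT by simp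
        also have "d \<otimes> (d' \<otimes> ?Z') = ?Z'"
          unfolding d1 using Z' dT by (simp add: inv_mult_cancel_left)
        finally show ?thesis by (simp add: 1)
      next
        case 2
        have 3: "\<not> lt y x" using 2 lt_asym by blast
        have "pr x y p U (ins lt y y U) = d' \<otimes> ?Z"
          using ex[OF x y p(1) U', of lt] 2 3 by (simp add: d'_def)
        moreover have "?Z' = inv d \<otimes> pr x y p' V (ins ?gt y y V)"
          using ex[OF y x p(2) V', of ?gt] 2 3 by (simp add: inv_d)
        ultimately show ?thesis
          using cancel[of ?Z' d] dT W' orb_swap[OF Z'(1,2) dT(1,2) dC(2)] by simp
      next
        case 3
        have 2: "\<not> lt x y" using 3 lt_asym by blast
        have "pr x y p' V (ins ?gt y y V) = d' \<otimes> ?Z'"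
          using ex[OF x y p(2) V', of ?gt] 2 3 by (simp add: d'_def)
        moreover have "?Z = inv d \<otimes> pr x y p U (ins lt y y U)"
          using ex[OF y x p(1) U', of lt] 2 3 by (simp add: inv_d)
        ultimately show ?thesis
          using cancel[of ?Z d] dT W' by simp
      qed
    qed
    then show ?thesis
      unfolding d_def[symmetric] d'_def[symmetric] L R using comm_ins[OF _ U', of lt] comm_ins[OF _ V', of ?gt] by simp
  qed
qed

section \<open>The commutant of the operators and the lifts of elements of \<open>T0\<close>\<close>

definition central where
  "central w \<longleftrightarrow> w permutes St \<and> (\<forall>a\<in>A. \<forall>a'\<in>A. w \<circ> lop a a' = lop a a' \<circ> w) \<and>
     (\<forall>p\<in>T0. w \<circ> xop p = xop p \<circ> w)"

text \<open>\<open>lifts \<beta> y\<close> collects the relations satisfied by \<open>xop y\<close>.  They determine \<open>\<beta>\<close> up to a factor in the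
  abelian group \<open>centre\<close> (lemma \<open>lifts_diff\<close>), in which \<open>\<phi>\<close> takes its values.\<close>

definition lifts where
  "lifts \<beta> y \<longleftrightarrow> \<beta> permutes St \<and> y \<in> T0 \<and>
     (\<forall>a\<in>A. \<forall>a'\<in>A. \<beta> \<circ> lop a a' = lop (y \<otimes> a \<otimes> inv y) (y \<otimes> a' \<otimes> inv y) \<circ> \<beta>) \<and>
     (\<forall>p\<in>T0. \<forall>s. sim s y \<longrightarrow> xop p \<circ> \<beta> = lop (comm (lift p) y) (comm p s) \<circ> (\<beta> \<circ> xop p)) \<and>
     (\<forall>w. central w \<longrightarrow> w \<circ> \<beta> = \<beta> \<circ> w)"

text \<open>This is the centre of the commutant of all \<open>lop\<close> and \<open>xop\<close> in
  the permutations of \<open>St\<close>. Passing to the centre supplies the commutativity that an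
  additive extension to the group ring requires of its target.\<close>

definition centre :: "((('a \<times> 'a) set \<times> ('a \<Rightarrow> 'a) \<times> ('a \<Rightarrow> 'a)) \<Rightarrow> _) monoid" where
  "centre = \<lparr>carrier = {z. central z \<and> (\<forall>w. central w \<longrightarrow> z \<circ> w = w \<circ> z)},
     monoid.mult = (\<circ>), one = id\<rparr>"

lemma centre_simps:
  "z \<in> carrier centre \<longleftrightarrow> central z \<and> (\<forall>w. central w \<longrightarrow> z \<circ> w = w \<circ> z)"
  "x \<otimes>\<^bsub>centre\<^esub> y = x \<circ> y" "\<one>\<^bsub>centre\<^esub> = id"
  by (simp_all add: centre_def)

declare centre_simps(2,3) [simp]

lemma central_permutes: "central w \<Longrightarrow> w permutes St"
  by (simp add: central_def)

lemma comp_commute_trans: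
  assumes "x \<circ> l = l \<circ> x" "y \<circ> l = l \<circ> y"
  shows "(x \<circ> y) \<circ> l = l \<circ> (x \<circ> y)"
  using assms by (metis comp_assoc)

lemma comp_commute_inv:
  assumes "x permutes Y" "x \<circ> l = l \<circ> x"
  shows "inv_into UNIV x \<circ> l = l \<circ> inv_into UNIV x"
  using permutes_inv_comp_commute[OF assms(1) permutes_id assms(2)] by simp

lemma central_comp: "\<lbrakk>central x; central y\<rbrakk> \<Longrightarrow> central (x \<circ> y)"
  unfolding central_def using permutes_compose comp_commute_trans by blast

lemma central_inv: "central x \<Longrightarrow> central (inv_into UNIV x)"
  unfolding central_def using comp_commute_inv[of x] permutes_inv[of x] by blast

lemma centreD:
  assumes "z \<in> carrier centre"
  shows centre_central: "central z" and centre_commute: "central w \<Longrightarrow> z \<circ> w = w \<circ> z"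
  using assms unfolding centre_simps by blast+

lemma centreI: "\<lbrakk>central z; \<And>w. central w \<Longrightarrow> z \<circ> w = w \<circ> z\<rbrakk> \<Longrightarrow> z \<in> carrier centre"
  unfolding centre_simps by blast

lemma comm_group_centre: "comm_group centre"
proof (rule comm_groupI)
  fix x y assume xy: "x \<in> carrier centre" "y \<in> carrier centre"
  show "x \<otimes>\<^bsub>centre\<^esub> y \<in> carrier centre"
    unfolding centre_simps(2)
    using comp_commute_trans[OF centre_commute[OF xy(1)] centre_commute[OF xy(2)]]
    by (rule centreI[OF central_comp[OF centre_central[OF xy(1)] centre_central[OF xy(2)]]])
  show "x \<otimes>\<^bsub>centre\<^esub> y = y \<otimes>\<^bsub>centre\<^esub> x"
    unfolding centre_simps(2) by (rule centre_commute[OF xy(1) centre_central[OF xy(2)]])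
next
  show "\<one>\<^bsub>centre\<^esub> \<in> carrier centre" by (intro centreI) (simp_all add: central_def permutes_id)
next
  fix x assume x: "x \<in> carrier centre"
  then have p: "x permutes St" using central_permutes centre_central by blast
  have "inv_into UNIV x \<in> carrier centre"
    using comp_commute_inv[OF p centre_commute[OF x]]
    by (rule centreI[OF central_inv[OF centre_central[OF x]]])
  moreover have "inv_into UNIV x \<otimes>\<^bsub>centre\<^esub> x = \<one>\<^bsub>centre\<^esub>"
    using permutes_inv_o(2)[OF p] by simp
  ultimately show "\<exists>y\<in>carrier centre. y \<otimes>\<^bsub>centre\<^esub> x = \<one>\<^bsub>centre\<^esub>" by blast
qed (simp_all add: comp_assoc)

lemma liftsD:
  assumes "lifts \<beta> y"
  shows lifts_permutes: "\<beta> permutes St" and lifts_T0: "y \<in> T0"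
    and lifts_lop: "\<lbrakk>a \<in> A; a' \<in> A\<rbrakk> \<Longrightarrow> \<beta> \<circ> lop a a' = lop (y \<otimes> a \<otimes> inv y) (y \<otimes> a' \<otimes> inv y) \<circ> \<beta>"
    and lifts_xop: "\<lbrakk>p \<in> T0; sim s y\<rbrakk> \<Longrightarrow> xop p \<circ> \<beta> = lop (comm (lift p) y) (comm p s) \<circ> (\<beta> \<circ> xop p)"
    and lifts_central: "central w \<Longrightarrow> w \<circ> \<beta> = \<beta> \<circ> w"
  using assms unfolding lifts_def by blast+

lemma xop_lop:
  assumes x: "x \<in> T0" and a: "a \<in> A" "a' \<in> A"
  shows "xop x \<circ> lop a a' = lop (x \<otimes> a \<otimes> inv x) (x \<otimes> a' \<otimes> inv x) \<circ> xop x"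
proof
  fix w
  show "(xop x \<circ> lop a a') w = (lop (x \<otimes> a \<otimes> inv x) (x \<otimes> a' \<otimes> inv x) \<circ> xop x) w"
  proof (cases "w \<in> St")
    case False
    then show ?thesis by (cases w) (simp add: lop_def xop_def)
  next
    case True
    then obtain p p' U V where w: "w = (orb p p', U, V)" and p: "p \<in> A" "p' \<in> A"
        and U: "\<forall>y. U y \<in> T0" and V: "\<forall>y. V y \<in> T0" using StE by blast
    note U' = U[rule_format] and V' = V[rule_format]
    have xc: "x \<in> carrier G" using x by simp
    note ap = A_m_closed[OF a(1) p(1)] A_m_closed[OF a(2) p(2)]
    note q = conj_comm_A[OF x p(1) T0_in_T[OF U'], of x] conj_comm_A[OF x p(2) T0_in_T[OF V'], of x]
    note c = conj_A_closed[OF xc a(1)] conj_A_closed[OF xc a(2)]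
    have z: "comm (lift x) (U x) \<in> carrier G" "comm (lift x) (V x) \<in> carrier G"
      using comm_lift[OF x T0_in_T[OF U'], of x] comm_lift[OF x T0_in_T[OF V'], of x] by auto
    have "p \<in> carrier G" "p' \<in> carrier G" "a \<in> carrier G" "a' \<in> carrier G" using p a by auto
    then show ?thesis
      unfolding w comp_apply lop_orb[OF p U' V' a] xop_orb[OF x ap U' V'] xop_orb[OF x p U' V']
        lop_orb[OF q ins_closed[OF U' x] ins_closed[OF V' x] c]
      using xc z by (simp add: m_assoc inv_mult_cancel_left)
  qed
qed

lemma lifts_xop_self:
  assumes y: "y \<in> T0"
  shows "lifts (xop y) y"
proof -
  have "xop p \<circ> xop y = lop (comm (lift p) y) (comm p s) \<circ> (xop y \<circ> xop p)" if p: "p \<in> T0" and s: "sim s y" for p s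
    using xop_exchange[OF p y] sim_unique[OF lift[OF y] s, of p] p by simp
  moreover have "w \<circ> xop y = xop y \<circ> w" if "central w" for w
    using that y unfolding central_def by blast
  ultimately show ?thesis
    unfolding lifts_def using xop_permutes[OF y] xop_lop[OF y] y by blast
qed

text \<open>An element \<open>a\<close> of \<open>A\<close> is congruent to itself, and
  \<open>p\<close> and \<open>lift p\<close> conjugate it alike. So both commutators in the relation
  equal \<open>p a p^-1 a^-1\<close>, and the relation reduces to \<open>xop_lop\<close>.\<close>

lemma lifts_lop_self:
  assumes a: "a \<in> A"
  shows "lifts (lop a a) a"
proof -
  have aT: "a \<in> T0" using A_in_T0[OF a] .
  have ac: "a \<in> carrier G" using a by auto
  have 1: "lop a a \<circ> lop b b' = lop (a \<otimes> b \<otimes> inv a) (a \<otimes> b' \<otimes> inv a) \<circ> lop a a" if b: "b \<in> A" "b' \<in> A" for b b'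
  proof -
    have "b \<in> carrier G" "b' \<in> carrier G" using b by auto
    then show ?thesis
      unfolding lop_mult[OF a a b] lop_mult[OF conj_A_closed[OF ac b(1)] conj_A_closed[OF ac b(2)] a a]
      using ac by (simp add: m_assoc)
  qed
  have 2: "xop p \<circ> lop a a = lop (comm (lift p) a) (comm p s) \<circ> (lop a a \<circ> xop p)"
    if p: "p \<in> T0" and s: "sim s a" for p s
  proof -
    have pc: "p \<in> carrier G" "lift p \<in> carrier G" using p lift_S by auto
    have "comm p s = comm p a" using sim_unique[OF s sim_A[OF a]] p by simp
    moreover have "comm p a \<otimes> a = p \<otimes> a \<otimes> inv p" "comm (lift p) a \<otimes> a = lift p \<otimes> a \<otimes> inv (lift p)"
      using pc ac by (simp_all add: comm_def m_assoc)
    moreover have "lift p \<otimes> a \<otimes> inv (lift p) = p \<otimes> a \<otimes> inv p" using sim_conj[OF lift[OF p] a] by simp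
    moreover have "comm (lift p) a \<in> A" "comm p a \<in> A"
      using comm_lift[OF p, of a] comm_T_S[of a p] p a by auto
    ultimately show ?thesis
      unfolding xop_lop[OF p a a] by (simp only: comp_assoc[symmetric] lop_mult[OF _ _ a a])
  qed
  have "w \<circ> lop a a = lop a a \<circ> w" if "central w" for w
    using that a unfolding central_def by blast
  then show ?thesis
    unfolding lifts_def using lop_permutes[OF a a] aT 1 2 by blast
qed

text \<open>Moving \<open>xop p\<close> past both factors collects \<open>[_, y]\<close> and the
  \<open>y\<close>-conjugate of \<open>[_, y']\<close>, which is the expansion of a commutator with
  a product. In the second coordinate \<open>y\<close> conjugates like \<open>lift y\<close>, and
  \<open>lift y \<otimes> lift y'\<close> is a valid choice for \<open>y \<otimes> y'\<close> by
  \<open>sim_mult\<close>.\<close>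

lemma lifts_mult:
  assumes b: "lifts \<beta> y" and b': "lifts \<beta>' y'"
  shows "lifts (\<beta> \<circ> \<beta>') (y \<otimes> y')"
proof -
  have y: "y \<in> T0" "y' \<in> T0" using lifts_T0 b b' by auto
  have yc: "y \<in> carrier G" "y' \<in> carrier G" using y by auto
  have 1: "(\<beta> \<circ> \<beta>') \<circ> lop a a' = lop (y \<otimes> y' \<otimes> a \<otimes> inv (y \<otimes> y')) (y \<otimes> y' \<otimes> a' \<otimes> inv (y \<otimes> y')) \<circ> (\<beta> \<circ> \<beta>')"
    if a: "a \<in> A" "a' \<in> A" for a a'
  proof -
    have ac: "a \<in> carrier G" "a' \<in> carrier G" using a by auto
    have "(\<beta> \<circ> \<beta>') \<circ> lop a a' = \<beta> \<circ> (\<beta>' \<circ> lop a a')" by (simp add: comp_assoc)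
    also have "\<dots> = (\<beta> \<circ> lop (y' \<otimes> a \<otimes> inv y') (y' \<otimes> a' \<otimes> inv y')) \<circ> \<beta>'"
      unfolding lifts_lop[OF b' a] by (simp add: comp_assoc)
    also have "\<dots> = lop (y \<otimes> (y' \<otimes> a \<otimes> inv y') \<otimes> inv y) (y \<otimes> (y' \<otimes> a' \<otimes> inv y') \<otimes> inv y) \<circ> \<beta> \<circ> \<beta>'"
      unfolding lifts_lop[OF b conj_A_closed[OF yc(2) a(1)] conj_A_closed[OF yc(2) a(2)]] ..
    also have "\<dots> = lop (y \<otimes> y' \<otimes> a \<otimes> inv (y \<otimes> y')) (y \<otimes> y' \<otimes> a' \<otimes> inv (y \<otimes> y')) \<circ> \<beta> \<circ> \<beta>'"
      using yc ac by (simp add: m_assoc inv_mult_group)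
    finally show ?thesis by (simp only: comp_assoc)
  qed
  have 2: "xop p \<circ> (\<beta> \<circ> \<beta>') = lop (comm (lift p) (y \<otimes> y')) (comm p s) \<circ> ((\<beta> \<circ> \<beta>') \<circ> xop p)"
    if p: "p \<in> T0" and s: "sim s (y \<otimes> y')" for p s
  proof -
    let ?s = "lift y" and ?s' = "lift y'"
    note sl = lift[OF y(1)] lift[OF y(2)]
    have pc: "p \<in> carrier G" "lift p \<in> carrier G" "?s \<in> carrier G" "?s' \<in> carrier G" using p y lift_S by auto
    have c: "comm (lift p) y \<in> A" "comm (lift p) y' \<in> A" "comm p ?s \<in> A" "comm p ?s' \<in> A"
      using comm_lift[OF p] comm_T_S[OF lift_S] p y by auto
    have conj: "y \<otimes> comm p ?s' \<otimes> inv y = ?s \<otimes> comm p ?s' \<otimes> inv ?s"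
      using sim_conj[OF sl(1) c(4)] .
    have "xop p \<circ> (\<beta> \<circ> \<beta>') = lop (comm (lift p) y) (comm p ?s) \<circ> (\<beta> \<circ> (xop p \<circ> \<beta>'))"
      unfolding comp_assoc[symmetric] lifts_xop[OF b p sl(1)] ..
    also have "\<dots> = lop (comm (lift p) y) (comm p ?s) \<circ> ((\<beta> \<circ> lop (comm (lift p) y') (comm p ?s')) \<circ> \<beta>' \<circ> xop p)"
      unfolding lifts_xop[OF b' p sl(2)] by (simp only: comp_assoc)
    also have "\<dots> = (lop (comm (lift p) y) (comm p ?s) \<circ> lop (y \<otimes> comm (lift p) y' \<otimes> inv y) (y \<otimes> comm p ?s' \<otimes> inv y)) \<circ> ((\<beta> \<circ> \<beta>') \<circ> xop p)"
      unfolding lifts_lop[OF b c(2,4)] by (simp only: comp_assoc)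
    also have "lop (comm (lift p) y) (comm p ?s) \<circ> lop (y \<otimes> comm (lift p) y' \<otimes> inv y) (y \<otimes> comm p ?s' \<otimes> inv y)
       = lop (comm (lift p) (y \<otimes> y')) (comm p (?s \<otimes> ?s'))"
      unfolding lop_mult[OF c(1,3) conj_A_closed[OF yc(1) c(2)] conj_A_closed[OF yc(1) c(4)]]
      unfolding conj using pc yc by (simp add: comm_mult_right)
    also have "comm p (?s \<otimes> ?s') = comm p s"
      using sim_unique[OF sim_mult[OF sl] s] p by simp
    finally show ?thesis .
  qed
  have "w \<circ> (\<beta> \<circ> \<beta>') = (\<beta> \<circ> \<beta>') \<circ> w" if "central w" for w
    using lifts_central[OF b that] lifts_central[OF b' that] by (metis comp_assoc)
  then show ?thesis
    unfolding lifts_def using lifts_permutes[OF b] lifts_permutes[OF b'] permutes_compose y 1 2 by blast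
qed

text \<open>The relations cannot see a factor \<open>b\<close> in \<open>B\<close>: it centralizes
  \<open>A\<close>, leaves \<open>[lift p, y]\<close> unchanged by \<open>comm_A_T\<close>, and lies
  in \<open>R\<close>, so the same \<open>s\<close> remain congruent to \<open>y\<close>.\<close>

lemma lifts_B:
  assumes "lifts \<beta> y" and b: "b \<in> B"
  shows "lifts \<beta> (b \<otimes> y)"
proof -
  have y: "y \<in> T0" "y \<in> T" "y \<in> carrier G" using lifts_T0 assms by auto
  have bc: "b \<in> carrier G" "b \<in> R" using b by auto
  have 1: "b \<otimes> y \<otimes> a \<otimes> inv (b \<otimes> y) = y \<otimes> a \<otimes> inv y" if "a \<in> A" for a
  proof -
    have z: "y \<otimes> a \<otimes> inv y \<in> A" using conj_A_closed[OF y(3) that] .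
    have "b \<otimes> y \<otimes> a \<otimes> inv (b \<otimes> y) = b \<otimes> (y \<otimes> a \<otimes> inv y) \<otimes> inv b"
      using that bc y by (simp add: word_simps)
    also have "\<dots> = y \<otimes> a \<otimes> inv y" using z bc commute_R by (intro conj_eq_self) auto
    finally show ?thesis .
  qed
  have 2: "sim s y" if s: "sim s (b \<otimes> y)" for s
  proof (rule simI)
    show "s \<in> S" "y \<in> T" using sim_imp[OF s] y by auto
    then have sc: "s \<in> carrier G" by simp
    have "inv s \<otimes> y = (inv s \<otimes> inv b \<otimes> s) \<otimes> (inv s \<otimes> (b \<otimes> y))"
      using sc bc y by (simp add: word_simps)
    then show "inv s \<otimes> y \<in> R"
      using sim_imp[OF s] bc sc by (simp add: R.inv_op_closed1)
  qed
  have 3: "comm (lift p) (b \<otimes> y) = comm (lift p) y" if "p \<in> T0" for p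
    using comm_A_T[OF lift_S[OF that] b y(2)] .
  have 4: "b \<otimes> y \<in> T0" using B_in_T0[OF b] y by blast
  note a = assms(1)
  show ?thesis
    unfolding lifts_def
  proof (intro conjI ballI allI impI)
    show "\<beta> permutes St" "b \<otimes> y \<in> T0" using lifts_permutes[OF a] 4 .
  next
    fix a a' assume aa: "a \<in> A" "a' \<in> A"
    show "\<beta> \<circ> lop a a' = lop (b \<otimes> y \<otimes> a \<otimes> inv (b \<otimes> y)) (b \<otimes> y \<otimes> a' \<otimes> inv (b \<otimes> y)) \<circ> \<beta>"
      unfolding 1[OF aa(1)] 1[OF aa(2)] by (rule lifts_lop[OF assms(1) aa])
  next
    fix p s assume p: "p \<in> T0" and s: "sim s (b \<otimes> y)"
    show "xop p \<circ> \<beta> = lop (comm (lift p) (b \<otimes> y)) (comm p s) \<circ> (\<beta> \<circ> xop p)"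
      unfolding 3[OF p] by (rule lifts_xop[OF assms(1) p 2[OF s]])
  next
    fix w assume "central w"
    then show "w \<circ> \<beta> = \<beta> \<circ> w" by (rule lifts_central[OF assms(1)])
  qed
qed

text \<open>The relations with \<open>lop\<close> and \<open>xop\<close> put the quotient into the
  commutant. The last clause of \<open>lifts\<close>, that a lift commutes with the whole commutant,
  puts it into the centre.\<close>

lemma lifts_diff:
  assumes b: "lifts \<beta> y" and b': "lifts \<beta>' y"
  shows "inv_into UNIV \<beta> \<circ> \<beta>' \<in> carrier centre"
proof -
  have y: "y \<in> T0" using lifts_T0[OF b] .
  note p = lifts_permutes[OF b] lifts_permutes[OF b']
  let ?z = "inv_into UNIV \<beta> \<circ> \<beta>'"
  have 1: "?z \<circ> lop a a' = lop a a' \<circ> ?z" if "a \<in> A" "a' \<in> A" for a a'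
    using permutes_inv_comp_commute[OF p lifts_lop[OF b that] lifts_lop[OF b' that]] .
  have 2: "?z \<circ> xop q = xop q \<circ> ?z" if q: "q \<in> T0" for q
  proof -
    let ?K = "lop (comm (lift q) y) (comm q (lift y))"
    have K: "?K permutes St"
      by (rule lop_permutes[OF comm_lift[OF q T0_in_T[OF y]] comm_T_S[OF lift_S[OF y] T0_in_T[OF q]]])
    \<comment> \<open>Solved for \<open>\<gamma> \<circ> xop q\<close>, the exchange relation says
      that every lift of \<open>y\<close> intertwines \<open>xop q\<close> with one and the same
      operator.\<close>
    have "\<gamma> \<circ> xop q = (inv_into UNIV ?K \<circ> xop q) \<circ> \<gamma>" if "lifts \<gamma> y" for \<gamma>
      unfolding comp_assoc lifts_xop[OF that q lift[OF y]]
      by (simp only: permutes_inv_o(2)[OF K] id_comp flip: comp_assoc)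
    then show ?thesis
      using permutes_inv_comp_commute[OF p] b b' by blast
  qed
  have c: "?z permutes St" by (rule permutes_compose[OF p(2) permutes_inv[OF p(1)]])
  have 3: "?z \<circ> w = w \<circ> ?z" if w: "central w" for w
    by (rule comp_commute_trans[OF comp_commute_inv[OF p(1)]]) (rule lifts_central[OF _ w, symmetric], rule b b')+
  have "central ?z" unfolding central_def using c 1 2 by blast
  then show ?thesis using 3 by (rule centreI)
qed

lemma lop_C_centre:
  assumes c: "c \<in> C"
  shows "lop c c \<in> carrier centre"
proof -
  have cA: "c \<in> A" using c by auto
  have cc: "c \<in> carrier G" using c by auto
  have 1: "lop c c \<circ> lop a a' = lop a a' \<circ> lop c c" if a: "a \<in> A" "a' \<in> A" for a a'
    unfolding lop_mult[OF cA cA a] lop_mult[OF a cA cA] using C_commute[OF c] a by simp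
  have 2: "lop c c \<circ> xop p = xop p \<circ> lop c c" if p: "p \<in> T0" for p
  proof -
    have "p \<otimes> c \<otimes> inv p = c" using C_commute[OF c, of p] p cc by (intro conj_eq_self) auto
    then show ?thesis using xop_lop[OF p cA cA] by simp
  qed
  have 3: "lop c c \<circ> w = w \<circ> lop c c" if "central w" for w
    using that cA unfolding central_def by simp
  show ?thesis
  proof (rule centreI[OF _ 3])
    show "central (lop c c)" unfolding central_def using 1 2 lop_permutes[OF cA cA] by blast
  qed
qed

section \<open>Two systems of lifts and their discrepancy\<close>

lemma some_rcos:
  assumes "subgroup H G" "x \<in> carrier G"
  shows "\<exists>h\<in>H. (SOME u. u \<in> H #> x) = h \<otimes> x"
proof -
  have "x \<in> H #> x" using assms subgroup.one_closed by (force simp: r_coset_def)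
  then have "(SOME u. u \<in> H #> x) \<in> H #> x" by (rule someI)
  then show ?thesis by (auto simp: r_coset_def)
qed

lemma rcos_absorb:
  assumes "subgroup H G" "h \<in> H" "x \<in> carrier G"
  shows "H #> (h \<otimes> x) = H #> x"
  using assms coset_join2[of h H] coset_mult_assoc[of H h x] subgroup.subset[OF assms(1)]
  by (metis subgroup.mem_carrier)

lemma subgroup_A: "subgroup A G" and subgroup_B: "subgroup B G"
  by (simp_all add: R.subgroup_axioms S.subgroup_axioms T.subgroup_axioms subgroups_Inter_pair)

text \<open>\<open>il\<close> is a choice of lifts that is constant on cosets of \<open>B\<close>, \<open>jl\<close> one that is equivariant under \<open>A\<close>.\<close>

definition rB where "rB z = (SOME u. u \<in> B #> z)"
definition rA where "rA y = (SOME u. u \<in> A #> y)"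
definition il where "il z = xop (rB z)"
definition jl where "jl y = lop (y \<otimes> inv (rA y)) (y \<otimes> inv (rA y)) \<circ> xop (rA y)"

lemma lifts_il:
  assumes z: "z \<in> T0"
  shows "lifts (il z) z"
proof -
  have zc: "z \<in> carrier G" using z by simp
  obtain b where b: "b \<in> B" "rB z = b \<otimes> z"
    using some_rcos[OF subgroup_B zc] by (auto simp: rB_def)
  have bc: "b \<in> carrier G" using b by auto
  have "b \<otimes> z \<in> T0" using B_in_T0[OF b(1)] z by blast
  then have "lifts (xop (rB z)) (b \<otimes> z)" using lifts_xop_self b(2) by simp
  moreover have "inv b \<in> B" using b(1) by auto
  ultimately have "lifts (xop (rB z)) (inv b \<otimes> (b \<otimes> z))" by (rule lifts_B)
  then show ?thesis using bc zc by (simp add: il_def inv_mult_cancel_left)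
qed

lemma il_B: "\<lbrakk>b \<in> B; z \<in> carrier G\<rbrakk> \<Longrightarrow> il (b \<otimes> z) = il z"
  by (simp add: il_def rB_def rcos_absorb[OF subgroup_B])

lemma rA_E:
  assumes "y \<in> T0"
  obtains "y \<otimes> inv (rA y) \<in> A" "rA y \<in> T0"
proof -
  have yc: "y \<in> carrier G" using assms by simp
  obtain a where a: "a \<in> A" "rA y = a \<otimes> y"
    using some_rcos[OF subgroup_A yc] by (auto simp: rA_def)
  have ac: "a \<in> carrier G" using a by auto
  have "y \<otimes> inv (rA y) = inv a" using a(2) ac yc by (simp add: word_simps)
  then have "y \<otimes> inv (rA y) \<in> A" using A_inv_closed[OF a(1)] by simp
  moreover have "rA y \<in> T0" using A_in_T0[OF a(1)] assms a(2) by simp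
  ultimately show ?thesis using that by blast
qed

lemma lifts_jl:
  assumes y: "y \<in> T0"
  shows "lifts (jl y) y"
proof (rule rA_E[OF y])
  assume a: "y \<otimes> inv (rA y) \<in> A" and r: "rA y \<in> T0"
  have "lifts (jl y) (y \<otimes> inv (rA y) \<otimes> rA y)"
    unfolding jl_def by (rule lifts_mult[OF lifts_lop_self[OF a] lifts_xop_self[OF r]])
  moreover have "y \<in> carrier G" "rA y \<in> carrier G" using y r by auto
  ultimately show ?thesis by (simp add: m_assoc)
qed

lemma jl_A:
  assumes a: "a \<in> A" and y: "y \<in> T0"
  shows "jl (a \<otimes> y) = lop a a \<circ> jl y"
proof (rule rA_E[OF y])
  assume b: "y \<otimes> inv (rA y) \<in> A" and r: "rA y \<in> T0"
  have c: "a \<in> carrier G" "y \<in> carrier G" "rA y \<in> carrier G" using a y r by auto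
  have "rA (a \<otimes> y) = rA y" using rcos_absorb[OF subgroup_A a c(2)] by (simp add: rA_def)
  then show ?thesis
    unfolding jl_def using c by (simp add: lop_mult[OF a a b b] m_assoc flip: comp_assoc)
qed

text \<open>Left cosets of \<open>T0\<close> are used so that \<open>t\<close> and
  \<open>t \<otimes> \<theta>\<close> share a representative. Left factors from \<open>A\<close> or
  \<open>B\<close> keep it too, because their conjugates under \<open>t\<close> lie in
  \<open>T0\<close> (\<open>tr_left\<close>).\<close>

definition tr where "tr t = (SOME u. u \<in> t <# T0)"

lemma tr_E:
  assumes "t \<in> T"
  obtains "tr t \<in> T" "inv (tr t) \<otimes> t \<in> T0"
proof -
  have tc: "t \<in> carrier G" using assms by simp
  have "t \<in> t <# T0" using tc by (force simp: l_coset_def)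
  then have "tr t \<in> t <# T0" unfolding tr_def by (rule someI)
  then obtain x where x: "x \<in> T0" "tr t = t \<otimes> x" by (auto simp: l_coset_def)
  have xc: "x \<in> carrier G" using x by simp
  have "inv (tr t) \<otimes> t = inv x" using x xc tc by (simp add: word_simps)
  then show ?thesis using that x assms by simp
qed

lemma lcos_T0_absorb: "\<lbrakk>t \<in> carrier G; \<theta> \<in> T0\<rbrakk> \<Longrightarrow> (t \<otimes> \<theta>) <# T0 = t <# T0"
proof
  assume t: "t \<in> carrier G" and th: "\<theta> \<in> T0"
  have thc: "\<theta> \<in> carrier G" using th by simp
  show "(t \<otimes> \<theta>) <# T0 \<subseteq> t <# T0"
  proof
    fix u assume "u \<in> (t \<otimes> \<theta>) <# T0"
    then obtain x where "x \<in> T0" "u = t \<otimes> \<theta> \<otimes> x" by (auto simp: l_coset_def)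
    then have "\<theta> \<otimes> x \<in> T0" "u = t \<otimes> (\<theta> \<otimes> x)" using t th by (auto simp: m_assoc)
    then show "u \<in> t <# T0" by (auto simp: l_coset_def)
  qed
  show "t <# T0 \<subseteq> (t \<otimes> \<theta>) <# T0"
  proof
    fix u assume "u \<in> t <# T0"
    then obtain x where x: "x \<in> T0" "u = t \<otimes> x" by (auto simp: l_coset_def)
    have "inv \<theta> \<otimes> x \<in> T0" using x th by simp
    moreover have "u = t \<otimes> \<theta> \<otimes> (inv \<theta> \<otimes> x)" using x t thc by (simp add: word_simps)
    ultimately show "u \<in> (t \<otimes> \<theta>) <# T0" by (auto simp: l_coset_def)
  qed
qed

lemma tr_right: "\<lbrakk>t \<in> T; \<theta> \<in> T0\<rbrakk> \<Longrightarrow> tr (t \<otimes> \<theta>) = tr t"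
  by (simp add: tr_def lcos_T0_absorb)

lemma conj_inv_A: "\<lbrakk>x \<in> carrier G; a \<in> A\<rbrakk> \<Longrightarrow> inv x \<otimes> a \<otimes> x \<in> A"
  by (simp add: S.inv_op_closed1 T.inv_op_closed1)

lemma conj_inv_B: "\<lbrakk>x \<in> carrier G; b \<in> B\<rbrakk> \<Longrightarrow> inv x \<otimes> b \<otimes> x \<in> B"
  by (simp add: R.inv_op_closed1 T.inv_op_closed1)

lemma tr_left:
  assumes t: "t \<in> T" and x: "x \<in> A \<or> x \<in> B"
  shows "tr (x \<otimes> t) = tr t"
proof -
  have c: "t \<in> carrier G" "x \<in> carrier G" using assms by auto
  have "inv t \<otimes> x \<otimes> t \<in> T0"
    using x conj_inv_A[OF c(1), of x] conj_inv_B[OF c(1), of x] A_in_T0 B_in_T0 by blast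
  moreover have "x \<otimes> t = t \<otimes> (inv t \<otimes> x \<otimes> t)" using c by (simp add: word_simps)
  ultimately show ?thesis using tr_right[OF t] by simp
qed

text \<open>\<open>iT\<close> and \<open>jT\<close> transport \<open>il\<close> and \<open>jl\<close> from \<open>T0\<close> to its cosets in \<open>T\<close>; \<open>Fn\<close> measures the failure of
  \<open>i (t \<theta>) = j t i \<theta>\<close>.\<close>

definition iT where "iT t = il (inv (tr t) \<otimes> t)"
definition jT where "jT t = jl (inv (tr t) \<otimes> t)"
definition Fn where "Fn \<theta> t = inv_into UNIV (iT (t \<otimes> \<theta>)) \<circ> (jT t \<circ> il \<theta>)"

definition cj where "cj a t = inv (tr t) \<otimes> a \<otimes> tr t"

lemma lifts_iT: "t \<in> T \<Longrightarrow> lifts (iT t) (inv (tr t) \<otimes> t)"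
  unfolding iT_def using tr_E lifts_il by blast

lemma lifts_jT: "t \<in> T \<Longrightarrow> lifts (jT t) (inv (tr t) \<otimes> t)"
  unfolding jT_def using tr_E lifts_jl by blast

lemma iT_B:
  assumes t: "t \<in> T" and b: "b \<in> B"
  shows "iT (b \<otimes> t) = iT t"
proof (rule tr_E[OF t])
  assume r: "tr t \<in> T" "inv (tr t) \<otimes> t \<in> T0"
  have c: "t \<in> carrier G" "b \<in> carrier G" "tr t \<in> carrier G" using t b r by auto
  have "inv (tr t) \<otimes> (b \<otimes> t) = (inv (tr t) \<otimes> b \<otimes> tr t) \<otimes> (inv (tr t) \<otimes> t)"
    using c by (simp add: word_simps)
  moreover have "inv (tr t) \<otimes> b \<otimes> tr t \<in> B"
    by (rule conj_inv_B[OF c(3) b])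
  ultimately show ?thesis
    using tr_left[OF t, of b] b c il_B by (simp add: iT_def)
qed

lemma cj_A:
  assumes t: "t \<in> T" and a: "a \<in> A"
  shows "cj a t \<in> A"
proof (rule tr_E[OF t])
  assume r: "tr t \<in> T" "inv (tr t) \<otimes> t \<in> T0"
  then show ?thesis unfolding cj_def by (intro conj_inv_A a) simp
qed

lemma jT_A:
  assumes t: "t \<in> T" and a: "a \<in> A"
  shows "jT (a \<otimes> t) = lop (cj a t) (cj a t) \<circ> jT t"
proof (rule tr_E[OF t])
  assume r: "tr t \<in> T" "inv (tr t) \<otimes> t \<in> T0"
  have c: "t \<in> carrier G" "a \<in> carrier G" "tr t \<in> carrier G" using t a r by auto
  have "inv (tr t) \<otimes> (a \<otimes> t) = cj a t \<otimes> (inv (tr t) \<otimes> t)"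
    using c by (simp add: word_simps cj_def)
  then show ?thesis
    using tr_left[OF t, of a] a jl_A[OF cj_A[OF t a] r(2)] by (simp add: jT_def)
qed

lemma lifts_Fn_right:
  assumes "t \<in> T" "\<theta> \<in> T0"
  shows "lifts (jT t \<circ> il \<theta>) (inv (tr t) \<otimes> t \<otimes> \<theta>)"
  using lifts_mult[OF lifts_jT[OF assms(1)] lifts_il[OF assms(2)]] .

text \<open>Both \<open>iT (t \<otimes> \<theta>)\<close> and
  \<open>jT t \<circ> il \<theta>\<close> lift the element \<open>tr(t)^-1 t \<theta>\<close>, hence
  differ by an element of the centre.\<close>

lemma Fn_closed:
  assumes t: "t \<in> T" and th: "\<theta> \<in> T0"
  shows "Fn \<theta> t \<in> carrier centre"
proof (rule tr_E[OF t])
  assume r: "tr t \<in> T" "inv (tr t) \<otimes> t \<in> T0"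
  have c: "t \<in> carrier G" "\<theta> \<in> carrier G" "tr t \<in> carrier G" using t th r by auto
  have "t \<otimes> \<theta> \<in> T" using t th by simp
  from lifts_iT[OF this] have "lifts (iT (t \<otimes> \<theta>)) (inv (tr t) \<otimes> t \<otimes> \<theta>)"
    using tr_right[OF t th] c by (simp add: m_assoc)
  then show ?thesis
    unfolding Fn_def by (rule lifts_diff[OF _ lifts_Fn_right[OF t th]])
qed

lemma iT_permutes: "t \<in> T \<Longrightarrow> iT t permutes St"
  using lifts_iT lifts_permutes by blast

lemma jT_permutes: "t \<in> T \<Longrightarrow> jT t permutes St"
  using lifts_jT lifts_permutes by blast

lemma iT_Fn:
  assumes t: "t \<in> T" and th: "\<theta> \<in> T0"
  shows "iT (t \<otimes> \<theta>) \<circ> Fn \<theta> t = jT t \<circ> il \<theta>"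
proof -
  have "t \<otimes> \<theta> \<in> T" using t th by simp
  from permutes_inv_o(1)[OF iT_permutes[OF this]] show ?thesis
    unfolding Fn_def by (simp flip: comp_assoc)
qed

lemma Fn_unique:
  assumes t: "t \<in> T" and th: "\<theta> \<in> T0" and "iT (t \<otimes> \<theta>) \<circ> z = jT t \<circ> il \<theta>"
  shows "z = Fn \<theta> t"
proof -
  have "t \<otimes> \<theta> \<in> T" using t th by simp
  from permutes_inv_o(2)[OF iT_permutes[OF this]] show ?thesis
    unfolding Fn_def assms(3)[symmetric] by (simp flip: comp_assoc)
qed

lemma iT_central: "\<lbrakk>t \<in> T; z \<in> carrier centre\<rbrakk> \<Longrightarrow> z \<circ> iT t = iT t \<circ> z"
  using lifts_central[OF lifts_iT] centre_central by blast

text \<open>As an element of \<open>B\<close>, \<open>c\<close> is invisible to \<open>iT\<close>;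
  as an element of \<open>A\<close>, it multiplies \<open>jT\<close> by \<open>lop c c\<close>, the
  conjugation in \<open>cj\<close> being trivial on \<open>C\<close>.\<close>

lemma Fn_C:
  assumes t: "t \<in> T" and th: "\<theta> \<in> T0" and c: "c \<in> C"
  shows "Fn \<theta> (c \<otimes> t) = lop c c \<circ> Fn \<theta> t"
proof (rule tr_E[OF t])
  assume r: "tr t \<in> T" "inv (tr t) \<otimes> t \<in> T0"
  have cA: "c \<in> A" "c \<in> B" "c \<in> T" using c by auto
  have ca: "t \<in> carrier G" "\<theta> \<in> carrier G" "tr t \<in> carrier G" "c \<in> carrier G" using t th r c by auto
  have tth: "t \<otimes> \<theta> \<in> T" using t th by simp
  have ct: "c \<otimes> t \<in> T" using cA t by simp
  have cj: "cj c t = c" using C_commute[OF c r(1)] ca by (simp add: cj_def m_assoc inv_mult_cancel_left)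
  have "iT (c \<otimes> t \<otimes> \<theta>) \<circ> (lop c c \<circ> Fn \<theta> t) = lop c c \<circ> (iT (t \<otimes> \<theta>) \<circ> Fn \<theta> t)"
    using iT_B[OF tth cA(2)] ca iT_central[OF tth lop_C_centre[OF c]] by (simp add: m_assoc flip: comp_assoc)
  also have "\<dots> = jT (c \<otimes> t) \<circ> il \<theta>"
    unfolding iT_Fn[OF t th] jT_A[OF t cA(1)] cj by (simp only: comp_assoc)
  finally show ?thesis by (rule Fn_unique[OF ct th, symmetric])
qed

text \<open>An equality of ratios, written without inverses. The ratio of
  \<open>Fn \<theta> (a \<otimes> t)\<close> to \<open>Fn \<theta> t\<close> involves only
  \<open>iT\<close> at \<open>w\<close> and \<open>a w\<close> and the coset representative of
  \<open>w = t \<theta>\<close>. Since \<open>a\<close> commutes with \<open>B\<close>, it depends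
  only on the \<open>B\<close>-coset of \<open>w\<close>.\<close>

lemma Fn_A:
  assumes t: "t \<in> T" and th: "\<theta> \<in> T0" and t': "t' \<in> T" and th': "\<theta>' \<in> T0" and a: "a \<in> A"
    and b: "b \<in> B" "t' \<otimes> \<theta>' = b \<otimes> (t \<otimes> \<theta>)"
  shows "Fn \<theta> (a \<otimes> t) \<circ> Fn \<theta>' t' = Fn \<theta>' (a \<otimes> t') \<circ> Fn \<theta> t"
proof -
  have ca: "t \<in> carrier G" "\<theta> \<in> carrier G" "t' \<in> carrier G" "\<theta>' \<in> carrier G" "a \<in> carrier G" "b \<in> carrier G"
    using assms by auto
  define w where "w = t \<otimes> \<theta>"
  have w: "w \<in> T" using t th by (simp add: w_def)
  have aw: "a \<otimes> w \<in> T" using w a by auto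
  have key: "Fn \<theta> (a \<otimes> t) = inv_into UNIV (iT (a \<otimes> w)) \<circ> lop (cj a w) (cj a w) \<circ> iT w \<circ> Fn \<theta> t"
    if t: "t \<in> T" and th: "\<theta> \<in> T0" and b: "b \<in> B" "t \<otimes> \<theta> = b \<otimes> w" for t \<theta> b
  proof -
    have ca': "t \<in> carrier G" "\<theta> \<in> carrier G" "b \<in> carrier G" "w \<in> carrier G" using t th b w by auto
    have "tr t = tr w" using tr_right[OF t th] tr_left[OF w, of b] b by simp
    then have cj: "cj a t = cj a w" by (simp add: cj_def)
    have ab: "a \<otimes> b = b \<otimes> a" using commute_R[of b a] b a by simp
    have "a \<otimes> t \<otimes> \<theta> = a \<otimes> (b \<otimes> w)" using ca ca' b(2) by (simp add: m_assoc)
    also have "\<dots> = b \<otimes> (a \<otimes> w)" using ca ca' ab by (simp flip: m_assoc)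
    finally have "iT (a \<otimes> t \<otimes> \<theta>) = iT (a \<otimes> w)" using iT_B[OF aw b(1)] by simp
    moreover have "iT (t \<otimes> \<theta>) = iT w" using iT_B[OF w b(1)] b(2) by simp
    ultimately show ?thesis
      using iT_Fn[OF t th] unfolding Fn_def[of \<theta> "a \<otimes> t"] jT_A[OF t a] cj by (simp add: comp_assoc)
  qed
  have "Fn \<theta> t \<circ> Fn \<theta>' t' = Fn \<theta>' t' \<circ> Fn \<theta> t"
    by (rule centre_commute[OF Fn_closed[OF t th] centre_central[OF Fn_closed[OF t' th']]])
  moreover have "t \<otimes> \<theta> = \<one> \<otimes> w" using w by (simp add: w_def)
  ultimately show ?thesis
    using key[OF t th, of \<one>] key[OF t' th' b(1)] b(2) by (simp add: comp_assoc w_def)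
qed

text \<open>As \<open>iT\<close> ignores \<open>b\<close>, the ratio of
  \<open>Fn \<theta> (b \<otimes> t)\<close> to \<open>Fn \<theta> t\<close> is the central element
  \<open>z\<close> by which \<open>jT (b \<otimes> t)\<close> differs from \<open>jT t\<close>. By
  equivariance of \<open>jT\<close> the same \<open>z\<close> serves for
  \<open>a \<otimes> t\<close>.\<close>

lemma Fn_B:
  assumes t: "t \<in> T" and th: "\<theta> \<in> T0" and th': "\<theta>' \<in> T0" and a: "a \<in> A" and b: "b \<in> B"
  shows "Fn \<theta> (b \<otimes> t) \<circ> Fn \<theta>' (a \<otimes> t) = Fn \<theta>' (b \<otimes> (a \<otimes> t)) \<circ> Fn \<theta> t"
proof -
  have ca: "t \<in> carrier G" "\<theta> \<in> carrier G" "\<theta>' \<in> carrier G" "a \<in> carrier G" "b \<in> carrier G"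
    using assms by auto
  have at: "a \<otimes> t \<in> T" and bt: "b \<otimes> t \<in> T" using t a b by auto
  define z where "z = inv_into UNIV (jT t) \<circ> jT (b \<otimes> t)"
  have z: "z \<in> carrier centre"
  proof (rule tr_E[OF t])
    assume r: "tr t \<in> T" "inv (tr t) \<otimes> t \<in> T0"
    have c: "tr t \<in> carrier G" using r by auto
    have "lifts (jT (b \<otimes> t)) (inv (tr t) \<otimes> (b \<otimes> t))"
      using lifts_jT[OF bt] tr_left[OF t, of b] b by simp
    moreover have "inv (tr t) \<otimes> (b \<otimes> t) = (inv (tr t) \<otimes> b \<otimes> tr t) \<otimes> (inv (tr t) \<otimes> t)"
      using c ca by (simp add: word_simps)
    moreover have "inv (tr t) \<otimes> b \<otimes> tr t \<in> B"
      by (rule conj_inv_B[OF c b])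
    ultimately show ?thesis
      unfolding z_def using lifts_diff[OF lifts_B[OF lifts_jT[OF t]]] by simp
  qed
  have jz: "jT (b \<otimes> t) = jT t \<circ> z"
    unfolding z_def using permutes_inv_o(1)[OF jT_permutes[OF t]] by (simp flip: comp_assoc)
  have ab: "b \<otimes> (a \<otimes> t) = a \<otimes> (b \<otimes> t)"
    using commute_R[of b a] b a ca by (simp flip: m_assoc)
  have "cj a (b \<otimes> t) = cj a t" using tr_left[OF t, of b] b by (simp add: cj_def)
  then have jz': "jT (b \<otimes> (a \<otimes> t)) = jT (a \<otimes> t) \<circ> z"
    unfolding ab jT_A[OF bt a] jT_A[OF t a] jz by (simp add: comp_assoc)
  have key: "Fn \<theta> (b \<otimes> t) = Fn \<theta> t \<circ> z" if t: "t \<in> T" and th: "\<theta> \<in> T0" and jz: "jT (b \<otimes> t) = jT t \<circ> z" for t \<theta>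
  proof -
    have bt: "b \<otimes> t \<in> T" and tth: "t \<otimes> \<theta> \<in> T" using t th b by auto
    have c: "t \<in> carrier G" "\<theta> \<in> carrier G" using t th by auto
    have "iT (b \<otimes> t \<otimes> \<theta>) \<circ> (Fn \<theta> t \<circ> z) = jT t \<circ> (il \<theta> \<circ> z)"
      using iT_B[OF tth b] c ca iT_Fn[OF t th] by (simp add: m_assoc flip: comp_assoc)
    also have "il \<theta> \<circ> z = z \<circ> il \<theta>"
      using lifts_central[OF lifts_il[OF th] centre_central[OF z]] by simp
    also have "jT t \<circ> (z \<circ> il \<theta>) = jT (b \<otimes> t) \<circ> il \<theta>" unfolding jz by (simp add: comp_assoc)
    finally show ?thesis by (rule Fn_unique[OF bt th, symmetric])
  qed
  note F = Fn_closed[OF t th] Fn_closed[OF at th']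
  have "(Fn \<theta> t \<circ> z) \<circ> Fn \<theta>' (a \<otimes> t) = Fn \<theta>' (a \<otimes> t) \<circ> (Fn \<theta> t \<circ> z)"
    by (rule comp_commute_trans[OF centre_commute[OF F(1) centre_central[OF F(2)]] centre_commute[OF z centre_central[OF F(2)]]])
  moreover have "Fn \<theta> t \<circ> z = z \<circ> Fn \<theta> t"
    by (rule centre_commute[OF F(1) centre_central[OF z]])
  ultimately show ?thesis
    unfolding key[OF t th jz] key[OF at th' jz'] by (simp only: comp_assoc)
qed

section \<open>Left translation of the discrepancy by elements of \<open>T\<close>\<close>

definition tw where "tw \<tau> t = inv (tr (\<tau> \<otimes> t)) \<otimes> \<tau> \<otimes> tr t"
text \<open>\<open>uT\<close> and \<open>vT\<close> measure how far \<open>iT\<close> and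
  \<open>jT\<close> are from turning left multiplication by \<open>\<tau>\<close> into composition
  with a lift of \<open>tw\<close>. Using the same lift \<open>jl (tw \<tau> _)\<close> for both
  lets it cancel in \<open>Fn_T\<close>.\<close>

definition uT where "uT \<tau> w = inv_into UNIV (iT (\<tau> \<otimes> w)) \<circ> (jl (tw \<tau> w) \<circ> iT w)"
definition vT where "vT \<tau> t = inv_into UNIV (jl (tw \<tau> t) \<circ> jT t) \<circ> jT (\<tau> \<otimes> t)"

lemma inj_comp_cancel: "\<lbrakk>inj f; f \<circ> g = f \<circ> h\<rbrakk> \<Longrightarrow> g = h"
  by (simp add: fun_eq_iff inj_eq)

lemma tw_E:
  assumes tau: "\<tau> \<in> T" and t: "t \<in> T"
  obtains "tw \<tau> t \<in> T0" "tw \<tau> t \<otimes> (inv (tr t) \<otimes> t) = inv (tr (\<tau> \<otimes> t)) \<otimes> (\<tau> \<otimes> t)"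
proof -
  have tt: "\<tau> \<otimes> t \<in> T" using assms by simp
  show ?thesis
  proof (rule tr_E[OF t], rule tr_E[OF tt])
    assume r: "tr t \<in> T" "inv (tr t) \<otimes> t \<in> T0" "tr (\<tau> \<otimes> t) \<in> T" "inv (tr (\<tau> \<otimes> t)) \<otimes> (\<tau> \<otimes> t) \<in> T0"
    have c: "t \<in> carrier G" "\<tau> \<in> carrier G" "tr t \<in> carrier G" "tr (\<tau> \<otimes> t) \<in> carrier G"
      using assms r by auto
    have "tw \<tau> t = (inv (tr (\<tau> \<otimes> t)) \<otimes> (\<tau> \<otimes> t)) \<otimes> inv (inv (tr t) \<otimes> t)"
      using c by (simp add: tw_def word_simps)
    moreover have "(inv (tr (\<tau> \<otimes> t)) \<otimes> (\<tau> \<otimes> t)) \<otimes> inv (inv (tr t) \<otimes> t) \<in> T0"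
      by (rule T0.m_closed[OF r(4) T0.m_inv_closed[OF r(2)]])
    ultimately have "tw \<tau> t \<in> T0" by simp
    moreover have "tw \<tau> t \<otimes> (inv (tr t) \<otimes> t) = inv (tr (\<tau> \<otimes> t)) \<otimes> (\<tau> \<otimes> t)"
      using c by (simp add: tw_def word_simps)
    ultimately show ?thesis by (rule that)
  qed
qed

lemma uT_closed:
  assumes tau: "\<tau> \<in> T" and w: "w \<in> T"
  shows "uT \<tau> w \<in> carrier centre"
proof (rule tw_E[OF tau w])
  assume y: "tw \<tau> w \<in> T0" "tw \<tau> w \<otimes> (inv (tr w) \<otimes> w) = inv (tr (\<tau> \<otimes> w)) \<otimes> (\<tau> \<otimes> w)"
  have tw: "\<tau> \<otimes> w \<in> T" using assms by simp
  have "lifts (jl (tw \<tau> w) \<circ> iT w) (inv (tr (\<tau> \<otimes> w)) \<otimes> (\<tau> \<otimes> w))"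
    using lifts_mult[OF lifts_jl[OF y(1)] lifts_iT[OF w]] y(2) by simp
  then show ?thesis unfolding uT_def by (rule lifts_diff[OF lifts_iT[OF tw]])
qed

lemma vT_closed:
  assumes tau: "\<tau> \<in> T" and w: "w \<in> T"
  shows "vT \<tau> w \<in> carrier centre" "jl (tw \<tau> w) \<circ> jT w \<circ> vT \<tau> w = jT (\<tau> \<otimes> w)"
proof -
  have "vT \<tau> w \<in> carrier centre \<and> jl (tw \<tau> w) \<circ> jT w \<circ> vT \<tau> w = jT (\<tau> \<otimes> w)"
  proof (rule tw_E[OF tau w])
    assume y: "tw \<tau> w \<in> T0" "tw \<tau> w \<otimes> (inv (tr w) \<otimes> w) = inv (tr (\<tau> \<otimes> w)) \<otimes> (\<tau> \<otimes> w)"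
    have tw: "\<tau> \<otimes> w \<in> T" using assms by simp
    have l: "lifts (jl (tw \<tau> w) \<circ> jT w) (inv (tr (\<tau> \<otimes> w)) \<otimes> (\<tau> \<otimes> w))"
      using lifts_mult[OF lifts_jl[OF y(1)] lifts_jT[OF w]] y(2) by simp
    have "vT \<tau> w \<in> carrier centre" unfolding vT_def by (rule lifts_diff[OF l lifts_jT[OF tw]])
    moreover have "jl (tw \<tau> w) \<circ> jT w \<circ> vT \<tau> w = jT (\<tau> \<otimes> w)"
      unfolding vT_def by (simp only: comp_assoc[symmetric] permutes_inv_o(1)[OF lifts_permutes[OF l]] id_comp)
    ultimately show ?thesis by blast
  qed
  then show "vT \<tau> w \<in> carrier centre" "jl (tw \<tau> w) \<circ> jT w \<circ> vT \<tau> w = jT (\<tau> \<otimes> w)" by blast+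
qed

lemma tr_tau_left:
  assumes tau: "\<tau> \<in> T" and w: "w \<in> T" and x: "x \<in> A \<or> x \<in> B"
  shows "tr (\<tau> \<otimes> (x \<otimes> w)) = tr (\<tau> \<otimes> w)" "\<tau> \<otimes> (x \<otimes> w) = (\<tau> \<otimes> x \<otimes> inv \<tau>) \<otimes> (\<tau> \<otimes> w)"
proof -
  have c: "\<tau> \<in> carrier G" "w \<in> carrier G" "x \<in> carrier G" using assms by auto
  show eq: "\<tau> \<otimes> (x \<otimes> w) = (\<tau> \<otimes> x \<otimes> inv \<tau>) \<otimes> (\<tau> \<otimes> w)" using c by (simp add: word_simps)
  have "\<tau> \<otimes> x \<otimes> inv \<tau> \<in> A \<or> \<tau> \<otimes> x \<otimes> inv \<tau> \<in> B"
    using x conj_inv_A[of "inv \<tau>" x] conj_inv_B[of "inv \<tau>" x] c by auto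
  then show "tr (\<tau> \<otimes> (x \<otimes> w)) = tr (\<tau> \<otimes> w)"
    unfolding eq using tr_left[of "\<tau> \<otimes> w"] tau w by blast
qed

lemma uT_B:
  assumes tau: "\<tau> \<in> T" and w: "w \<in> T" and b: "b \<in> B"
  shows "uT \<tau> (b \<otimes> w) = uT \<tau> w"
proof -
  have tw: "\<tau> \<otimes> w \<in> T" using assms by simp
  have "\<tau> \<otimes> b \<otimes> inv \<tau> \<in> B" using conj_inv_B[of "inv \<tau>" b] tau b by simp
  then have "iT (\<tau> \<otimes> (b \<otimes> w)) = iT (\<tau> \<otimes> w)"
    using tr_tau_left(2)[OF tau w, of b] b iT_B[OF tw] by simp
  moreover have "tw \<tau> (b \<otimes> w) = tw \<tau> w"
    using tr_tau_left(1)[OF tau w, of b] tr_left[OF w, of b] b by (simp add: tw_def)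
  ultimately show ?thesis unfolding uT_def using iT_B[OF w b] by simp
qed

lemma vT_A:
  assumes tau: "\<tau> \<in> T" and w: "w \<in> T" and a: "a \<in> A"
  shows "vT \<tau> (a \<otimes> w) = vT \<tau> w"
proof (rule tw_E[OF tau w], rule tr_E[OF w])
  assume y: "tw \<tau> w \<in> T0" "tw \<tau> w \<otimes> (inv (tr w) \<otimes> w) = inv (tr (\<tau> \<otimes> w)) \<otimes> (\<tau> \<otimes> w)"
  assume r: "tr w \<in> T"
  have tw: "\<tau> \<otimes> w \<in> T" and aw: "a \<otimes> w \<in> T" using assms by auto
  have c: "\<tau> \<in> carrier G" "w \<in> carrier G" "a \<in> carrier G" "tr w \<in> carrier G" "tw \<tau> w \<in> carrier G"
    using assms r y by auto
  have trt: "tr (\<tau> \<otimes> w) \<in> carrier G" by (rule tr_E[OF tw]) simp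
  define a' where "a' = \<tau> \<otimes> a \<otimes> inv \<tau>"
  have a': "a' \<in> A" using conj_A_closed[of \<tau> a] c a by (simp add: a'_def)
  have t: "tw \<tau> (a \<otimes> w) = tw \<tau> w"
    using tr_tau_left(1)[OF tau w, of a] tr_left[OF w, of a] a by (simp add: tw_def)
  \<comment> \<open>Conjugation by \<open>tw\<close> carries the \<open>A\<close>-factor of
    \<open>jT (a \<otimes> w)\<close> to that of
    \<open>jT (\<tau> \<otimes> (a \<otimes> w))\<close>, so both sides acquire the same left factor
    \<open>?L\<close>, which is then cancelled.\<close>
  have cj: "tw \<tau> w \<otimes> cj a w \<otimes> inv (tw \<tau> w) = cj a' (\<tau> \<otimes> w)"
    using c trt by (simp add: tw_def cj_def a'_def word_simps)
  let ?j = "jl (tw \<tau> w)" and ?L = "lop (cj a' (\<tau> \<otimes> w)) (cj a' (\<tau> \<otimes> w))"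
  have L: "?L permutes St" by (rule lop_permutes[OF cj_A[OF tw a'] cj_A[OF tw a']])
  have "jT (\<tau> \<otimes> (a \<otimes> w)) = ?L \<circ> jT (\<tau> \<otimes> w)"
    unfolding tr_tau_left(2)[OF tau w disjI1[OF a]] a'_def[symmetric] by (rule jT_A[OF tw a'])
  then have "?j \<circ> jT (a \<otimes> w) \<circ> vT \<tau> (a \<otimes> w) = ?L \<circ> (?j \<circ> jT w \<circ> vT \<tau> w)"
    using vT_closed(2)[OF tau aw] vT_closed(2)[OF tau w] unfolding t by simp
  also have "?j \<circ> jT (a \<otimes> w) = ?L \<circ> (?j \<circ> jT w)"
    unfolding jT_A[OF w a] using lifts_lop[OF lifts_jl[OF y(1)] cj_A[OF w a] cj_A[OF w a]]
    unfolding cj by (simp flip: comp_assoc)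
  finally have eq: "(?L \<circ> (?j \<circ> jT w)) \<circ> vT \<tau> (a \<otimes> w) = (?L \<circ> (?j \<circ> jT w)) \<circ> vT \<tau> w"
    by (simp only: comp_assoc)
  have "(?L \<circ> (?j \<circ> jT w)) permutes St"
    by (rule permutes_compose[OF permutes_compose[OF jT_permutes[OF w] lifts_permutes[OF lifts_jl[OF y(1)]]] L])
  then have "inj (?L \<circ> (?j \<circ> jT w))" by (rule permutes_inj)
  then show ?thesis using eq by (rule inj_comp_cancel)
qed

text \<open>The increment splits into two parts, one seeing only the \<open>B\<close>-coset of
  \<open>t \<theta>\<close> (\<open>uT_B\<close>), the other only the \<open>A\<close>-coset of
  \<open>t\<close> (\<open>vT_A\<close>). Centrality lets \<open>vT\<close> pass through
  \<open>iT\<close> and \<open>jT\<close>.\<close>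

lemma Fn_T:
  assumes tau: "\<tau> \<in> T" and t: "t \<in> T" and th: "\<theta> \<in> T0"
  shows "Fn \<theta> (\<tau> \<otimes> t) = uT \<tau> (t \<otimes> \<theta>) \<circ> vT \<tau> t \<circ> Fn \<theta> t"
proof -
  define w where "w = t \<otimes> \<theta>"
  have w: "w \<in> T" using t th by (simp add: w_def)
  have tw: "\<tau> \<otimes> w \<in> T" and tt: "\<tau> \<otimes> t \<in> T" using tau t w by auto
  have c: "\<tau> \<in> carrier G" "t \<in> carrier G" "\<theta> \<in> carrier G" using assms by auto
  have w': "\<tau> \<otimes> t \<otimes> \<theta> = \<tau> \<otimes> w" using c by (simp add: w_def m_assoc)
  have "tr w = tr t" "tr (\<tau> \<otimes> w) = tr (\<tau> \<otimes> t)"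
    using tr_right[OF t th] tr_right[OF tt th] w' by (simp_all add: w_def)
  then have t': "tw \<tau> w = tw \<tau> t" by (simp add: tw_def)
  let ?j = "jl (tw \<tau> t)"
  have v: "central (vT \<tau> t)" by (rule centre_central[OF vT_closed(1)[OF tau t]])
  have iu: "iT (\<tau> \<otimes> w) \<circ> uT \<tau> w = ?j \<circ> iT w"
    unfolding uT_def t' by (simp only: comp_assoc[symmetric] permutes_inv_o(1)[OF iT_permutes[OF tw]] id_comp)
  have "iT (\<tau> \<otimes> t \<otimes> \<theta>) \<circ> (uT \<tau> w \<circ> vT \<tau> t \<circ> Fn \<theta> t) = ?j \<circ> (iT w \<circ> vT \<tau> t) \<circ> Fn \<theta> t"
    unfolding w' using iu by (simp only: comp_assoc[symmetric])
  also have "iT w \<circ> vT \<tau> t = vT \<tau> t \<circ> iT w"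
    using lifts_central[OF lifts_iT[OF w] v] by simp
  also have "?j \<circ> (vT \<tau> t \<circ> iT w) \<circ> Fn \<theta> t = ?j \<circ> (vT \<tau> t \<circ> jT t) \<circ> il \<theta>"
    using iT_Fn[OF t th] by (simp add: comp_assoc w_def)
  also have "vT \<tau> t \<circ> jT t = jT t \<circ> vT \<tau> t"
    by (rule lifts_central[OF lifts_jT[OF t] v])
  also have "?j \<circ> (jT t \<circ> vT \<tau> t) \<circ> il \<theta> = jT (\<tau> \<otimes> t) \<circ> il \<theta>"
    using vT_closed(2)[OF tau t] by (simp only: comp_assoc[symmetric])
  finally show ?thesis unfolding w_def[symmetric] by (rule Fn_unique[OF tt th, symmetric])
qed

section \<open>Coordinates on the group\<close>

text \<open>For \<open>H\<close> normal and \<open>K\<close> a subgroup this is a right coset of the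
  subgroup \<open>HK\<close>.\<close>

definition dcos where "dcos H K g = {h \<otimes> k \<otimes> g | h k. h \<in> H \<and> k \<in> K}"

lemma dcosI: "\<lbrakk>h \<in> H; k \<in> K\<rbrakk> \<Longrightarrow> h \<otimes> k \<otimes> g \<in> dcos H K g"
  by (auto simp: dcos_def)

lemma dcos_absorb:
  assumes H: "H \<lhd> G" and K: "subgroup K G" and h: "h \<in> H" and k: "k \<in> K" and g: "g \<in> carrier G"
  shows "dcos H K (h \<otimes> k \<otimes> g) = dcos H K g"
proof -
  interpret H: normal H G by (rule H)
  interpret K: subgroup K G by (rule K)
  have sub: "dcos H K (h \<otimes> k \<otimes> g) \<subseteq> dcos H K g" if h: "h \<in> H" and k: "k \<in> K" and g: "g \<in> carrier G" for h k g
  proof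
    fix u assume "u \<in> dcos H K (h \<otimes> k \<otimes> g)"
    then obtain x y where xy: "x \<in> H" "y \<in> K" and u: "u = x \<otimes> y \<otimes> (h \<otimes> k \<otimes> g)" by (auto simp: dcos_def)
    have c: "x \<in> carrier G" "y \<in> carrier G" "h \<in> carrier G" "k \<in> carrier G"
      using xy h k H.mem_carrier K.mem_carrier by blast+
    have "u = (x \<otimes> (y \<otimes> h \<otimes> inv y)) \<otimes> (y \<otimes> k) \<otimes> g" unfolding u using c g by (simp add: word_simps)
    moreover have "x \<otimes> (y \<otimes> h \<otimes> inv y) \<in> H" using xy h c H.inv_op_closed2 by simp
    moreover have "y \<otimes> k \<in> K" using xy k by simp
    ultimately show "u \<in> dcos H K g" using dcosI by metis
  qed
  show ?thesis
  proof
    show "dcos H K (h \<otimes> k \<otimes> g) \<subseteq> dcos H K g" by (rule sub[OF h k g])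
    have c: "h \<in> carrier G" "k \<in> carrier G" using h k H.mem_carrier K.mem_carrier by blast+
    have i: "inv k \<otimes> inv h \<otimes> k \<in> H" using h c H.inv_op_closed1 by simp
    have "dcos H K (inv k \<otimes> inv h \<otimes> k \<otimes> inv k \<otimes> (h \<otimes> k \<otimes> g)) \<subseteq> dcos H K (h \<otimes> k \<otimes> g)"
      by (rule sub[OF i K.m_inv_closed[OF k]]) (use c g in simp)
    moreover have "inv k \<otimes> inv h \<otimes> k \<otimes> inv k \<otimes> (h \<otimes> k \<otimes> g) = g" using c g by (simp add: word_simps)
    ultimately show "dcos H K g \<subseteq> dcos H K (h \<otimes> k \<otimes> g)" by simp
  qed
qed

definition g0 where "g0 g = (SOME u. \<exists>t\<in>T. \<exists>s\<in>S. \<exists>r\<in>R. u = t \<otimes> s \<otimes> r \<otimes> g)"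

lemma subgroups: "subgroup R G" "subgroup S G" "subgroup T G" "subgroup E G"
  by (simp_all add: R.subgroup_axioms S.subgroup_axioms T.subgroup_axioms subgroups_Inter_pair)

lemma carrier_conj: "\<lbrakk>x \<in> carrier G; r \<in> R\<rbrakk> \<Longrightarrow> x \<otimes> r \<otimes> inv x \<in> R" "\<lbrakk>x \<in> carrier G; s \<in> S\<rbrakk> \<Longrightarrow> x \<otimes> s \<otimes> inv x \<in> S"
  "\<lbrakk>x \<in> carrier G; t \<in> T\<rbrakk> \<Longrightarrow> x \<otimes> t \<otimes> inv x \<in> T"
  by (simp_all add: R.inv_op_closed2 S.inv_op_closed2 T.inv_op_closed2)

lemma g0_E:
  assumes g: "g \<in> carrier G"
  obtains t s r where "t \<in> T" "s \<in> S" "r \<in> R" "g = t \<otimes> s \<otimes> r \<otimes> g0 g" "g0 g \<in> carrier G"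
proof -
  have "\<exists>t\<in>T. \<exists>s\<in>S. \<exists>r\<in>R. g = t \<otimes> s \<otimes> r \<otimes> g"
    using g by (intro bexI[of _ \<one>]) simp_all
  then have "\<exists>t\<in>T. \<exists>s\<in>S. \<exists>r\<in>R. g0 g = t \<otimes> s \<otimes> r \<otimes> g" unfolding g0_def by (rule someI)
  then obtain t s r where t: "t \<in> T" "s \<in> S" "r \<in> R" and e: "g0 g = t \<otimes> s \<otimes> r \<otimes> g" by blast
  have c: "t \<in> carrier G" "s \<in> carrier G" "r \<in> carrier G" using t by auto
  have g0: "g0 g \<in> carrier G" using e c g by simp
  define s' r' where "s' = t \<otimes> inv s \<otimes> inv t" and "r' = t \<otimes> s \<otimes> inv r \<otimes> inv (t \<otimes> s)"
  have "g = inv t \<otimes> s' \<otimes> r' \<otimes> g0 g"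
    unfolding e s'_def r'_def using c g by (simp add: word_simps)
  moreover have "inv t \<in> T" "s' \<in> S" "r' \<in> R"
    using t c carrier_conj(2)[of t "inv s"] carrier_conj(1)[of "t \<otimes> s" "inv r"] by (simp_all add: s'_def r'_def)
  ultimately show ?thesis using that g0 by blast
qed

lemma g0_eq:
  assumes g: "g \<in> carrier G" and x: "x \<in> R \<or> x \<in> S \<or> x \<in> T"
  shows "g0 (x \<otimes> g) = g0 g"
proof -
  have sub: "\<exists>t\<in>T. \<exists>s\<in>S. \<exists>r\<in>R. u = t \<otimes> s \<otimes> r \<otimes> g"
    if g: "g \<in> carrier G" and x: "x \<in> R \<or> x \<in> S \<or> x \<in> T" and u: "\<exists>t\<in>T. \<exists>s\<in>S. \<exists>r\<in>R. u = t \<otimes> s \<otimes> r \<otimes> (x \<otimes> g)" for g x u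
  proof -
    obtain t s r where t: "t \<in> T" "s \<in> S" "r \<in> R" and u: "u = t \<otimes> s \<otimes> r \<otimes> (x \<otimes> g)" using u by blast
    have c: "t \<in> carrier G" "s \<in> carrier G" "r \<in> carrier G" "x \<in> carrier G" using t x by auto
    consider "x \<in> R" | "x \<in> S" | "x \<in> T" using x by blast
    then show ?thesis
    proof cases
      case 1
      have "u = t \<otimes> s \<otimes> (r \<otimes> x) \<otimes> g" unfolding u using c g by (simp add: m_assoc)
      then show ?thesis using t 1 R.m_closed by blast
    next
      case 2
      have "u = t \<otimes> (s \<otimes> x) \<otimes> (inv x \<otimes> r \<otimes> x) \<otimes> g" unfolding u using c g by (simp add: word_simps)
      moreover have "inv x \<otimes> r \<otimes> x \<in> R" using t c R.inv_op_closed1 by simp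
      ultimately show ?thesis using t 2 S.m_closed by blast
    next
      case 3
      have "u = (t \<otimes> x) \<otimes> (inv x \<otimes> s \<otimes> x) \<otimes> (inv x \<otimes> r \<otimes> x) \<otimes> g" unfolding u using c g by (simp add: word_simps)
      moreover have "inv x \<otimes> r \<otimes> x \<in> R" "inv x \<otimes> s \<otimes> x \<in> S" using t c R.inv_op_closed1 S.inv_op_closed1 by simp_all
      ultimately show ?thesis using t 3 T.m_closed by blast
    qed
  qed
  have xc: "x \<in> carrier G" and ix: "inv x \<in> R \<or> inv x \<in> S \<or> inv x \<in> T" using x by auto
  have "(\<exists>t\<in>T. \<exists>s\<in>S. \<exists>r\<in>R. u = t \<otimes> s \<otimes> r \<otimes> (x \<otimes> g)) \<longleftrightarrow> (\<exists>t\<in>T. \<exists>s\<in>S. \<exists>r\<in>R. u = t \<otimes> s \<otimes> r \<otimes> g)" for u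
    using sub[OF g x, of u] sub[OF m_closed[OF xc g] ix, of u] xc g inv_mult_cancel_left[OF xc g] by metis
  then show ?thesis unfolding g0_def by simp
qed

text \<open>Nested representatives: \<open>g0\<close> of the coset of \<open>RST\<close>, \<open>zz\<close> of that of \<open>TS\<close>, \<open>yy\<close> of that of \<open>TR\<close>, \<open>jj\<close> of
  that of \<open>T (R \<inter> S)\<close>.  The element \<open>th g \<in> T0\<close> compares \<open>jj g\<close> with \<open>yy g\<close> modulo \<open>R\<close>, while \<open>tg g\<close> below is the
  \<open>T\<close>-component of \<open>g\<close> relative to \<open>jj g\<close>.  Left multiplication by \<open>S\<close> changes \<open>tg g\<close> only by a factor in \<open>A\<close>,
  and left multiplication by \<open>R\<close> changes \<open>tg g \<otimes> th g\<close> only by a factor in \<open>B\<close>; these are the arguments of the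
  two systems of lifts in \<open>phi\<close>.\<close>

definition zz where "zz g = (SOME u. u \<in> dcos T S g \<and> (\<exists>r\<in>R. u = r \<otimes> g0 g))"
definition yy where "yy g = (SOME u. u \<in> dcos T R g \<and> (\<exists>s\<in>S. u = s \<otimes> g0 g))"
definition jj where "jj g = (SOME u. u \<in> dcos T E g \<and> (\<exists>s\<in>S. u = s \<otimes> zz g))"
definition th where "th g = (SOME \<theta>. \<theta> \<in> T \<and> (\<exists>r\<in>R. jj g = \<theta> \<otimes> r \<otimes> yy g))"

lemma dcos_swap:
  assumes K: "K \<lhd> G" and g: "g \<in> carrier G" and u: "u \<in> dcos T K g"
  obtains t k where "t \<in> T" "k \<in> K" "g = t \<otimes> k \<otimes> u" "u \<in> carrier G"
proof -
  interpret K: normal K G by (rule K)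
  obtain t k where t: "t \<in> T" "k \<in> K" "u = t \<otimes> k \<otimes> g" using u by (auto simp: dcos_def)
  have c: "t \<in> carrier G" "k \<in> carrier G" using t K.mem_carrier by auto
  have "g = inv t \<otimes> (t \<otimes> inv k \<otimes> inv t) \<otimes> u" using t(3) c g by (simp add: word_simps)
  moreover have "t \<otimes> inv k \<otimes> inv t \<in> K" using t c K.inv_op_closed2 by simp
  ultimately show ?thesis using that[of "inv t"] t c g by simp
qed

lemma zz_E:
  assumes g: "g \<in> carrier G"
  obtains t s r where "t \<in> T" "s \<in> S" "r \<in> R" "g = t \<otimes> s \<otimes> zz g" "zz g = r \<otimes> g0 g" "zz g \<in> carrier G"
proof -
  obtain t s r where t: "t \<in> T" "s \<in> S" "r \<in> R" "g = t \<otimes> s \<otimes> r \<otimes> g0 g" and g0: "g0 g \<in> carrier G"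
    by (rule g0_E[OF g])
  have c: "t \<in> carrier G" "s \<in> carrier G" "r \<in> carrier G" using t by auto
  have gg: "inv (t \<otimes> s) \<otimes> g = r \<otimes> g0 g"
    using arg_cong[OF t(4), of "\<lambda>u. inv (t \<otimes> s) \<otimes> u"] c g0 by (simp add: word_simps)
  have "inv (t \<otimes> s) \<otimes> g = (inv s \<otimes> inv t \<otimes> s) \<otimes> inv s \<otimes> g" using c g by (simp add: word_simps)
  moreover have "inv s \<otimes> inv t \<otimes> s \<in> T" using t c T.inv_op_closed1 by simp
  ultimately have "r \<otimes> g0 g \<in> dcos T S g" using dcosI t S.m_inv_closed gg by metis
  then have "\<exists>u. u \<in> dcos T S g \<and> (\<exists>r\<in>R. u = r \<otimes> g0 g)" using t by blast
  then have z: "zz g \<in> dcos T S g" "\<exists>r\<in>R. zz g = r \<otimes> g0 g" unfolding zz_def by (rule someI2_ex, blast)+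
  show ?thesis
    using dcos_swap[OF normal_S g z(1)] z(2) that by metis
qed

lemma yy_E:
  assumes g: "g \<in> carrier G"
  obtains t r s where "t \<in> T" "r \<in> R" "s \<in> S" "g = t \<otimes> r \<otimes> yy g" "yy g = s \<otimes> g0 g" "yy g \<in> carrier G"
proof -
  obtain t s r where t: "t \<in> T" "s \<in> S" "r \<in> R" "g = t \<otimes> s \<otimes> r \<otimes> g0 g" and g0: "g0 g \<in> carrier G"
    by (rule g0_E[OF g])
  have c: "t \<in> carrier G" "s \<in> carrier G" "r \<in> carrier G" using t by auto
  define r' where "r' = s \<otimes> r \<otimes> inv s"
  have r': "r' \<in> R" "r' \<in> carrier G" using carrier_conj(1)[of s r] c t by (auto simp: r'_def)
  have "g = (t \<otimes> r') \<otimes> (s \<otimes> g0 g)" using t(4) c g0 by (simp add: r'_def word_simps)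
  then have gg: "inv (t \<otimes> r') \<otimes> g = s \<otimes> g0 g"
    using c r' g0 by (metis inv_mult_cancel_left m_closed)
  have "inv (t \<otimes> r') \<otimes> g = (inv r' \<otimes> inv t \<otimes> r') \<otimes> inv r' \<otimes> g" using c r' g by (simp add: word_simps)
  moreover have "inv r' \<otimes> inv t \<otimes> r' \<in> T" using t c r' T.inv_op_closed1 by simp
  ultimately have "s \<otimes> g0 g \<in> dcos T R g" using dcosI r' R.m_inv_closed gg by metis
  then have "\<exists>u. u \<in> dcos T R g \<and> (\<exists>s\<in>S. u = s \<otimes> g0 g)" using t by blast
  then have z: "yy g \<in> dcos T R g" "\<exists>s\<in>S. yy g = s \<otimes> g0 g" unfolding yy_def by (rule someI2_ex, blast)+
  show ?thesis
    using dcos_swap[OF normal_R g z(1)] z(2) that by metis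
qed

lemma normal_E: "E \<lhd> G"
  by (rule normal_subgroup_intersect[OF normal_R normal_S])

lemma jj_E:
  assumes g: "g \<in> carrier G"
  obtains t e s where "t \<in> T" "e \<in> E" "s \<in> S" "g = t \<otimes> e \<otimes> jj g" "jj g = s \<otimes> zz g" "jj g \<in> carrier G"
proof -
  obtain t s r where t: "t \<in> T" "s \<in> S" "g = t \<otimes> s \<otimes> zz g" and z: "zz g \<in> carrier G"
    by (rule zz_E[OF g])
  have c: "t \<in> carrier G" "s \<in> carrier G" using t by auto
  have "inv t \<otimes> \<one> \<otimes> g = s \<otimes> zz g"
    using arg_cong[OF t(3), of "\<lambda>u. inv t \<otimes> u"] c z by (simp add: word_simps)
  moreover have "inv t \<otimes> \<one> \<otimes> g \<in> dcos T E g" by (rule dcosI) (use t in auto)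
  ultimately have "\<exists>u. u \<in> dcos T E g \<and> (\<exists>s\<in>S. u = s \<otimes> zz g)" using t by metis
  then have z: "jj g \<in> dcos T E g" "\<exists>s\<in>S. jj g = s \<otimes> zz g" unfolding jj_def by (rule someI2_ex, blast)+
  show ?thesis
    using dcos_swap[OF normal_E g z(1)] z(2) that by metis
qed

text \<open>Comparing \<open>jj g\<close> and \<open>yy g\<close> through \<open>g\<close> gives a
  factor in \<open>T\<close> and one in \<open>R\<close>. Comparing them through
  \<open>g0 g\<close>, from which \<open>jj g\<close> differs by \<open>S\<close> and
  \<open>R\<close> and \<open>yy g\<close> by \<open>S\<close>, shows that the factor in
  \<open>T\<close> is congruent modulo \<open>R\<close> to an element of \<open>S\<close>, so it
  lies in \<open>T0\<close>.\<close>

lemma th_E: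
  assumes g: "g \<in> carrier G"
  obtains r where "th g \<in> T0" "r \<in> R" "jj g = th g \<otimes> r \<otimes> yy g"
proof -
  obtain t e s where j: "t \<in> T" "e \<in> E" "s \<in> S" "g = t \<otimes> e \<otimes> jj g" "jj g = s \<otimes> zz g" "jj g \<in> carrier G"
    by (rule jj_E[OF g])
  obtain r1 where z: "r1 \<in> R" "zz g = r1 \<otimes> g0 g" by (rule zz_E[OF g])
  obtain t2 r2 s2 where y: "t2 \<in> T" "r2 \<in> R" "s2 \<in> S" "g = t2 \<otimes> r2 \<otimes> yy g" "yy g = s2 \<otimes> g0 g" "yy g \<in> carrier G"
    by (rule yy_E[OF g])
  obtain g0: "g0 g \<in> carrier G" by (rule g0_E[OF g])
  have c: "t \<in> carrier G" "e \<in> carrier G" "s \<in> carrier G" "r1 \<in> carrier G" "t2 \<in> carrier G" "r2 \<in> carrier G" "s2 \<in> carrier G"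
    using j y z by auto
  have "jj g = inv (t \<otimes> e) \<otimes> (t2 \<otimes> r2 \<otimes> yy g)"
    using arg_cong[OF j(4), of "\<lambda>u. inv (t \<otimes> e) \<otimes> u"] j(6) c y(4) by (simp add: inv_mult_cancel_left)
  also have "\<dots> = (inv e \<otimes> (inv t \<otimes> t2) \<otimes> inv (inv e)) \<otimes> (inv e \<otimes> r2) \<otimes> yy g"
    using c y(6) by (simp add: word_simps)
  finally have "jj g = (inv e \<otimes> (inv t \<otimes> t2) \<otimes> inv (inv e)) \<otimes> (inv e \<otimes> r2) \<otimes> yy g" .
  moreover have "inv e \<otimes> (inv t \<otimes> t2) \<otimes> inv (inv e) \<in> T"
    by (rule carrier_conj(3)) (use c j y in simp_all)
  moreover have "inv e \<otimes> r2 \<in> R" using j y by auto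
  ultimately have "\<exists>\<theta>. \<theta> \<in> T \<and> (\<exists>r\<in>R. jj g = \<theta> \<otimes> r \<otimes> yy g)" by blast
  then have "th g \<in> T \<and> (\<exists>r\<in>R. jj g = th g \<otimes> r \<otimes> yy g)" unfolding th_def by (rule someI_ex)
  then obtain r where th: "th g \<in> T" "r \<in> R" "jj g = th g \<otimes> r \<otimes> yy g" by blast
  have c': "th g \<in> carrier G" "r \<in> carrier G" using th by auto
  have "s \<otimes> r1 \<otimes> g0 g = th g \<otimes> r \<otimes> s2 \<otimes> g0 g"
    using th(3) j(5) z(2) y(5) c c' g0 by (simp add: m_assoc)
  then have "s \<otimes> r1 = th g \<otimes> r \<otimes> s2" using c c' g0 by simp
  then have "th g = s \<otimes> r1 \<otimes> inv s2 \<otimes> inv r"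
    using c c' by (simp add: m_assoc)
  then have "inv (s \<otimes> inv s2) \<otimes> th g = (s2 \<otimes> r1 \<otimes> inv s2) \<otimes> inv r"
    using c c' by (simp add: word_simps)
  also have "\<dots> \<in> R" using carrier_conj(1)[of s2 r1] c z th by simp
  finally have "sim (s \<otimes> inv s2) (th g)" by (intro simI) (use j y th in auto)
  then have "th g \<in> T0" using T0_iff by blast
  then show ?thesis using that th by blast
qed

lemma dcos_eq:
  assumes "K \<lhd> G" "x \<in> T \<or> x \<in> K" "g \<in> carrier G"
  shows "dcos T K (x \<otimes> g) = dcos T K g"
proof -
  interpret K: normal K G by (rule assms)
  show ?thesis
    using assms(2)
  proof
    assume x: "x \<in> T"
    then show ?thesis using dcos_absorb[OF normal_T K.subgroup_axioms x K.one_closed assms(3)] by simp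
  next
    assume x: "x \<in> K"
    then show ?thesis
      using dcos_absorb[OF normal_T K.subgroup_axioms T.one_closed x assms(3)] K.mem_carrier by simp
  qed
qed

lemma zz_eq:
  assumes "x \<in> T \<or> x \<in> S" "g \<in> carrier G"
  shows "zz (x \<otimes> g) = zz g"
proof -
  have "g0 (x \<otimes> g) = g0 g" using g0_eq assms by blast
  then show ?thesis unfolding zz_def dcos_eq[OF normal_S assms] by simp
qed

lemma yy_eq:
  assumes "x \<in> T \<or> x \<in> R" "g \<in> carrier G"
  shows "yy (x \<otimes> g) = yy g"
proof -
  have "g0 (x \<otimes> g) = g0 g" using g0_eq assms by blast
  then show ?thesis unfolding yy_def dcos_eq[OF normal_R assms] by simp
qed

lemma jj_eq:
  assumes "x \<in> T \<or> x \<in> E" "g \<in> carrier G"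
  shows "jj (x \<otimes> g) = jj g"
proof -
  have "zz (x \<otimes> g) = zz g" using zz_eq assms by blast
  then show ?thesis unfolding jj_def dcos_eq[OF normal_E assms] by simp
qed

lemma th_eq:
  assumes "x \<in> T \<or> x \<in> E" "g \<in> carrier G"
  shows "th (x \<otimes> g) = th g"
proof -
  have "yy (x \<otimes> g) = yy g" using yy_eq assms by blast
  then show ?thesis unfolding th_def jj_eq[OF assms] by simp
qed

lemma subgroup_C: "subgroup C G"
  by (simp add: subgroups subgroups_Inter_pair)

section \<open>The component of a group element in \<open>T\<close>\<close>

definition rC where "rC e = (SOME u. u \<in> C #> e)"

lemma rC_eq: "\<lbrakk>c \<in> C; e \<in> carrier G\<rbrakk> \<Longrightarrow> rC (c \<otimes> e) = rC e"
  unfolding rC_def by (simp only: rcos_absorb[OF subgroup_C])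

lemma rC_E:
  assumes e: "e \<in> E"
  obtains c where "c \<in> C" "e = c \<otimes> rC e" "rC e \<in> E" "rC (rC e) = rC e"
proof -
  have ec: "e \<in> carrier G" using e by auto
  obtain c where c: "c \<in> C" "rC e = c \<otimes> e"
    using some_rcos[OF subgroup_C ec] unfolding rC_def by blast
  have cc: "c \<in> carrier G" using c by auto
  have "inv c \<in> C" using c by auto
  moreover have "e = inv c \<otimes> rC e" unfolding c(2) using cc ec by (simp add: inv_mult_cancel_left)
  moreover have "rC e \<in> E" unfolding c(2) using c(1) e by auto
  moreover have "rC (rC e) = rC e" using rC_eq[OF c(1) ec] c(2) by simp
  ultimately show ?thesis by (rule that)
qed

text \<open>In \<open>g = e t (jj g)\<close> a factor from \<open>C\<close> can be moved between
  \<open>e\<close> and \<open>t\<close>. Requiring \<open>e\<close> to be the chosen representative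
  of its \<open>C\<close>-coset removes this freedom (\<open>eg_unique\<close>).\<close>

definition eg where "eg g = (SOME e. e \<in> E \<and> rC e = e \<and> (\<exists>t\<in>T. g = e \<otimes> t \<otimes> jj g))"
definition tg where "tg g = inv (eg g) \<otimes> g \<otimes> inv (jj g)"

lemma eg_unique:
  assumes g: "g \<in> carrier G"
    and e: "e \<in> E" "rC e = e" "t \<in> T" "g = e \<otimes> t \<otimes> jj g"
  shows "eg g = e" "tg g = t"
proof -
  have j: "jj g \<in> carrier G" by (rule jj_E[OF g])
  have "\<exists>e. e \<in> E \<and> rC e = e \<and> (\<exists>t\<in>T. g = e \<otimes> t \<otimes> jj g)" using e by blast
  then have "eg g \<in> E \<and> rC (eg g) = eg g \<and> (\<exists>t\<in>T. g = eg g \<otimes> t \<otimes> jj g)" unfolding eg_def by (rule someI_ex)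
  then obtain t' where e': "eg g \<in> E" "rC (eg g) = eg g" "t' \<in> T" "g = eg g \<otimes> t' \<otimes> jj g" by blast
  have c: "e \<in> carrier G" "t \<in> carrier G" "eg g \<in> carrier G" "t' \<in> carrier G" using e e' by auto
  have "e \<otimes> t \<otimes> jj g = eg g \<otimes> t' \<otimes> jj g" using e(4) e'(4) by simp
  then have et: "e \<otimes> t = eg g \<otimes> t'" using c j by simp
  have "e \<otimes> inv (eg g) = eg g \<otimes> (t' \<otimes> inv t) \<otimes> inv (eg g)"
  proof -
    have "e = eg g \<otimes> t' \<otimes> inv t" using et c by (metis inv_solve_right m_closed)
    then show ?thesis using c by (metis inv_closed m_assoc)
  qed
  also have "\<dots> \<in> T" using carrier_conj(3)[of "eg g" "t' \<otimes> inv t"] e e' c by simp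
  finally have "e \<otimes> inv (eg g) \<in> C" using e e' by auto
  from rC_eq[OF this c(3)] have "rC e = rC (eg g)" using c by (simp add: m_assoc)
  then show eg: "eg g = e" using e e' by simp
  show "tg g = t" unfolding tg_def eg using arg_cong[OF e(4), of "\<lambda>u. inv e \<otimes> u \<otimes> inv (jj g)"] c j
    by (simp add: word_simps)
qed

lemma eg_E:
  assumes g: "g \<in> carrier G"
  obtains "eg g \<in> E" "rC (eg g) = eg g" "tg g \<in> T" "g = eg g \<otimes> tg g \<otimes> jj g" "jj g \<in> carrier G"
proof -
  obtain t e where te: "t \<in> T" "e \<in> E" "g = t \<otimes> e \<otimes> jj g" and j: "jj g \<in> carrier G" by (rule jj_E[OF g])
  obtain c where c: "c \<in> C" "e = c \<otimes> rC e" "rC e \<in> E" "rC (rC e) = rC e" by (rule rC_E[OF te(2)])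
  have ca: "t \<in> carrier G" "e \<in> carrier G" "c \<in> carrier G" "rC e \<in> carrier G" using te c by auto
  have "t \<otimes> e = e \<otimes> t" using commute_T te by blast
  also have "\<dots> = c \<otimes> rC e \<otimes> t" using c(2) by simp
  also have "\<dots> = rC e \<otimes> c \<otimes> t" using C_central[OF c(1), of "rC e"] c(3) by simp
  also have "\<dots> = rC e \<otimes> (c \<otimes> t)" using ca by (simp add: m_assoc)
  finally have "g = rC e \<otimes> (c \<otimes> t) \<otimes> jj g" using te(3) by simp
  moreover have ct: "c \<otimes> t \<in> T" using c te by auto
  ultimately have "eg g = rC e" "tg g = c \<otimes> t" using eg_unique[OF g c(3,4) ct] by blast+
  then show ?thesis using that c ct \<open>g = rC e \<otimes> (c \<otimes> t) \<otimes> jj g\<close> j by simp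
qed

text \<open>\<open>T\<close> centralizes \<open>E\<close>, so \<open>\<tau>\<close> passes the
  \<open>E\<close>-component and reaches the \<open>T\<close>-component unchanged.\<close>

lemma eg_T:
  assumes g: "g \<in> carrier G" and tau: "\<tau> \<in> T"
  shows "eg (\<tau> \<otimes> g) = eg g" "tg (\<tau> \<otimes> g) = \<tau> \<otimes> tg g"
proof -
  obtain e: "eg g \<in> E" "rC (eg g) = eg g" "tg g \<in> T" "g = eg g \<otimes> tg g \<otimes> jj g" "jj g \<in> carrier G"
    by (rule eg_E[OF g])
  have c: "eg g \<in> carrier G" "tg g \<in> carrier G" "\<tau> \<in> carrier G" using e tau by auto
  have j: "jj (\<tau> \<otimes> g) = jj g" using jj_eq tau g by simp
  have "\<tau> \<otimes> eg g = eg g \<otimes> \<tau>" using commute_T[of \<tau> "eg g"] tau e by simp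
  then have "\<tau> \<otimes> (eg g \<otimes> tg g \<otimes> jj g) = eg g \<otimes> (\<tau> \<otimes> tg g) \<otimes> jj g"
    using c e(5) by (metis m_assoc m_closed)
  then have "\<tau> \<otimes> g = eg g \<otimes> (\<tau> \<otimes> tg g) \<otimes> jj (\<tau> \<otimes> g)"
    unfolding j using e(4) by simp
  then show "eg (\<tau> \<otimes> g) = eg g" "tg (\<tau> \<otimes> g) = \<tau> \<otimes> tg g"
    using eg_unique[of "\<tau> \<otimes> g" "eg g" "\<tau> \<otimes> tg g"] g tau e c by auto
qed

text \<open>The factor \<open>c\<close> comes from bringing \<open>x \<otimes> e\<close> back to its
  representative modulo \<open>C\<close>, so one \<open>c\<close> serves all \<open>g\<close> with
  the same \<open>eg g\<close>. In particular it serves \<open>g\<close> and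
  \<open>\<tau> \<otimes> g\<close>, as \<open>phi_E\<close> requires.\<close>

lemma eg_E_left:
  assumes x: "x \<in> E" and e: "e \<in> E"
  shows "\<exists>c\<in>C. \<forall>g\<in>carrier G. eg g = e \<longrightarrow> tg (x \<otimes> g) = c \<otimes> tg g"
proof -
  have xe: "x \<otimes> e \<in> E" using x e by auto
  obtain c where c: "c \<in> C" "x \<otimes> e = c \<otimes> rC (x \<otimes> e)" "rC (x \<otimes> e) \<in> E" "rC (rC (x \<otimes> e)) = rC (x \<otimes> e)"
    by (rule rC_E[OF xe])
  have "tg (x \<otimes> g) = c \<otimes> tg g" if g: "g \<in> carrier G" and eg: "eg g = e" for g
  proof -
    obtain t: "tg g \<in> T" "g = e \<otimes> tg g \<otimes> jj g" "jj g \<in> carrier G"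
      using eg_E[OF g] eg by metis
    have ca: "x \<in> carrier G" "e \<in> carrier G" "tg g \<in> carrier G" "c \<in> carrier G" "rC (x \<otimes> e) \<in> carrier G"
      using x e t c by auto
    have j: "jj (x \<otimes> g) = jj g" using jj_eq x g by simp
    have "x \<otimes> g = x \<otimes> (e \<otimes> tg g \<otimes> jj g)" using t(2) by simp
    also have "\<dots> = (x \<otimes> e) \<otimes> tg g \<otimes> jj g" using ca t(3) by (simp add: m_assoc)
    also have "x \<otimes> e = rC (x \<otimes> e) \<otimes> c" using c(2) C_central[OF c(1), of "rC (x \<otimes> e)"] c(3) by simp
    also have "rC (x \<otimes> e) \<otimes> c \<otimes> tg g \<otimes> jj g = rC (x \<otimes> e) \<otimes> (c \<otimes> tg g) \<otimes> jj (x \<otimes> g)"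
      unfolding j using ca t(3) by (simp add: m_assoc)
    finally have "x \<otimes> g = rC (x \<otimes> e) \<otimes> (c \<otimes> tg g) \<otimes> jj (x \<otimes> g)" .
    moreover have "c \<otimes> tg g \<in> T" using c t by auto
    ultimately show ?thesis using eg_unique(2)[of "x \<otimes> g"] c ca g by simp
  qed
  then show ?thesis using c(1) by blast
qed

text \<open>Modulo \<open>K\<close> the equation reads \<open>w y = w' y\<close>.\<close>

lemma middle_factor:
  assumes K: "K \<lhd> G" and k: "x \<in> K" "e \<in> K" "r \<in> K" "e' \<in> K" "r' \<in> K"
    and c: "w \<in> carrier G" "w' \<in> carrier G" "y \<in> carrier G"
    and "x \<otimes> (e \<otimes> w \<otimes> r \<otimes> y) = e' \<otimes> w' \<otimes> r' \<otimes> y"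
  shows "w' \<otimes> inv w \<in> K"
proof -
  interpret K: normal K G by (rule K)
  note kc = k[THEN K.mem_carrier]
  have "(x \<otimes> e \<otimes> w \<otimes> r) \<otimes> y = (e' \<otimes> w' \<otimes> r') \<otimes> y" using assms(10) c kc by (simp add: m_assoc)
  then have eq: "x \<otimes> e \<otimes> w \<otimes> r = e' \<otimes> w' \<otimes> r'" using c kc by simp
  have "w' \<otimes> inv w = inv e' \<otimes> (e' \<otimes> w' \<otimes> r') \<otimes> inv r' \<otimes> inv w" using c kc by (simp add: word_simps)
  also have "\<dots> = inv e' \<otimes> x \<otimes> e \<otimes> (w \<otimes> (r \<otimes> inv r') \<otimes> inv w)"
    unfolding eq[symmetric] using c kc by (simp add: m_assoc)
  also have "\<dots> \<in> K" by (intro K.m_closed K.m_inv_closed K.inv_op_closed2 c k)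
  finally show ?thesis .
qed

text \<open>Substituting \<open>jj g = th g r (yy g)\<close> writes \<open>g\<close> as
  \<open>tg g \<otimes> th g\<close> between elements of \<open>R\<close>, times
  \<open>yy g\<close>. As \<open>yy\<close> does not change under \<open>R\<close>, the middle
  factors of \<open>g\<close> and \<open>\<rho> g\<close> agree modulo \<open>R\<close>, and they
  lie in \<open>T\<close>.\<close>

lemma tg_R:
  assumes g: "g \<in> carrier G" and rho: "\<rho> \<in> R"
  shows "\<exists>b\<in>B. tg (\<rho> \<otimes> g) \<otimes> th (\<rho> \<otimes> g) = b \<otimes> (tg g \<otimes> th g)"
proof -
  have rc: "\<rho> \<in> carrier G" using rho by simp
  have rg: "\<rho> \<otimes> g \<in> carrier G" using rc g by simp
  have y: "yy (\<rho> \<otimes> g) = yy g" using yy_eq rho g by simp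
  have yc: "yy g \<in> carrier G" by (rule yy_E[OF g])
  have dec: "\<exists>e\<in>R. \<exists>r\<in>R. g = e \<otimes> (tg g \<otimes> th g) \<otimes> r \<otimes> yy g \<and> tg g \<otimes> th g \<in> T" if g: "g \<in> carrier G" for g
  proof -
    obtain e: "eg g \<in> E" "tg g \<in> T" "g = eg g \<otimes> tg g \<otimes> jj g" "jj g \<in> carrier G" by (rule eg_E[OF g])
    obtain r where r: "th g \<in> T0" "r \<in> R" "jj g = th g \<otimes> r \<otimes> yy g" by (rule th_E[OF g])
    have yc: "yy g \<in> carrier G" by (rule yy_E[OF g])
    have c: "eg g \<in> carrier G" "tg g \<in> carrier G" "th g \<in> carrier G" "r \<in> carrier G" using e r by auto
    have "g = eg g \<otimes> tg g \<otimes> (th g \<otimes> r \<otimes> yy g)" using e(3) r(3) by simp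
    also have "\<dots> = eg g \<otimes> (tg g \<otimes> th g) \<otimes> r \<otimes> yy g" using c yc by (simp add: m_assoc)
    finally show ?thesis using e r by auto
  qed
  define w w' where "w = tg g \<otimes> th g" and "w' = tg (\<rho> \<otimes> g) \<otimes> th (\<rho> \<otimes> g)"
  obtain e r where e: "e \<in> R" "r \<in> R" "g = e \<otimes> w \<otimes> r \<otimes> yy g" "w \<in> T" using dec[OF g] by (auto simp: w_def)
  obtain e' r' where e': "e' \<in> R" "r' \<in> R" "\<rho> \<otimes> g = e' \<otimes> w' \<otimes> r' \<otimes> yy g" "w' \<in> T"
    using dec[OF rg] y by (auto simp: w'_def)
  have c: "e \<in> carrier G" "r \<in> carrier G" "w \<in> carrier G" "e' \<in> carrier G" "r' \<in> carrier G" "w' \<in> carrier G"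
    using e e' by auto
  have "\<rho> \<otimes> (e \<otimes> w \<otimes> r \<otimes> yy g) = e' \<otimes> w' \<otimes> r' \<otimes> yy g" using e(3) e'(3) by simp
  from middle_factor[OF normal_R rho e(1,2) e'(1,2) c(3,6) yc this] have "w' \<otimes> inv w \<in> B" using e e' by auto
  moreover have "w' = (w' \<otimes> inv w) \<otimes> w" using c by (simp add: m_assoc)
  ultimately show ?thesis unfolding w_def w'_def by blast
qed

text \<open>The same comparison modulo \<open>S\<close>, now with \<open>zz\<close> as the fixed
  right end: \<open>jj g\<close> lies in \<open>S (zz g)\<close>, so \<open>tg g\<close> alone is
  the middle factor.\<close>

lemma tg_S:
  assumes g: "g \<in> carrier G" and sig: "\<sigma> \<in> S"
  shows "\<exists>a\<in>A. tg (\<sigma> \<otimes> g) = a \<otimes> tg g"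
proof -
  have rc: "\<sigma> \<in> carrier G" using sig by simp
  have rg: "\<sigma> \<otimes> g \<in> carrier G" using rc g by simp
  have y: "zz (\<sigma> \<otimes> g) = zz g" using zz_eq sig g by simp
  have yc: "zz g \<in> carrier G" by (rule zz_E[OF g])
  have dec: "\<exists>e\<in>S. \<exists>r\<in>S. g = e \<otimes> tg g \<otimes> r \<otimes> zz g \<and> tg g \<in> T" if g: "g \<in> carrier G" for g
  proof -
    obtain e: "eg g \<in> E" "tg g \<in> T" "g = eg g \<otimes> tg g \<otimes> jj g" "jj g \<in> carrier G" by (rule eg_E[OF g])
    obtain s where s: "s \<in> S" "jj g = s \<otimes> zz g" by (rule jj_E[OF g])
    have yc: "zz g \<in> carrier G" by (rule zz_E[OF g])
    have c: "eg g \<in> carrier G" "tg g \<in> carrier G" "s \<in> carrier G" using e s by auto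
    have "g = eg g \<otimes> tg g \<otimes> (s \<otimes> zz g)" using e(3) s(2) by simp
    also have "\<dots> = eg g \<otimes> tg g \<otimes> s \<otimes> zz g" using c yc by (simp add: m_assoc)
    finally show ?thesis using e s by auto
  qed
  define w w' where "w = tg g" and "w' = tg (\<sigma> \<otimes> g)"
  obtain e r where e: "e \<in> S" "r \<in> S" "g = e \<otimes> w \<otimes> r \<otimes> zz g" "w \<in> T" using dec[OF g] by (auto simp: w_def)
  obtain e' r' where e': "e' \<in> S" "r' \<in> S" "\<sigma> \<otimes> g = e' \<otimes> w' \<otimes> r' \<otimes> zz g" "w' \<in> T"
    using dec[OF rg] y by (auto simp: w'_def)
  have c: "e \<in> carrier G" "r \<in> carrier G" "w \<in> carrier G" "e' \<in> carrier G" "r' \<in> carrier G" "w' \<in> carrier G"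
    using e e' by auto
  have "\<sigma> \<otimes> (e \<otimes> w \<otimes> r \<otimes> zz g) = e' \<otimes> w' \<otimes> r' \<otimes> zz g" using e(3) e'(3) by simp
  from middle_factor[OF normal_S sig e(1,2) e'(1,2) c(3,6) yc this] have "w' \<otimes> inv w \<in> A" using e e' by auto
  moreover have "w' = (w' \<otimes> inv w) \<otimes> w" using c by (simp add: m_assoc)
  ultimately show ?thesis unfolding w_def w'_def by blast
qed

section \<open>The function on the group and its difference relations\<close>

definition phi where "phi g = Fn (th g) (tg g)"

lemma phi_args:
  assumes g: "g \<in> carrier G"
  obtains "th g \<in> T0" "tg g \<in> T"
  using th_E[OF g] eg_E[OF g] by metis

lemma phi_closed:
  assumes g: "g \<in> carrier G"
  shows "phi g \<in> carrier centre"
  by (rule phi_args[OF g]) (simp add: phi_def Fn_closed)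

lemma phi_C:
  assumes g: "g \<in> carrier G" and c: "c \<in> C"
  shows "phi (c \<otimes> g) = lop c c \<circ> phi g"
proof (rule phi_args[OF g])
  assume t: "th g \<in> T0" "tg g \<in> T"
  have "c \<in> T" using c by auto
  then show ?thesis using th_eq[of c g] eg_T(2)[OF g, of c] Fn_C[OF t(2,1) c] g by (simp add: phi_def)
qed

text \<open>The extension of \<open>phi\<close> kills \<open>(a - 1)(\<rho> - 1) g\<close>.
  Multiplying by \<open>a\<close> only shifts \<open>tg g\<close>, with an effect that depends on
  the \<open>B\<close>-coset of \<open>tg g \<otimes> th g\<close>, and \<open>\<rho>\<close>
  preserves this coset by \<open>tg_R\<close>.\<close>

lemma phi_A:
  assumes g: "g \<in> carrier G" and a: "a \<in> A" and rho: "\<rho> \<in> R"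
  shows "phi (a \<otimes> g) \<circ> phi (\<rho> \<otimes> g) = phi (a \<otimes> (\<rho> \<otimes> g)) \<circ> phi g"
proof -
  have rg: "\<rho> \<otimes> g \<in> carrier G" and aT: "a \<in> T" using rho g a by auto
  obtain b where b: "b \<in> B" "tg (\<rho> \<otimes> g) \<otimes> th (\<rho> \<otimes> g) = b \<otimes> (tg g \<otimes> th g)"
    using tg_R[OF g rho] by blast
  obtain t: "th g \<in> T0" "tg g \<in> T" by (rule phi_args[OF g])
  obtain t': "th (\<rho> \<otimes> g) \<in> T0" "tg (\<rho> \<otimes> g) \<in> T" by (rule phi_args[OF rg])
  show ?thesis
    using Fn_A[OF t(2,1) t'(2,1) a b] eg_T(2)[OF g aT] eg_T(2)[OF rg aT] th_eq[of a g] th_eq[of a "\<rho> \<otimes> g"] g rg aT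
    by (simp add: phi_def)
qed

text \<open>The analogue for \<open>(b - 1)(\<sigma> - 1) g\<close>: the effect of \<open>b\<close>
  depends only on the \<open>A\<close>-coset of \<open>tg g\<close>, which \<open>\<sigma>\<close>
  preserves by \<open>tg_S\<close>.\<close>

lemma phi_B:
  assumes g: "g \<in> carrier G" and b: "b \<in> B" and sig: "\<sigma> \<in> S"
  shows "phi (b \<otimes> g) \<circ> phi (\<sigma> \<otimes> g) = phi (b \<otimes> (\<sigma> \<otimes> g)) \<circ> phi g"
proof -
  have rg: "\<sigma> \<otimes> g \<in> carrier G" and bT: "b \<in> T" using sig g b by auto
  obtain a where a: "a \<in> A" "tg (\<sigma> \<otimes> g) = a \<otimes> tg g"
    using tg_S[OF g sig] by blast
  obtain t: "th g \<in> T0" "tg g \<in> T" by (rule phi_args[OF g])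
  obtain t': "th (\<sigma> \<otimes> g) \<in> T0" "tg (\<sigma> \<otimes> g) \<in> T" by (rule phi_args[OF rg])
  show ?thesis
    using Fn_B[OF t(2,1) t'(1) a(1) b] a(2) eg_T(2)[OF g bT] eg_T(2)[OF rg bT] th_eq[of b g] th_eq[of b "\<sigma> \<otimes> g"] g rg bT
    by (simp add: phi_def)
qed

text \<open>The analogue for \<open>(x - 1)(\<tau> - 1) g\<close>: multiplying by \<open>x\<close>
  changes \<open>tg\<close> by a factor \<open>c\<close> in \<open>C\<close>, hence
  \<open>phi\<close> by \<open>lop c c\<close>, with the same \<open>c\<close> at \<open>g\<close>
  and at \<open>\<tau> \<otimes> g\<close>.\<close>

lemma phi_E:
  assumes g: "g \<in> carrier G" and x: "x \<in> E" and tau: "\<tau> \<in> T"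
  shows "phi (x \<otimes> g) \<circ> phi (\<tau> \<otimes> g) = phi (x \<otimes> (\<tau> \<otimes> g)) \<circ> phi g"
proof -
  have rg: "\<tau> \<otimes> g \<in> carrier G" using tau g by auto
  obtain e: "eg g \<in> E" by (rule eg_E[OF g])
  obtain c where c: "c \<in> C" "\<And>g'. g' \<in> carrier G \<Longrightarrow> eg g' = eg g \<Longrightarrow> tg (x \<otimes> g') = c \<otimes> tg g'"
    using eg_E_left[OF x e] by blast
  have 1: "phi (x \<otimes> g') = lop c c \<circ> phi g'" if g': "g' \<in> carrier G" "eg g' = eg g" for g'
  proof (rule phi_args[OF g'(1)])
    assume t: "th g' \<in> T0" "tg g' \<in> T"
    show ?thesis using c(2)[OF g'] th_eq[of x g'] x g' Fn_C[OF t(2,1) c(1)] by (simp add: phi_def)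
  qed
  have "phi g \<circ> phi (\<tau> \<otimes> g) = phi (\<tau> \<otimes> g) \<circ> phi g"
    by (rule centre_commute[OF phi_closed[OF g] centre_central[OF phi_closed[OF rg]]])
  then show ?thesis
    unfolding 1[OF g refl] 1[OF rg eg_T(1)[OF g tau]] by (simp only: comp_assoc)
qed

definition phiU where "phiU \<tau> g = uT \<tau> (tg g \<otimes> th g)"
definition phiV where "phiV \<tau> g = vT \<tau> (tg g)"

text \<open>The source of the third-difference condition: the increment under \<open>\<tau>\<close>
  is a product of an \<open>R\<close>-invariant factor (\<open>phiU_R\<close>) and an
  \<open>S\<close>-invariant one (\<open>phiV_S\<close>), so a further difference in
  \<open>R\<close> and one in \<open>S\<close> annihilate it.\<close>

lemma phi_T:
  assumes g: "g \<in> carrier G" and tau: "\<tau> \<in> T"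
  shows "phi (\<tau> \<otimes> g) = phiU \<tau> g \<circ> phiV \<tau> g \<circ> phi g"
    and "phiU \<tau> g \<in> carrier centre" "phiV \<tau> g \<in> carrier centre"
proof -
  obtain t: "th g \<in> T0" "tg g \<in> T" by (rule phi_args[OF g])
  show "phi (\<tau> \<otimes> g) = phiU \<tau> g \<circ> phiV \<tau> g \<circ> phi g"
    using Fn_T[OF tau t(2,1)] eg_T(2)[OF g tau] th_eq[of \<tau> g] tau g by (simp add: phi_def phiU_def phiV_def)
  show "phiU \<tau> g \<in> carrier centre" unfolding phiU_def by (rule uT_closed[OF tau]) (use t in simp)
  show "phiV \<tau> g \<in> carrier centre" unfolding phiV_def by (rule vT_closed(1)[OF tau t(2)])
qed

lemma phiU_R:
  assumes g: "g \<in> carrier G" and tau: "\<tau> \<in> T" and rho: "\<rho> \<in> R"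
  shows "phiU \<tau> (\<rho> \<otimes> g) = phiU \<tau> g"
proof -
  obtain t: "th g \<in> T0" "tg g \<in> T" by (rule phi_args[OF g])
  then have "tg g \<otimes> th g \<in> T" by simp
  then show ?thesis using tg_R[OF g rho] uT_B[OF tau] unfolding phiU_def by metis
qed

lemma phiV_S:
  assumes g: "g \<in> carrier G" and tau: "\<tau> \<in> T" and sig: "\<sigma> \<in> S"
  shows "phiV \<tau> (\<sigma> \<otimes> g) = phiV \<tau> g"
proof -
  obtain t: "th g \<in> T0" "tg g \<in> T" by (rule phi_args[OF g])
  then show ?thesis using tg_S[OF g sig] vT_A[OF tau] unfolding phiV_def by metis
qed

end

section \<open>Functionals on the group ring\<close>

abbreviation (input) "aug \<equiv> relative_augmentation_ideal"

context group begin

lemma group_ring_simps [simp]: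
  "x \<in> carrier (group_ring G) \<longleftrightarrow> Poly_Mapping.keys x \<subseteq> carrier G"
  "x \<otimes>\<^bsub>group_ring G\<^esub> y = group_ring_mult G x y"
  "x \<oplus>\<^bsub>group_ring G\<^esub> y = x + y"
  "\<zero>\<^bsub>group_ring G\<^esub> = 0"
  by (simp_all add: group_ring_def)

lemma frag_minus_one_eq: "g \<in> carrier G \<Longrightarrow>
    frag_of g \<ominus>\<^bsub>group_ring G\<^esub> \<one>\<^bsub>group_ring G\<^esub> = frag_of g - frag_of \<one>"
  using group_ring_minus[of "frag_of g" "frag_of \<one>"] by (simp add: group_ring_def)

lemma keys_diff_subset:
  "\<lbrakk>Poly_Mapping.keys x \<subseteq> K; Poly_Mapping.keys y \<subseteq> K\<rbrakk> \<Longrightarrow> Poly_Mapping.keys (x - y :: 'k \<Rightarrow>\<^sub>0 int) \<subseteq> K"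
  using keys_diff[of x y] by blast

text \<open>The projection of \<open>Z[G]\<close> to \<open>Z[G/N]\<close>, with the target regarded
  as the free abelian group on the cosets.\<close>

definition push where "push N = frag_extend (\<lambda>g. frag_of (N #> g))"

lemma push_frag [simp]: "push N (frag_of g) = frag_of (N #> g)"
  by (simp add: push_def)

lemma push_diff: "push N (x - y) = push N x - push N y"
  by (simp add: push_def frag_extend_diff)

lemma push_left:
  assumes N: "N \<lhd> G" and g: "g \<in> carrier G" and x: "Poly_Mapping.keys x \<subseteq> carrier G"
  shows "push N (group_ring_mult G (frag_of g) x) = frag_extend (\<lambda>K. frag_of (g <# K)) (push N x)"
  using x
proof (induction x rule: frag_induction)
  case (one h)
  interpret N: normal N G by (rule N)
  have "N #> (g \<otimes> h) = g <# (N #> h)"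
    using one g N.subset by (metis N.coset_eq coset_assoc coset_mult_assoc)
  then show ?case by simp
qed (simp_all add: push_def group_ring_mult_diff_right frag_extend_diff)

lemma push_right:
  assumes N: "N \<lhd> G" and g: "g \<in> carrier G" and x: "Poly_Mapping.keys x \<subseteq> carrier G"
  shows "push N (group_ring_mult G x (frag_of g)) = frag_extend (\<lambda>K. frag_of (K #> g)) (push N x)"
  using x
proof (induction x rule: frag_induction)
  case (one h)
  interpret N: normal N G by (rule N)
  have "N #> (h \<otimes> g) = (N #> h) #> g"
    using one g N.subset by (simp add: coset_mult_assoc)
  then show ?case by simp
qed (simp_all add: push_def group_ring_mult_diff_left frag_extend_diff)

text \<open>Multiplication by a group element permutes the cosets of \<open>N\<close>, so the kernel
  of \<open>push\<close> is a two-sided ideal, and it contains the generators of the augmentation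
  ideal.\<close>

lemma aug_push:
  assumes N: "N \<lhd> G" and x: "x \<in> aug G N"
  shows "push N x = 0"
proof -
  interpret N: normal N G by (rule N)
  interpret ZG: ring "group_ring G" by (rule ring_group_ring)
  define K where "K = {x. Poly_Mapping.keys x \<subseteq> carrier G \<and> push N x = 0}"
  have left: "push N (group_ring_mult G y x) = 0" if x: "x \<in> K" and y: "Poly_Mapping.keys y \<subseteq> carrier G" for x y
    using y
  proof (induction y rule: frag_induction)
    case (one h)
    then show ?case using push_left[OF N one, of x] x by (simp add: K_def)
  qed (simp_all add: push_def group_ring_mult_diff_left frag_extend_diff)
  have right: "push N (group_ring_mult G x y) = 0" if x: "x \<in> K" and y: "Poly_Mapping.keys y \<subseteq> carrier G" for x y
    using y
  proof (induction y rule: frag_induction)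
    case (one h)
    then show ?case using push_right[OF N one, of x] x by (simp add: K_def)
  qed (simp_all add: push_def group_ring_mult_diff_right frag_extend_diff)
  have "ideal K (group_ring G)"
  proof (rule idealI)
    show "ring (group_ring G)" by (rule ring_group_ring)
    show "subgroup K (add_monoid (group_ring G))"
    proof (rule ZG.add.subgroupI)
      show "K \<subseteq> carrier (group_ring G)" by (auto simp: K_def)
      show "K \<noteq> {}" unfolding K_def push_def by (auto intro!: exI[of _ 0])
    next
      fix x assume x: "x \<in> K"
      have "\<ominus>\<^bsub>group_ring G\<^esub> x = 0 - x"
        using group_ring_minus[of 0 x] x ZG.minus_eq[of 0 x] by (simp add: K_def a_minus_def)
      then show "\<ominus>\<^bsub>group_ring G\<^esub> x \<in> K" using x by (simp add: K_def push_def frag_extend_minus)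
    next
      fix x y assume xy: "x \<in> K" "y \<in> K"
      then show "x \<oplus>\<^bsub>group_ring G\<^esub> y \<in> K"
        using keys_add[of x y] by (auto simp: K_def push_def frag_extend_add)
    qed
  next
    fix x y assume "x \<in> K" "y \<in> carrier (group_ring G)"
    then show "y \<otimes>\<^bsub>group_ring G\<^esub> x \<in> K" "x \<otimes>\<^bsub>group_ring G\<^esub> y \<in> K"
      using left right group_ring_mult_closed by (simp_all add: K_def)
  qed
  moreover have "frag_of n \<ominus>\<^bsub>group_ring G\<^esub> \<one>\<^bsub>group_ring G\<^esub> \<in> K" if n: "n \<in> N" for n
  proof -
    have nc: "n \<in> carrier G" using n by simp
    have "N #> n = N #> \<one>" using n N.subset by (simp add: N.rcos_const)
    then have "push N (frag_of n - frag_of \<one>) = 0" by (simp add: push_diff)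
    then show ?thesis unfolding frag_minus_one_eq[OF nc] K_def
      using keys_diff_subset[of "frag_of n" "carrier G" "frag_of \<one>"] nc by simp
  qed
  ultimately have "aug G N \<subseteq> K"
    unfolding relative_augmentation_ideal_def by (intro ZG.genideal_minimal) auto
  then show ?thesis using x by (auto simp: K_def)
qed

lemma aug_carrier: "N \<lhd> G \<Longrightarrow> x \<in> aug G N \<Longrightarrow> Poly_Mapping.keys x \<subseteq> carrier G"
  using ideal.Icarr[OF ideal_relative_augmentation_ideal, of N x] normal_imp_subgroup subgroup.subset
  by (metis group_ring_simps(1))

end

section \<open>Additive extensions and intersections of augmentation ideals\<close>

locale group_functionals = group G + H: comm_group H for G (structure) and H (structure)
begin

abbreviation hmult (infixl "\<cdot>" 70) where "x \<cdot> y \<equiv> x \<otimes>\<^bsub>H\<^esub> y"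

definition ext where
  "ext \<psi> = (SOME h. h \<in> hom (free_Abelian_group (carrier G)) H \<and> (\<forall>g\<in>carrier G. h (frag_of g) = \<psi> g))"

lemma ext_props:
  assumes "\<psi> \<in> carrier G \<rightarrow> carrier H"
  shows "ext \<psi> \<in> hom (free_Abelian_group (carrier G)) H" "\<And>g. g \<in> carrier G \<Longrightarrow> ext \<psi> (frag_of g) = \<psi> g"
proof -
  have "\<psi> ` carrier G \<subseteq> carrier H" using assms by blast
  then obtain h where "h \<in> hom (free_Abelian_group (carrier G)) H" "\<And>g. g \<in> carrier G \<Longrightarrow> h (frag_of g) = \<psi> g"
    using H.free_Abelian_group_universal by metis
  then have "\<exists>h. h \<in> hom (free_Abelian_group (carrier G)) H \<and> (\<forall>g\<in>carrier G. h (frag_of g) = \<psi> g)"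
    by blast
  then have "ext \<psi> \<in> hom (free_Abelian_group (carrier G)) H \<and> (\<forall>g\<in>carrier G. ext \<psi> (frag_of g) = \<psi> g)"
    unfolding ext_def by (rule someI_ex)
  then show "ext \<psi> \<in> hom (free_Abelian_group (carrier G)) H" "\<And>g. g \<in> carrier G \<Longrightarrow> ext \<psi> (frag_of g) = \<psi> g"
    by blast+
qed

abbreviation Z :: "('a \<Rightarrow>\<^sub>0 int) set" where "Z \<equiv> {x. Poly_Mapping.keys x \<subseteq> carrier G}"

text \<open>Additivity is stated for differences because \<open>frag_induction\<close> builds the
  elements by differences.\<close>

definition ahom where
  "ahom h \<longleftrightarrow> (\<forall>x\<in>Z. h x \<in> carrier H) \<and> (\<forall>x\<in>Z. \<forall>y\<in>Z. h (x - y) = h x \<cdot> inv\<^bsub>H\<^esub> h y)"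

lemma ahomI:
  assumes "\<And>x. x \<in> Z \<Longrightarrow> h x \<in> carrier H"
    and "\<And>x y. \<lbrakk>x \<in> Z; y \<in> Z\<rbrakk> \<Longrightarrow> h (x - y) = h x \<cdot> inv\<^bsub>H\<^esub> h y"
  shows "ahom h"
  unfolding ahom_def using assms by blast

lemma quotient_one:
  assumes "a \<cdot> inv\<^bsub>H\<^esub> b = \<one>\<^bsub>H\<^esub>" "a \<in> carrier H" "b \<in> carrier H"
  shows "a = b"
proof -
  have "a = a \<cdot> inv\<^bsub>H\<^esub> b \<cdot> b" using assms(2,3) by (simp add: H.m_assoc)
  then show ?thesis using assms by simp
qed

lemma ahom_zero:
  assumes "ahom h"
  shows "h 0 = \<one>\<^bsub>H\<^esub>"
proof -
  have z: "(0 :: 'a \<Rightarrow>\<^sub>0 int) \<in> Z" by simp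
  have c: "h 0 \<in> carrier H" and "h (0 - 0) = h 0 \<cdot> inv\<^bsub>H\<^esub> h 0"
    using assms z unfolding ahom_def by blast+
  then show ?thesis using H.r_inv[OF c] by simp
qed

lemma ahom_add:
  assumes h: "ahom h" and x: "x \<in> Z" and y: "y \<in> Z"
  shows "h (x + y) = h x \<cdot> h y"
proof -
  have "x + y \<in> Z" using x y keys_add[of x y] by auto
  then have "h (x + y - y) = h (x + y) \<cdot> inv\<^bsub>H\<^esub> h y" "h (x + y) \<in> carrier H" "h y \<in> carrier H"
    using h y unfolding ahom_def by blast+
  then show ?thesis by (simp add: H.m_assoc)
qed

lemma ahom_eqI:
  assumes h: "ahom h" and k: "ahom k" and eq: "\<And>g. g \<in> carrier G \<Longrightarrow> h (frag_of g) = k (frag_of g)" and x: "x \<in> Z"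
  shows "h x = k x"
proof -
  have "Poly_Mapping.keys x \<subseteq> carrier G" using x by simp
  then have "x \<in> Z \<and> h x = k x"
  proof (induction x rule: frag_induction)
    case zero
    then show ?case using ahom_zero[OF h] ahom_zero[OF k] by simp
  next
    case (one g)
    then show ?case using eq by simp
  next
    case (diff a b)
    then show ?case using h k keys_diff_subset[of a "carrier G" b] unfolding ahom_def by auto
  qed
  then show ?thesis by simp
qed

lemma ahom_ext:
  assumes "\<psi> \<in> carrier G \<rightarrow> carrier H"
  shows "ahom (ext \<psi>)"
proof -
  note e = ext_props(1)[OF assms]
  have mem: "ext \<psi> x \<in> carrier H" if "x \<in> Z" for x
    by (rule hom_in_carrier[OF e]) (use that in simp)
  have add: "ext \<psi> (x + y) = ext \<psi> x \<cdot> ext \<psi> y" if "x \<in> Z" "y \<in> Z" for x y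
    using hom_mult[OF e, of x y] that by simp
  have "ext \<psi> (x - y) = ext \<psi> x \<cdot> inv\<^bsub>H\<^esub> ext \<psi> y" if "x \<in> Z" "y \<in> Z" for x y
  proof -
    have d: "x - y \<in> Z" using that keys_diff_subset[of x "carrier G" y] by simp
    have "ext \<psi> x = ext \<psi> (x - y) \<cdot> ext \<psi> y" using add[OF d that(2)] by simp
    then show ?thesis using mem d that by (simp add: H.m_assoc)
  qed
  then show ?thesis using mem by (simp add: ahom_def)
qed

lemma ext_diff_one:
  assumes \<psi>: "\<psi> \<in> carrier G \<rightarrow> carrier H" and g: "g \<in> carrier G" and one: "ext \<psi> (frag_of g - frag_of \<one>) = \<one>\<^bsub>H\<^esub>"
  shows "\<psi> g = \<psi> \<one>"
proof -
  have "frag_of g \<in> Z" "frag_of \<one> \<in> Z" using g by simp_all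
  then have "ext \<psi> (frag_of g - frag_of \<one>) = ext \<psi> (frag_of g) \<cdot> inv\<^bsub>H\<^esub> ext \<psi> (frag_of \<one>)"
    using ahom_ext[OF \<psi>] unfolding ahom_def by blast
  then have "\<psi> g \<cdot> inv\<^bsub>H\<^esub> \<psi> \<one> = \<one>\<^bsub>H\<^esub>"
    using one ext_props(2)[OF \<psi> g] ext_props(2)[OF \<psi> one_closed] by argo
  then show ?thesis by (rule quotient_one) (use \<psi> g in auto)
qed

text \<open>By invariance \<open>h\<close> is constant on the cosets of \<open>N\<close>, so it
  factors through \<open>push N\<close>, which kills the ideal.\<close>

lemma ahom_kills_aug:
  assumes N: "N \<lhd> G" and h: "ahom h"
    and inv: "\<And>n g. \<lbrakk>n \<in> N; g \<in> carrier G\<rbrakk> \<Longrightarrow> h (frag_of (n \<otimes> g)) = h (frag_of g)"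
    and x: "x \<in> aug G N"
  shows "h x = \<one>\<^bsub>H\<^esub>"
proof -
  interpret N: normal N G by (rule N)
  define \<psi> where "\<psi> K = h (frag_of (SOME g. g \<in> K))" for K
  have h_closed: "h (frag_of g) \<in> carrier H" if "g \<in> carrier G" for g
    using h that unfolding ahom_def by auto
  have psi: "\<psi> (N #> g) = h (frag_of g)" if g: "g \<in> carrier G" for g
  proof -
    have "g \<in> N #> g" using rcos_self[OF g N.subgroup_axioms] .
    then have "(SOME u. u \<in> N #> g) \<in> N #> g" by (rule someI)
    then obtain n where "n \<in> N" "(SOME u. u \<in> N #> g) = n \<otimes> g" by (auto simp: r_coset_def)
    then show ?thesis using inv g by (simp add: \<psi>_def)
  qed
  have "\<psi> ` (rcosets N) \<subseteq> carrier H"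
    using psi h_closed by (auto simp: RCOSETS_def)
  then obtain k where k: "k \<in> hom (free_Abelian_group (rcosets N)) H" "\<And>K. K \<in> rcosets N \<Longrightarrow> k (frag_of K) = \<psi> K"
    using H.free_Abelian_group_universal by metis
  have "Poly_Mapping.keys x \<subseteq> carrier G" using aug_carrier[OF N x] .
  then have "Poly_Mapping.keys x \<subseteq> carrier G \<and> Poly_Mapping.keys (push N x) \<subseteq> rcosets N \<and> k (push N x) = h x"
  proof (induction x rule: frag_induction)
    case zero
    have "k 0 = \<one>\<^bsub>H\<^esub>" using hom_one[OF k(1)] by (simp add: H.is_group)
    then show ?case using ahom_zero[OF h] by (simp add: push_def)
  next
    case (one g)
    then have "N #> g \<in> rcosets N" by (auto simp: RCOSETS_def)
    then show ?case using k(2) psi one by simp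
  next
    case (diff a b)
    have hd: "h (a - b) = h a \<cdot> inv\<^bsub>H\<^esub> h b" using h diff unfolding ahom_def by blast
    have c: "k (push N a) \<in> carrier H" "k (push N b) \<in> carrier H"
      using h diff unfolding ahom_def by auto
    have p: "Poly_Mapping.keys (push N a - push N b) \<subseteq> rcosets N" using keys_diff_subset diff by blast
    have "k (push N a - push N b + push N b) = k (push N a - push N b) \<cdot> k (push N b)"
      using hom_mult[OF k(1), of "push N a - push N b" "push N b"] p diff by simp
    moreover have "k (push N a - push N b) \<in> carrier H"
      by (rule hom_in_carrier[OF k(1)]) (simp add: p)
    ultimately have "k (push N a - push N b) = k (push N a) \<cdot> inv\<^bsub>H\<^esub> k (push N b)"
      using c by (simp add: H.m_assoc)
    then show ?case using hd diff p keys_diff_subset[of a "carrier G" b] by (simp add: push_diff)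
  qed
  then have "h x = k 0" using aug_push[OF N x] by simp
  also have "\<dots> = \<one>\<^bsub>H\<^esub>" using hom_one[OF k(1)] by (simp add: H.is_group)
  finally show ?thesis .
qed

lemma ahom_mult:
  assumes "ahom h" "ahom k"
  shows "ahom (\<lambda>x. h x \<cdot> k x)"
proof -
  have "h (x - y) \<cdot> k (x - y) = h x \<cdot> k x \<cdot> inv\<^bsub>H\<^esub> (h y \<cdot> k y)"
    if xy: "x \<in> Z" "y \<in> Z" for x y
  proof -
    have "h (x - y) = h x \<cdot> inv\<^bsub>H\<^esub> h y" "k (x - y) = k x \<cdot> inv\<^bsub>H\<^esub> k y"
      "h x \<in> carrier H" "h y \<in> carrier H" "k x \<in> carrier H" "k y \<in> carrier H"
      using assms xy unfolding ahom_def by blast+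
    then show ?thesis by (simp add: H.inv_mult_group H.m_ac)
  qed
  moreover have "h x \<cdot> k x \<in> carrier H" if "x \<in> Z" for x
    using assms that unfolding ahom_def by simp
  ultimately show ?thesis unfolding ahom_def by blast
qed

text \<open>By \<open>mix\<close>, \<open>\<psi>\<close> is the product of an \<open>M\<close>-invariant and an \<open>L\<close>-invariant function, whose extensions kill
  the augmentation ideals of \<open>M\<close> and of \<open>L\<close>.\<close>

lemma ext_kills_inter:
  assumes L: "L \<lhd> G" and M: "M \<lhd> G"
    and closed: "\<And>g. g \<in> carrier G \<Longrightarrow> \<psi> g \<in> carrier H"
    and inv: "\<And>a g. \<lbrakk>a \<in> L; a \<in> M; g \<in> carrier G\<rbrakk> \<Longrightarrow> \<psi> (a \<otimes> g) = \<psi> g"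
    and mix: "\<And>y z g. \<lbrakk>y \<in> L; z \<in> M; g \<in> carrier G\<rbrakk> \<Longrightarrow>
      \<psi> (y \<otimes> z \<otimes> g) \<cdot> \<psi> g = \<psi> (y \<otimes> g) \<cdot> \<psi> (z \<otimes> g)"
    and x: "x \<in> aug G L" "x \<in> aug G M"
  shows "ext \<psi> x = \<one>\<^bsub>H\<^esub>"
proof -
  interpret L: normal L G by (rule L)
  interpret M: normal M G by (rule M)
  have closed_Pi: "\<psi> \<in> carrier G \<rightarrow> carrier H" using closed by blast
  define rep where "rep g = (SOME u. \<exists>y\<in>L. \<exists>z\<in>M. u = y \<otimes> z \<otimes> g)" for g
  have sub: "\<exists>y\<in>L. \<exists>z\<in>M. u = y \<otimes> z \<otimes> g"
    if g: "g \<in> carrier G" and w: "w \<in> L \<or> w \<in> M" and u: "\<exists>y\<in>L. \<exists>z\<in>M. u = y \<otimes> z \<otimes> (w \<otimes> g)" for g w u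
  proof -
    obtain y z where yz: "y \<in> L" "z \<in> M" "u = y \<otimes> z \<otimes> (w \<otimes> g)" using u by blast
    have c: "y \<in> carrier G" "z \<in> carrier G" "w \<in> carrier G" using yz w by auto
    show ?thesis
      using w
    proof
      assume w: "w \<in> L"
      have "u = (y \<otimes> (z \<otimes> w \<otimes> inv z)) \<otimes> z \<otimes> g" unfolding yz using c g by (simp add: word_simps)
      moreover have "y \<otimes> (z \<otimes> w \<otimes> inv z) \<in> L" using yz w c by (simp add: L.inv_op_closed2)
      ultimately show ?thesis using yz by blast
    next
      assume w: "w \<in> M"
      have "u = y \<otimes> (z \<otimes> w) \<otimes> g" unfolding yz using c g by (simp add: m_assoc)
      then show ?thesis using yz w M.m_closed by blast
    qed
  qed
  have rep_eq: "rep (w \<otimes> g) = rep g" if g: "g \<in> carrier G" and w: "w \<in> L \<or> w \<in> M" for w g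
  proof -
    have wc: "w \<in> carrier G" and iw: "inv w \<in> L \<or> inv w \<in> M" using w by auto
    have "(\<exists>y\<in>L. \<exists>z\<in>M. u = y \<otimes> z \<otimes> (w \<otimes> g)) \<longleftrightarrow> (\<exists>y\<in>L. \<exists>z\<in>M. u = y \<otimes> z \<otimes> g)" for u
      using sub[OF g w, of u] sub[OF m_closed[OF wc g] iw, of u] inv_mult_cancel_left[OF wc g] by metis
    then show ?thesis unfolding rep_def by simp
  qed
  have rep_E: "\<exists>y z. y \<in> L \<and> z \<in> M \<and> g = y \<otimes> z \<otimes> rep g \<and> rep g \<in> carrier G" if g: "g \<in> carrier G" for g
  proof -
    have "\<exists>y\<in>L. \<exists>z\<in>M. g = y \<otimes> z \<otimes> g" using g by (intro bexI[of _ \<one>]) simp_all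
    then have "\<exists>y\<in>L. \<exists>z\<in>M. rep g = y \<otimes> z \<otimes> g" unfolding rep_def by (rule someI)
    then obtain y z where yz: "y \<in> L" "z \<in> M" "rep g = y \<otimes> z \<otimes> g" by blast
    have c: "y \<in> carrier G" "z \<in> carrier G" using yz by auto
    have "g = (inv z \<otimes> inv y \<otimes> z) \<otimes> inv z \<otimes> rep g" unfolding yz using c g by (simp add: word_simps)
    moreover have "inv z \<otimes> inv y \<otimes> z \<in> L" using yz c by (simp add: L.inv_op_closed1)
    ultimately show ?thesis using yz c g by (metis M.m_inv_closed m_closed)
  qed
  then obtain Y W where YW: "\<And>g. g \<in> carrier G \<Longrightarrow> Y g \<in> L \<and> W g \<in> M \<and> g = Y g \<otimes> W g \<otimes> rep g \<and> rep g \<in> carrier G"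
    by metis
  \<comment> \<open>In \<open>g = Y W (rep g)\<close> the factors are unique up to
    \<open>L \<inter> M\<close>. Multiplying \<open>g\<close> by \<open>M\<close> therefore changes
    \<open>Y\<close> only by an element of \<open>L \<inter> M\<close>, which \<open>\<psi>\<close>
    ignores, and multiplying by \<open>L\<close> changes \<open>W\<close> likewise. The factor
    \<open>\<psi> (rep g)\<close> is divided out once, so that \<open>mix\<close> gives
    \<open>u \<cdot> v = \<psi>\<close>.\<close>
  define u where "u g = \<psi> (Y g \<otimes> rep g)" for g
  define v where "v g = inv\<^bsub>H\<^esub> \<psi> (rep g) \<cdot> \<psi> (W g \<otimes> rep g)" for g
  have uc: "u g \<in> carrier H" and vc: "v g \<in> carrier H" if g: "g \<in> carrier G" for g
  proof -
    have "Y g \<otimes> rep g \<in> carrier G" "W g \<otimes> rep g \<in> carrier G" "rep g \<in> carrier G" using YW[OF g] by auto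
    then show "u g \<in> carrier H" "v g \<in> carrier H" using closed by (simp_all add: u_def v_def)
  qed
  have uc_Pi: "u \<in> carrier G \<rightarrow> carrier H" and vc_Pi: "v \<in> carrier G \<rightarrow> carrier H"
    using uc vc by blast+
  have split: "u g \<cdot> v g = \<psi> g" if g: "g \<in> carrier G" for g
  proof -
    have "Y g \<otimes> rep g \<in> carrier G" "W g \<otimes> rep g \<in> carrier G" "rep g \<in> carrier G" using YW[OF g] by auto
    then have c: "\<psi> (Y g \<otimes> rep g) \<in> carrier H" "\<psi> (W g \<otimes> rep g) \<in> carrier H" "\<psi> (rep g) \<in> carrier H" "\<psi> g \<in> carrier H"
      using closed g by simp_all
    have "\<psi> g \<cdot> \<psi> (rep g) = \<psi> (Y g \<otimes> rep g) \<cdot> \<psi> (W g \<otimes> rep g)"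
      using mix[of "Y g" "W g" "rep g"] YW[OF g] by metis
    then have "\<psi> (Y g \<otimes> rep g) \<cdot> \<psi> (W g \<otimes> rep g) \<cdot> inv\<^bsub>H\<^esub> \<psi> (rep g) = \<psi> g"
      using c by (metis H.inv_solve_right H.m_closed)
    then show ?thesis unfolding u_def v_def using c by (simp add: H.m_ac)
  qed
  have u_inv: "u (w \<otimes> g) = u g" if g: "g \<in> carrier G" and w: "w \<in> M" for w g
  proof -
    have wg: "w \<otimes> g \<in> carrier G" using w g by simp
    have r: "rep (w \<otimes> g) = rep g" using rep_eq g w by blast
    note a = YW[OF g] YW[OF wg, unfolded r]
    have c: "Y g \<in> carrier G" "W g \<in> carrier G" "Y (w \<otimes> g) \<in> carrier G" "W (w \<otimes> g) \<in> carrier G" "rep g \<in> carrier G" "w \<in> carrier G"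
      using a w by auto
    have "w \<otimes> (Y g \<otimes> W g \<otimes> rep g) = Y (w \<otimes> g) \<otimes> W (w \<otimes> g) \<otimes> rep g" using a by simp
    then have "(w \<otimes> Y g \<otimes> W g) \<otimes> rep g = (Y (w \<otimes> g) \<otimes> W (w \<otimes> g)) \<otimes> rep g" using c by (simp add: m_assoc)
    then have eq: "w \<otimes> Y g \<otimes> W g = Y (w \<otimes> g) \<otimes> W (w \<otimes> g)" using c by simp
    define d where "d = Y (w \<otimes> g) \<otimes> inv (Y g)"
    have "d = (Y (w \<otimes> g) \<otimes> W (w \<otimes> g)) \<otimes> inv (W (w \<otimes> g)) \<otimes> inv (Y g)" using c by (simp add: d_def word_simps)
    also have "\<dots> = w \<otimes> (Y g \<otimes> (W g \<otimes> inv (W (w \<otimes> g))) \<otimes> inv (Y g))" unfolding eq[symmetric] using c by (simp add: m_assoc)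
    also have "\<dots> \<in> M" using a w c by (intro M.m_closed M.inv_op_closed2 M.m_inv_closed) auto
    finally have dM: "d \<in> M" .
    have dL: "d \<in> L" unfolding d_def using a by (intro L.m_closed L.m_inv_closed) auto
    have "Y (w \<otimes> g) \<otimes> rep g = d \<otimes> (Y g \<otimes> rep g)" using c by (simp add: d_def word_simps)
    then show ?thesis unfolding u_def r using inv[OF dL dM, of "Y g \<otimes> rep g"] c by simp
  qed
  have v_inv: "v (w \<otimes> g) = v g" if g: "g \<in> carrier G" and w: "w \<in> L" for w g
  proof -
    have wg: "w \<otimes> g \<in> carrier G" using w g by simp
    have r: "rep (w \<otimes> g) = rep g" using rep_eq g w by blast
    note a = YW[OF g] YW[OF wg, unfolded r]
    have c: "Y g \<in> carrier G" "W g \<in> carrier G" "Y (w \<otimes> g) \<in> carrier G" "W (w \<otimes> g) \<in> carrier G" "rep g \<in> carrier G" "w \<in> carrier G"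
      using a w by auto
    have "w \<otimes> (Y g \<otimes> W g \<otimes> rep g) = Y (w \<otimes> g) \<otimes> W (w \<otimes> g) \<otimes> rep g" using a by simp
    then have "(w \<otimes> Y g \<otimes> W g) \<otimes> rep g = (Y (w \<otimes> g) \<otimes> W (w \<otimes> g)) \<otimes> rep g" using c by (simp add: m_assoc)
    then have eq: "w \<otimes> Y g \<otimes> W g = Y (w \<otimes> g) \<otimes> W (w \<otimes> g)" using c by simp
    define d where "d = W (w \<otimes> g) \<otimes> inv (W g)"
    have "d = inv (Y (w \<otimes> g)) \<otimes> (Y (w \<otimes> g) \<otimes> W (w \<otimes> g)) \<otimes> inv (W g)" using c by (simp add: d_def word_simps)
    also have "\<dots> = inv (Y (w \<otimes> g)) \<otimes> (w \<otimes> Y g)" unfolding eq[symmetric] using c by (simp add: m_assoc)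
    also have "\<dots> \<in> L" using a w by (intro L.m_closed L.m_inv_closed) auto
    finally have dL: "d \<in> L" .
    have dM: "d \<in> M" unfolding d_def using a by (intro M.m_closed M.m_inv_closed) auto
    have "W (w \<otimes> g) \<otimes> rep g = d \<otimes> (W g \<otimes> rep g)" using c by (simp add: d_def word_simps)
    then show ?thesis unfolding v_def r using inv[OF dL dM, of "W g \<otimes> rep g"] c by simp
  qed
  have xZ: "x \<in> Z" using aug_carrier[OF L x(1)] by simp
  have "ext \<psi> x = ext u x \<cdot> ext v x"
    by (rule ahom_eqI[OF ahom_ext[OF closed_Pi] ahom_mult[OF ahom_ext[OF uc_Pi] ahom_ext[OF vc_Pi]] _ xZ])
      (simp_all add: ext_props(2)[OF closed_Pi] ext_props(2)[OF uc_Pi] ext_props(2)[OF vc_Pi] split)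
  also have "ext u x = \<one>\<^bsub>H\<^esub>"
    by (rule ahom_kills_aug[OF M ahom_ext[OF uc_Pi] _ x(2)]) (simp_all add: ext_props(2)[OF uc_Pi] u_inv)
  also have "ext v x = \<one>\<^bsub>H\<^esub>"
    by (rule ahom_kills_aug[OF L ahom_ext[OF vc_Pi] _ x(1)]) (simp_all add: ext_props(2)[OF vc_Pi] v_inv)
  finally show ?thesis by simp
qed

text \<open>Equivalently, the extension of \<open>\<phi>\<close> kills \<open>(x - 1) (y - 1) (z - 1) g\<close>.\<close>

definition tri where
  "tri \<phi> x y z g \<longleftrightarrow>
    \<phi> (x \<otimes> y \<otimes> z \<otimes> g) \<cdot> \<phi> (x \<otimes> g) \<cdot> (\<phi> (y \<otimes> g) \<cdot> \<phi> (z \<otimes> g)) =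
    \<phi> (x \<otimes> y \<otimes> g) \<cdot> \<phi> (x \<otimes> z \<otimes> g) \<cdot> (\<phi> (y \<otimes> z \<otimes> g) \<cdot> \<phi> g)"

section \<open>Products of ideals and third differences\<close>

lemma quotient_eq:
  assumes "a \<cdot> b = c \<cdot> d" "a \<in> carrier H" "b \<in> carrier H" "c \<in> carrier H" "d \<in> carrier H"
  shows "a \<cdot> inv\<^bsub>H\<^esub> d = c \<cdot> inv\<^bsub>H\<^esub> b"
proof -
  have "a \<cdot> inv\<^bsub>H\<^esub> d = (a \<cdot> b) \<cdot> (inv\<^bsub>H\<^esub> b \<cdot> inv\<^bsub>H\<^esub> d)"
    using assms(2-5) by (simp add: H.m_assoc H.mult_inv_cancel_left)
  also have "\<dots> = c \<cdot> inv\<^bsub>H\<^esub> b"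
    unfolding assms(1) using assms(2-5) by (simp add: H.m_comm[of "inv\<^bsub>H\<^esub> b" "inv\<^bsub>H\<^esub> d"] H.m_assoc H.mult_inv_cancel_left)
  finally show ?thesis .
qed

lemma quotient_mix:
  assumes "a \<cdot> b \<cdot> (c \<cdot> d) = e \<cdot> f \<cdot> (k \<cdot> l)"
    "a \<in> carrier H" "b \<in> carrier H" "c \<in> carrier H" "d \<in> carrier H"
    "e \<in> carrier H" "f \<in> carrier H" "k \<in> carrier H" "l \<in> carrier H"
  shows "(a \<cdot> inv\<^bsub>H\<^esub> k) \<cdot> (b \<cdot> inv\<^bsub>H\<^esub> l) = (e \<cdot> inv\<^bsub>H\<^esub> c) \<cdot> (f \<cdot> inv\<^bsub>H\<^esub> d)"
  using quotient_eq[OF assms(1)] assms(2-9) by (simp add: H.inv_mult_group H.m_ac)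

text \<open>For fixed \<open>x\<close> in \<open>K\<close> the increment
  \<open>\<phi> (x g) / \<phi> g\<close> satisfies the hypotheses of \<open>ext_kills_inter\<close>:
  \<open>c1\<close> and \<open>c2\<close> give invariance under \<open>L \<inter> M\<close>, and
  \<open>t1\<close> gives \<open>mix\<close>. So \<open>ext \<phi>\<close> kills
  \<open>(x - 1) a\<close> for every \<open>a\<close> in both ideals; then
  \<open>i \<mapsto> ext \<phi> (i j)\<close> is invariant under \<open>K\<close> and
  \<open>ahom_kills_aug\<close> applies. The other product uses increments on the right, with
  \<open>c2\<close> and \<open>t2\<close>.\<close>

lemma kills_products:
  assumes K: "K \<lhd> G" and L: "L \<lhd> G" and M: "M \<lhd> G"
    and closed: "\<And>g. g \<in> carrier G \<Longrightarrow> \<phi> g \<in> carrier H"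
    and c1: "\<And>x a g. \<lbrakk>x \<in> K; a \<in> L; a \<in> M; g \<in> carrier G\<rbrakk> \<Longrightarrow> \<phi> (x \<otimes> a \<otimes> g) = \<phi> (a \<otimes> x \<otimes> g)"
    and c2: "\<And>x a g. \<lbrakk>x \<in> K; a \<in> L; a \<in> M; g \<in> carrier G\<rbrakk> \<Longrightarrow>
      \<phi> (a \<otimes> g) \<cdot> \<phi> (x \<otimes> g) = \<phi> (a \<otimes> x \<otimes> g) \<cdot> \<phi> g"
    and t1: "\<And>x y z g. \<lbrakk>x \<in> K; y \<in> L; z \<in> M; g \<in> carrier G\<rbrakk> \<Longrightarrow> tri \<phi> x y z g"
    and t2: "\<And>x y z g. \<lbrakk>x \<in> K; y \<in> L; z \<in> M; g \<in> carrier G\<rbrakk> \<Longrightarrow> tri \<phi> y z x g"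
    and i: "i \<in> aug G K" and j: "j \<in> aug G L" "j \<in> aug G M"
  shows "ext \<phi> (group_ring_mult G i j) = \<one>\<^bsub>H\<^esub>" "ext \<phi> (group_ring_mult G j i) = \<one>\<^bsub>H\<^esub>"
proof -
  interpret K: normal K G by (rule K)
  interpret L: normal L G by (rule L)
  interpret M: normal M G by (rule M)
  have closed_Pi: "\<phi> \<in> carrier G \<rightarrow> carrier H" using closed by blast
  note e = ahom_ext[OF closed_Pi] and ef = ext_props(2)[OF closed_Pi]
  have iZ: "i \<in> Z" "j \<in> Z" using aug_carrier[OF K i] aug_carrier[OF L j(1)] by simp_all
  have mZ: "group_ring_mult G a b \<in> Z" if "a \<in> Z" "b \<in> Z" for a b
    using group_ring_mult_closed that by simp
  have ideals: "group_ring_mult G (frag_of g) a \<in> aug G N" if "N \<lhd> G" "a \<in> aug G N" "g \<in> carrier G" for N a g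
    using ideal.I_l_closed[OF ideal_relative_augmentation_ideal[OF subgroup.subset[OF normal_imp_subgroup[OF that(1)]]] that(2), of "frag_of g"] that(3)
    by simp
  have e_mem: "ext \<phi> a \<in> carrier H" if "a \<in> Z" for a using e that unfolding ahom_def by blast
  have e_sub: "ext \<phi> (a - b) = ext \<phi> a \<cdot> inv\<^bsub>H\<^esub> ext \<phi> b" if "a \<in> Z" "b \<in> Z" for a b using e that unfolding ahom_def by blast
  have left: "ext \<phi> (group_ring_mult G (frag_of x) a) = ext \<phi> a"
    if x: "x \<in> K" and a: "a \<in> aug G L" "a \<in> aug G M" for x a
  proof -
    have xc: "x \<in> carrier G" using x by simp
    have aZ: "a \<in> Z" using aug_carrier[OF L a(1)] by simp
    define \<psi> where "\<psi> g = \<phi> (x \<otimes> g) \<cdot> inv\<^bsub>H\<^esub> \<phi> g" for g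
    have psi: "\<psi> g \<in> carrier H" if "g \<in> carrier G" for g using closed that xc by (simp add: \<psi>_def)
    have psi_Pi: "\<psi> \<in> carrier G \<rightarrow> carrier H" using psi by blast
    have "ext \<psi> a = \<one>\<^bsub>H\<^esub>"
    proof (rule ext_kills_inter[OF L M psi _ _ a])
      fix y g assume y: "y \<in> L" "y \<in> M" and g: "g \<in> carrier G"
      have yc: "y \<in> carrier G" using y by simp
      have "\<phi> (y \<otimes> x \<otimes> g) \<cdot> \<phi> g = \<phi> (x \<otimes> g) \<cdot> \<phi> (y \<otimes> g)"
        using c2[OF x y g] closed xc yc g by (simp add: H.m_comm)
      then show "\<psi> (y \<otimes> g) = \<psi> g"
        unfolding \<psi>_def using c1[OF x y g] quotient_eq[of "\<phi> (y \<otimes> x \<otimes> g)" "\<phi> g" "\<phi> (x \<otimes> g)" "\<phi> (y \<otimes> g)"] closed xc yc g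
        by (simp add: m_assoc)
    next
      fix y z g assume y: "y \<in> L" and z: "z \<in> M" and g: "g \<in> carrier G"
      have c: "y \<in> carrier G" "z \<in> carrier G" using y z by auto
      show "\<psi> (y \<otimes> z \<otimes> g) \<cdot> \<psi> g = \<psi> (y \<otimes> g) \<cdot> \<psi> (z \<otimes> g)"
        unfolding \<psi>_def using quotient_mix[OF t1[OF x y z g, unfolded tri_def]] closed xc c g by (simp add: m_assoc)
    qed
    moreover have "ext \<psi> a = ext \<phi> (group_ring_mult G (frag_of x) a - a)"
    proof (rule ahom_eqI[OF ahom_ext[OF psi_Pi] _ _ aZ, of "\<lambda>a. ext \<phi> (group_ring_mult G (frag_of x) a - a)"])
      have d: "group_ring_mult G (frag_of x) b - b \<in> Z" if "b \<in> Z" for b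
        using keys_diff_subset[of "group_ring_mult G (frag_of x) b" "carrier G" b] mZ[of "frag_of x" b] that xc by simp
      have "ext \<phi> (group_ring_mult G (frag_of x) (b - b') - (b - b')) =
        ext \<phi> (group_ring_mult G (frag_of x) b - b) \<cdot> inv\<^bsub>H\<^esub> ext \<phi> (group_ring_mult G (frag_of x) b' - b')"
        if "b \<in> Z" "b' \<in> Z" for b b'
      proof -
        have "group_ring_mult G (frag_of x) (b - b') - (b - b') =
          (group_ring_mult G (frag_of x) b - b) - (group_ring_mult G (frag_of x) b' - b')"
          by (simp add: group_ring_mult_diff_right)
        then show ?thesis using e_sub[OF d[OF that(1)] d[OF that(2)]] by (simp only:)
      qed
      from e_mem[OF d] this show "ahom (\<lambda>a. ext \<phi> (group_ring_mult G (frag_of x) a - a))"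
        by (rule ahomI)
      fix g assume g: "g \<in> carrier G"
      show "ext \<psi> (frag_of g) = ext \<phi> (group_ring_mult G (frag_of x) (frag_of g) - frag_of g)"
        using ext_props(2)[OF psi_Pi g] e_sub[of "frag_of (x \<otimes> g)" "frag_of g"] ef g xc by (simp add: \<psi>_def)
    qed
    moreover have xa: "group_ring_mult G (frag_of x) a \<in> Z" using mZ[of "frag_of x" a] aZ xc by simp
    ultimately have "ext \<phi> (group_ring_mult G (frag_of x) a) \<cdot> inv\<^bsub>H\<^esub> ext \<phi> a = \<one>\<^bsub>H\<^esub>"
      using e_sub[OF xa aZ] by simp
    then show ?thesis by (rule quotient_one[OF _ e_mem[OF xa] e_mem[OF aZ]])
  qed
  have right: "ext \<phi> (group_ring_mult G a (frag_of (x \<otimes> w))) = ext \<phi> (group_ring_mult G a (frag_of w))"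
    if x: "x \<in> K" and a: "a \<in> aug G L" "a \<in> aug G M" and w: "w \<in> carrier G" for x a w
  proof -
    have xc: "x \<in> carrier G" "x \<otimes> w \<in> carrier G" using x w by simp_all
    have aZ: "a \<in> Z" using aug_carrier[OF L a(1)] by simp
    define \<psi> where "\<psi> g = \<phi> (g \<otimes> (x \<otimes> w)) \<cdot> inv\<^bsub>H\<^esub> \<phi> (g \<otimes> w)" for g
    have psi: "\<psi> g \<in> carrier H" if "g \<in> carrier G" for g using closed that xc w by (simp add: \<psi>_def)
    have psi_Pi: "\<psi> \<in> carrier G \<rightarrow> carrier H" using psi by blast
    have "ext \<psi> a = \<one>\<^bsub>H\<^esub>"
    proof (rule ext_kills_inter[OF L M psi _ _ a])
      fix y g assume y: "y \<in> L" "y \<in> M" and g: "g \<in> carrier G"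
      have yc: "y \<in> carrier G" using y by simp
      \<comment> \<open>Right multiplication by \<open>x\<close> is left multiplication by the
        conjugate \<open>g x g^-1\<close>, again in \<open>K\<close>, so the hypotheses about left
        factors apply at \<open>h = g w\<close>.\<close>
      define x' h where "x' = g \<otimes> x \<otimes> inv g" and "h = g \<otimes> w"
      have x': "x' \<in> K" "x' \<in> carrier G" using x g xc by (simp_all add: x'_def K.inv_op_closed2)
      have h: "h \<in> carrier G" using g w by (simp add: h_def)
      have gx: "g \<otimes> (x \<otimes> w) = x' \<otimes> h" using g xc(1) w by (simp add: x'_def h_def word_simps)
      have "\<phi> (y \<otimes> x' \<otimes> h) \<cdot> \<phi> h = \<phi> (x' \<otimes> h) \<cdot> \<phi> (y \<otimes> h)"
        using c2[OF x'(1) y h] closed x' yc h by (simp add: H.m_comm)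
      then have "\<phi> (y \<otimes> x' \<otimes> h) \<cdot> inv\<^bsub>H\<^esub> \<phi> (y \<otimes> h) = \<phi> (x' \<otimes> h) \<cdot> inv\<^bsub>H\<^esub> \<phi> h"
        by (rule quotient_eq) (use closed x' yc h in simp_all)
      moreover have "y \<otimes> g \<otimes> (x \<otimes> w) = y \<otimes> x' \<otimes> h" "y \<otimes> g \<otimes> w = y \<otimes> h"
        using gx yc g xc w x' h by (simp_all add: m_assoc) (simp add: h_def)
      ultimately show "\<psi> (y \<otimes> g) = \<psi> g" unfolding \<psi>_def gx by (simp add: h_def)
    next
      fix y z g assume y: "y \<in> L" and z: "z \<in> M" and g: "g \<in> carrier G"
      have c: "y \<in> carrier G" "z \<in> carrier G" using y z by auto
      define x' h where "x' = g \<otimes> x \<otimes> inv g" and "h = g \<otimes> w"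
      have x': "x' \<in> K" "x' \<in> carrier G" using x g xc by (simp_all add: x'_def K.inv_op_closed2)
      have h: "h \<in> carrier G" using g w by (simp add: h_def)
      have gx: "g \<otimes> (x \<otimes> w) = x' \<otimes> h" using g xc(1) w by (simp add: x'_def h_def word_simps)
      have *: "y \<otimes> z \<otimes> g \<otimes> (x \<otimes> w) = y \<otimes> z \<otimes> x' \<otimes> h" "y \<otimes> z \<otimes> g \<otimes> w = y \<otimes> z \<otimes> h"
        "y \<otimes> g \<otimes> (x \<otimes> w) = y \<otimes> x' \<otimes> h" "y \<otimes> g \<otimes> w = y \<otimes> h" "z \<otimes> g \<otimes> (x \<otimes> w) = z \<otimes> x' \<otimes> h" "z \<otimes> g \<otimes> w = z \<otimes> h"
        using gx c g xc w x' h by (simp_all add: m_assoc) (simp_all add: h_def)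
      have "\<phi> (y \<otimes> z \<otimes> x' \<otimes> h) \<cdot> \<phi> (x' \<otimes> h) \<cdot> (\<phi> (y \<otimes> h) \<cdot> \<phi> (z \<otimes> h)) =
        \<phi> (y \<otimes> x' \<otimes> h) \<cdot> \<phi> (z \<otimes> x' \<otimes> h) \<cdot> (\<phi> (y \<otimes> z \<otimes> h) \<cdot> \<phi> h)"
        using t2[OF x'(1) y z h] closed c x' h by (simp add: tri_def H.m_ac)
      from quotient_mix[OF this]
      show "\<psi> (y \<otimes> z \<otimes> g) \<cdot> \<psi> g = \<psi> (y \<otimes> g) \<cdot> \<psi> (z \<otimes> g)"
        unfolding \<psi>_def gx * h_def[symmetric] using closed c x' h by simp
    qed
    moreover have "ext \<psi> a = ext \<phi> (group_ring_mult G a (frag_of (x \<otimes> w)) - group_ring_mult G a (frag_of w))"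
    proof (rule ahom_eqI[OF ahom_ext[OF psi_Pi] _ _ aZ, of "\<lambda>a. ext \<phi> (group_ring_mult G a (frag_of (x \<otimes> w)) - group_ring_mult G a (frag_of w))"])
      have d: "group_ring_mult G b (frag_of (x \<otimes> w)) - group_ring_mult G b (frag_of w) \<in> Z" if "b \<in> Z" for b
        using keys_diff_subset[of "group_ring_mult G b (frag_of (x \<otimes> w))" "carrier G" "group_ring_mult G b (frag_of w)"]
          mZ[of b "frag_of (x \<otimes> w)"] mZ[of b "frag_of w"] that xc w by simp
      have "ext \<phi> (group_ring_mult G (b - b') (frag_of (x \<otimes> w)) - group_ring_mult G (b - b') (frag_of w)) =
        ext \<phi> (group_ring_mult G b (frag_of (x \<otimes> w)) - group_ring_mult G b (frag_of w)) \<cdot>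
        inv\<^bsub>H\<^esub> ext \<phi> (group_ring_mult G b' (frag_of (x \<otimes> w)) - group_ring_mult G b' (frag_of w))"
        if "b \<in> Z" "b' \<in> Z" for b b'
      proof -
        have "group_ring_mult G (b - b') (frag_of (x \<otimes> w)) - group_ring_mult G (b - b') (frag_of w) =
          (group_ring_mult G b (frag_of (x \<otimes> w)) - group_ring_mult G b (frag_of w)) -
          (group_ring_mult G b' (frag_of (x \<otimes> w)) - group_ring_mult G b' (frag_of w))"
          by (simp add: group_ring_mult_diff_left)
        then show ?thesis using e_sub[OF d[OF that(1)] d[OF that(2)]] by (simp only:)
      qed
      from e_mem[OF d] this show "ahom (\<lambda>a. ext \<phi> (group_ring_mult G a (frag_of (x \<otimes> w)) - group_ring_mult G a (frag_of w)))"
        by (rule ahomI)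
      fix g assume g: "g \<in> carrier G"
      show "ext \<psi> (frag_of g) = ext \<phi> (group_ring_mult G (frag_of g) (frag_of (x \<otimes> w)) - group_ring_mult G (frag_of g) (frag_of w))"
        using ext_props(2)[OF psi_Pi g] e_sub[of "frag_of (g \<otimes> (x \<otimes> w))" "frag_of (g \<otimes> w)"] ef g xc w by (simp add: \<psi>_def)
    qed
    moreover have xa: "group_ring_mult G a (frag_of (x \<otimes> w)) \<in> Z" "group_ring_mult G a (frag_of w) \<in> Z"
      using mZ[of a "frag_of (x \<otimes> w)"] mZ[of a "frag_of w"] aZ xc w by simp_all
    ultimately have "ext \<phi> (group_ring_mult G a (frag_of (x \<otimes> w))) \<cdot> inv\<^bsub>H\<^esub> ext \<phi> (group_ring_mult G a (frag_of w)) = \<one>\<^bsub>H\<^esub>"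
      using e_sub[OF xa] by simp
    then show ?thesis by (rule quotient_one[OF _ e_mem[OF xa(1)] e_mem[OF xa(2)]])
  qed
  have h1: "ahom (\<lambda>a. ext \<phi> (group_ring_mult G a j))" "ahom (\<lambda>a. ext \<phi> (group_ring_mult G j a))"
    unfolding ahom_def using mZ iZ e_mem e_sub by (simp_all add: group_ring_mult_diff_left group_ring_mult_diff_right)
  show "ext \<phi> (group_ring_mult G i j) = \<one>\<^bsub>H\<^esub>"
  proof (rule ahom_kills_aug[OF K h1(1) _ i])
    fix n g assume n: "n \<in> K" and g: "g \<in> carrier G"
    have "group_ring_mult G (frag_of (n \<otimes> g)) j = group_ring_mult G (frag_of n) (group_ring_mult G (frag_of g) j)"
      using group_ring_mult_assoc[of "frag_of n" "frag_of g" j] n g iZ by simp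
    then show "ext \<phi> (group_ring_mult G (frag_of (n \<otimes> g)) j) = ext \<phi> (group_ring_mult G (frag_of g) j)"
      using left[OF n ideals[OF L j(1) g] ideals[OF M j(2) g]] by simp
  qed
  show "ext \<phi> (group_ring_mult G j i) = \<one>\<^bsub>H\<^esub>"
    by (rule ahom_kills_aug[OF K h1(2) _ i]) (rule right[OF _ j])
qed

lemma swap_cancel:
  assumes "P \<cdot> w = Q \<cdot> k" "M \<cdot> Q = P \<cdot> L"
    "P \<in> carrier H" "w \<in> carrier H" "Q \<in> carrier H" "k \<in> carrier H" "M \<in> carrier H" "L \<in> carrier H"
  shows "M \<cdot> w = L \<cdot> k"
proof -
  have "(M \<cdot> w) \<cdot> Q = (M \<cdot> Q) \<cdot> w" using assms(3-8) by (simp add: H.m_ac)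
  also have "\<dots> = L \<cdot> (P \<cdot> w)" unfolding assms(2) using assms(3-8) by (simp add: H.m_ac)
  also have "\<dots> = (L \<cdot> k) \<cdot> Q" unfolding assms(1) using assms(3-8) by (simp add: H.m_ac)
  finally show ?thesis using assms(3-8) by simp
qed

text \<open>Exchanging the first two factors changes the third difference by
  \<open>(x y - y x)(z - 1) g\<close>; the second assumption says that this is killed.\<close>

lemma tri_swap_outer:
  assumes "tri \<phi> y x z g" "\<phi> (x \<otimes> y \<otimes> z \<otimes> g) \<cdot> \<phi> (y \<otimes> x \<otimes> g) = \<phi> (y \<otimes> x \<otimes> z \<otimes> g) \<cdot> \<phi> (x \<otimes> y \<otimes> g)"
    and closed: "\<And>g. g \<in> carrier G \<Longrightarrow> \<phi> g \<in> carrier H"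
    and c: "x \<in> carrier G" "y \<in> carrier G" "z \<in> carrier G" "g \<in> carrier G"
  shows "tri \<phi> x y z g"
proof -
  have cl: "\<phi> (x \<otimes> y \<otimes> z \<otimes> g) \<in> carrier H" "\<phi> (y \<otimes> x \<otimes> z \<otimes> g) \<in> carrier H" "\<phi> (x \<otimes> y \<otimes> g) \<in> carrier H"
    "\<phi> (y \<otimes> x \<otimes> g) \<in> carrier H" "\<phi> (x \<otimes> g) \<in> carrier H" "\<phi> (y \<otimes> g) \<in> carrier H" "\<phi> (z \<otimes> g) \<in> carrier H"
    "\<phi> (x \<otimes> z \<otimes> g) \<in> carrier H" "\<phi> (y \<otimes> z \<otimes> g) \<in> carrier H" "\<phi> g \<in> carrier H"
    using closed c by simp_all
  have "\<phi> (y \<otimes> x \<otimes> z \<otimes> g) \<cdot> (\<phi> (x \<otimes> g) \<cdot> (\<phi> (y \<otimes> g) \<cdot> \<phi> (z \<otimes> g))) =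
    \<phi> (y \<otimes> x \<otimes> g) \<cdot> (\<phi> (x \<otimes> z \<otimes> g) \<cdot> (\<phi> (y \<otimes> z \<otimes> g) \<cdot> \<phi> g))"
    using assms(1) cl by (simp add: tri_def H.m_ac)
  from swap_cancel[OF this assms(2)] show ?thesis
    using cl by (simp add: tri_def H.m_assoc)
qed

text \<open>Here the correction is \<open>(x - 1)(y z - z y) g\<close>.\<close>

lemma tri_swap_inner:
  assumes "tri \<phi> x z y g" "\<phi> (x \<otimes> y \<otimes> z \<otimes> g) \<cdot> \<phi> (z \<otimes> y \<otimes> g) = \<phi> (x \<otimes> z \<otimes> y \<otimes> g) \<cdot> \<phi> (y \<otimes> z \<otimes> g)"
    and closed: "\<And>g. g \<in> carrier G \<Longrightarrow> \<phi> g \<in> carrier H"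
    and c: "x \<in> carrier G" "y \<in> carrier G" "z \<in> carrier G" "g \<in> carrier G"
  shows "tri \<phi> x y z g"
proof -
  have cl: "\<phi> (x \<otimes> y \<otimes> z \<otimes> g) \<in> carrier H" "\<phi> (x \<otimes> z \<otimes> y \<otimes> g) \<in> carrier H" "\<phi> (x \<otimes> y \<otimes> g) \<in> carrier H"
    "\<phi> (z \<otimes> y \<otimes> g) \<in> carrier H" "\<phi> (x \<otimes> g) \<in> carrier H" "\<phi> (y \<otimes> g) \<in> carrier H" "\<phi> (z \<otimes> g) \<in> carrier H"
    "\<phi> (x \<otimes> z \<otimes> g) \<in> carrier H" "\<phi> (y \<otimes> z \<otimes> g) \<in> carrier H" "\<phi> g \<in> carrier H"
    using closed c by simp_all
  have "\<phi> (x \<otimes> z \<otimes> y \<otimes> g) \<cdot> (\<phi> (x \<otimes> g) \<cdot> (\<phi> (y \<otimes> g) \<cdot> \<phi> (z \<otimes> g))) =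
    \<phi> (z \<otimes> y \<otimes> g) \<cdot> (\<phi> (x \<otimes> y \<otimes> g) \<cdot> (\<phi> (x \<otimes> z \<otimes> g) \<cdot> \<phi> g))"
    using assms(1) cl by (simp add: tri_def H.m_ac)
  from swap_cancel[OF this assms(2)] show ?thesis
    using cl by (simp add: tri_def H.m_ac)
qed

definition ext_kernel where "ext_kernel \<phi> = {x \<in> Z. ext \<phi> x = \<one>\<^bsub>H\<^esub>}"

lemma ideal_prod_killed:
  assumes \<phi>: "\<phi> \<in> carrier G \<rightarrow> carrier H" and I: "I \<subseteq> Z" and J: "J \<subseteq> Z"
    and kill: "\<And>i j. \<lbrakk>i \<in> I; j \<in> J\<rbrakk> \<Longrightarrow> ext \<phi> (group_ring_mult G i j) = \<one>\<^bsub>H\<^esub>"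
  shows "ideal_prod (group_ring G) I J \<subseteq> ext_kernel \<phi>"
proof
  fix x assume "x \<in> ideal_prod (group_ring G) I J"
  then show "x \<in> ext_kernel \<phi>"
  proof (induction x rule: ideal_prod.induct)
    case (prod i j)
    then have "i \<in> Z" "j \<in> Z" using I J by blast+
    then have "group_ring_mult G i j \<in> Z" using group_ring_mult_closed by simp
    then show ?case using kill[OF prod] by (simp add: ext_kernel_def)
  next
    case (sum a b)
    then have ab: "a \<in> Z" "b \<in> Z" by (simp_all add: ext_kernel_def)
    then have "a + b \<in> Z" using keys_add[of a b] by auto
    then show ?case using sum ahom_add[OF ahom_ext[OF \<phi>] ab] by (simp add: ext_kernel_def)
  qed
qed

lemma set_add_killed:
  assumes \<phi>: "\<phi> \<in> carrier G \<rightarrow> carrier H" and I: "I \<subseteq> ext_kernel \<phi>" and J: "J \<subseteq> ext_kernel \<phi>"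
  shows "I <+>\<^bsub>group_ring G\<^esub> J \<subseteq> ext_kernel \<phi>"
proof
  fix x assume x: "x \<in> I <+>\<^bsub>group_ring G\<^esub> J"
  obtain a b where "a \<in> I" "b \<in> J" and x: "x = a + b"
    using x by (auto simp: set_add_def')
  then have k: "a \<in> ext_kernel \<phi>" "b \<in> ext_kernel \<phi>" using I J by blast+
  then have ab: "a \<in> Z" "b \<in> Z" by (simp_all add: ext_kernel_def)
  then have "a + b \<in> Z" using keys_add[of a b] by auto
  then show "x \<in> ext_kernel \<phi>" using k x ahom_add[OF ahom_ext[OF \<phi>] ab] by (simp add: ext_kernel_def)
qed

text \<open>\<open>kills_products\<close> requires third differences in the cyclic orders
  \<open>RST\<close>, \<open>STR\<close> and \<open>TRS\<close>. With \<open>T\<close> in front they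
  vanish by the decomposition \<open>dT\<close>. The remaining orders follow by exchanging
  neighbours, whose commutators fall into \<open>A\<close> or \<open>B\<close>, where the
  second-difference conditions take over.\<close>

lemma kills_ideal_triple:
  assumes R: "R \<lhd> G" and S: "S \<lhd> G" and T: "T \<lhd> G"
    and closed: "\<And>g. g \<in> carrier G \<Longrightarrow> \<phi> g \<in> carrier H"
    and cR: "\<And>x a g. \<lbrakk>x \<in> R; a \<in> S; a \<in> T; g \<in> carrier G\<rbrakk> \<Longrightarrow> \<phi> (x \<otimes> a \<otimes> g) = \<phi> (a \<otimes> x \<otimes> g)"
    and cS: "\<And>x a g. \<lbrakk>x \<in> S; a \<in> R; a \<in> T; g \<in> carrier G\<rbrakk> \<Longrightarrow> \<phi> (x \<otimes> a \<otimes> g) = \<phi> (a \<otimes> x \<otimes> g)"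
    and cT: "\<And>x a g. \<lbrakk>x \<in> T; a \<in> R; a \<in> S; g \<in> carrier G\<rbrakk> \<Longrightarrow> \<phi> (x \<otimes> a \<otimes> g) = \<phi> (a \<otimes> x \<otimes> g)"
    and pR: "\<And>x a g. \<lbrakk>x \<in> R; a \<in> S; a \<in> T; g \<in> carrier G\<rbrakk> \<Longrightarrow>
      \<phi> (a \<otimes> g) \<cdot> \<phi> (x \<otimes> g) = \<phi> (a \<otimes> x \<otimes> g) \<cdot> \<phi> g"
    and pS: "\<And>x a g. \<lbrakk>x \<in> S; a \<in> R; a \<in> T; g \<in> carrier G\<rbrakk> \<Longrightarrow>
      \<phi> (a \<otimes> g) \<cdot> \<phi> (x \<otimes> g) = \<phi> (a \<otimes> x \<otimes> g) \<cdot> \<phi> g"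
    and pT: "\<And>x a g. \<lbrakk>x \<in> T; a \<in> R; a \<in> S; g \<in> carrier G\<rbrakk> \<Longrightarrow>
      \<phi> (a \<otimes> g) \<cdot> \<phi> (x \<otimes> g) = \<phi> (a \<otimes> x \<otimes> g) \<cdot> \<phi> g"
    and dT: "\<And>\<tau> g. \<lbrakk>\<tau> \<in> T; g \<in> carrier G\<rbrakk> \<Longrightarrow> \<phi> (\<tau> \<otimes> g) = U \<tau> g \<cdot> V \<tau> g \<cdot> \<phi> g"
    and Uc: "\<And>\<tau> g. \<lbrakk>\<tau> \<in> T; g \<in> carrier G\<rbrakk> \<Longrightarrow> U \<tau> g \<in> carrier H"
    and Vc: "\<And>\<tau> g. \<lbrakk>\<tau> \<in> T; g \<in> carrier G\<rbrakk> \<Longrightarrow> V \<tau> g \<in> carrier H"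
    and UR: "\<And>\<tau> \<rho> g. \<lbrakk>\<tau> \<in> T; \<rho> \<in> R; g \<in> carrier G\<rbrakk> \<Longrightarrow> U \<tau> (\<rho> \<otimes> g) = U \<tau> g"
    and VS: "\<And>\<tau> \<sigma> g. \<lbrakk>\<tau> \<in> T; \<sigma> \<in> S; g \<in> carrier G\<rbrakk> \<Longrightarrow> V \<tau> (\<sigma> \<otimes> g) = V \<tau> g"
    and x: "x \<in> ideal_triple (group_ring G) (aug G R) (aug G S) (aug G T)"
  shows "ext \<phi> x = \<one>\<^bsub>H\<^esub>"
proof -
  interpret R: normal R G by (rule R)
  interpret S: normal S G by (rule S)
  interpret T: normal T G by (rule T)
  have TRS: "tri \<phi> \<tau> \<rho> \<sigma> g" and TSR: "tri \<phi> \<tau> \<sigma> \<rho> g" if t: "\<tau> \<in> T" "\<rho> \<in> R" "\<sigma> \<in> S" "g \<in> carrier G" for \<tau> \<rho> \<sigma> g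
  proof -
    have c: "\<tau> \<in> carrier G" "\<rho> \<in> carrier G" "\<sigma> \<in> carrier G" using t by auto
    \<comment> \<open>\<open>V\<close> ignores \<open>\<sigma>\<close> only as the outermost factor,
      and \<open>U\<close> likewise \<open>\<rho>\<close>. Conjugation brings each of them to the
      front, which is where normality of \<open>S\<close> and \<open>R\<close> enters.\<close>
    have rs: "\<rho> \<otimes> \<sigma> \<otimes> g = (\<rho> \<otimes> \<sigma> \<otimes> inv \<rho>) \<otimes> (\<rho> \<otimes> g)" "\<sigma> \<otimes> \<rho> \<otimes> g = (\<sigma> \<otimes> \<rho> \<otimes> inv \<sigma>) \<otimes> (\<sigma> \<otimes> g)"
      using c t by (simp_all add: word_simps)
    have s': "\<rho> \<otimes> \<sigma> \<otimes> inv \<rho> \<in> S" "\<sigma> \<otimes> \<rho> \<otimes> inv \<sigma> \<in> R"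
      using c t by (simp_all add: S.inv_op_closed2 R.inv_op_closed2)
    have u: "U \<tau> (\<rho> \<otimes> \<sigma> \<otimes> g) = U \<tau> (\<sigma> \<otimes> g)" "V \<tau> (\<rho> \<otimes> \<sigma> \<otimes> g) = V \<tau> (\<rho> \<otimes> g)"
      "U \<tau> (\<sigma> \<otimes> \<rho> \<otimes> g) = U \<tau> (\<sigma> \<otimes> g)" "V \<tau> (\<sigma> \<otimes> \<rho> \<otimes> g) = V \<tau> (\<rho> \<otimes> g)"
      "U \<tau> (\<rho> \<otimes> g) = U \<tau> g" "V \<tau> (\<sigma> \<otimes> g) = V \<tau> g"
      using UR[OF t(1,2), of "\<sigma> \<otimes> g"] VS[OF t(1) s'(1), of "\<rho> \<otimes> g"] UR[OF t(1) s'(2), of "\<sigma> \<otimes> g"]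
        VS[OF t(1,3), of "\<rho> \<otimes> g"] UR[OF t(1,2,4)] VS[OF t(1,3,4)] c t(4) rs by (simp_all add: m_assoc)
    have d: "\<phi> (\<tau> \<otimes> \<rho> \<otimes> \<sigma> \<otimes> g) = U \<tau> (\<sigma> \<otimes> g) \<cdot> V \<tau> (\<rho> \<otimes> g) \<cdot> \<phi> (\<rho> \<otimes> \<sigma> \<otimes> g)"
      "\<phi> (\<tau> \<otimes> \<sigma> \<otimes> \<rho> \<otimes> g) = U \<tau> (\<sigma> \<otimes> g) \<cdot> V \<tau> (\<rho> \<otimes> g) \<cdot> \<phi> (\<sigma> \<otimes> \<rho> \<otimes> g)"
      "\<phi> (\<tau> \<otimes> \<rho> \<otimes> g) = U \<tau> g \<cdot> V \<tau> (\<rho> \<otimes> g) \<cdot> \<phi> (\<rho> \<otimes> g)"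
      "\<phi> (\<tau> \<otimes> \<sigma> \<otimes> g) = U \<tau> (\<sigma> \<otimes> g) \<cdot> V \<tau> g \<cdot> \<phi> (\<sigma> \<otimes> g)"
      "\<phi> (\<tau> \<otimes> g) = U \<tau> g \<cdot> V \<tau> g \<cdot> \<phi> g"
      using dT[OF t(1), of "\<rho> \<otimes> \<sigma> \<otimes> g"] dT[OF t(1), of "\<sigma> \<otimes> \<rho> \<otimes> g"] dT[OF t(1), of "\<rho> \<otimes> g"]
        dT[OF t(1), of "\<sigma> \<otimes> g"] dT[OF t(1), of g] u c t(4) by (simp_all add: m_assoc)
    have cl: "U \<tau> (\<sigma> \<otimes> g) \<in> carrier H" "U \<tau> g \<in> carrier H" "V \<tau> (\<rho> \<otimes> g) \<in> carrier H" "V \<tau> g \<in> carrier H"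
      "\<phi> (\<rho> \<otimes> \<sigma> \<otimes> g) \<in> carrier H" "\<phi> (\<sigma> \<otimes> \<rho> \<otimes> g) \<in> carrier H" "\<phi> (\<rho> \<otimes> g) \<in> carrier H" "\<phi> (\<sigma> \<otimes> g) \<in> carrier H" "\<phi> g \<in> carrier H"
      using closed Uc Vc c t by simp_all
    show "tri \<phi> \<tau> \<rho> \<sigma> g" unfolding tri_def d using cl by (simp add: H.m_ac)
    show "tri \<phi> \<tau> \<sigma> \<rho> g" unfolding tri_def d using cl by (simp add: H.m_ac)
  qed
  have swap: "tri \<phi> x y z g"
    if tri: "tri \<phi> y x z g" and K: "K \<lhd> G" "x \<in> K" and M: "M \<lhd> G" "z \<in> M" and y: "y \<in> T" and g: "g \<in> carrier G"
      and p: "\<And>x a g. \<lbrakk>x \<in> M; a \<in> K; a \<in> T; g \<in> carrier G\<rbrakk> \<Longrightarrow>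
        \<phi> (a \<otimes> g) \<cdot> \<phi> (x \<otimes> g) = \<phi> (a \<otimes> x \<otimes> g) \<cdot> \<phi> g" for x y z g K M
  proof (rule tri_swap_outer[OF tri _ closed])
    interpret K: normal K G by (rule K)
    interpret M: normal M G by (rule M)
    show c: "x \<in> carrier G" "y \<in> carrier G" "z \<in> carrier G" "g \<in> carrier G" using K M y g by auto
    \<comment> \<open>With these, \<open>(x y - y x)(z - 1) g = (b - 1)(s - 1) w\<close>, a second
      difference covered by \<open>p\<close>.\<close>
    define b s w where "b = x \<otimes> y \<otimes> inv x \<otimes> inv y" and "s = (y \<otimes> x) \<otimes> z \<otimes> inv (y \<otimes> x)" and "w = y \<otimes> x \<otimes> g"
    have b: "b \<in> K" "b \<in> T" "b \<in> carrier G"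
      using commutator_in_normal[OF K(1) c(1,2)] commutator_in_normal[OF T c(1,2)] K y by (auto simp: b_def)
    have s: "s \<in> M" "s \<in> carrier G" using c M by (auto simp: s_def intro!: M.inv_op_closed2)
    have w: "w \<in> carrier G" using c by (simp add: w_def)
    have e: "x \<otimes> y \<otimes> z \<otimes> g = b \<otimes> s \<otimes> w" "y \<otimes> x \<otimes> g = w" "y \<otimes> x \<otimes> z \<otimes> g = s \<otimes> w" "x \<otimes> y \<otimes> g = b \<otimes> w"
      using c by (simp_all add: b_def s_def w_def word_simps)
    have "\<phi> (b \<otimes> w) \<cdot> \<phi> (s \<otimes> w) = \<phi> (b \<otimes> s \<otimes> w) \<cdot> \<phi> w" by (rule p[OF s(1) b(1,2) w])
    then show "\<phi> (x \<otimes> y \<otimes> z \<otimes> g) \<cdot> \<phi> (y \<otimes> x \<otimes> g) = \<phi> (y \<otimes> x \<otimes> z \<otimes> g) \<cdot> \<phi> (x \<otimes> y \<otimes> g)"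
      unfolding e using closed b s w by (simp add: H.m_comm)
  qed
  have RTS: "tri \<phi> \<rho> \<tau> \<sigma> g" and STR: "tri \<phi> \<sigma> \<tau> \<rho> g"
    if t: "\<tau> \<in> T" "\<rho> \<in> R" "\<sigma> \<in> S" "g \<in> carrier G" for \<tau> \<rho> \<sigma> g
    by (rule swap[OF TRS[OF t] R t(2) S t(3) t(1,4) pS] swap[OF TSR[OF t] S t(3) R t(2) t(1,4) pR]; assumption)+
  have RST: "tri \<phi> \<rho> \<sigma> \<tau> g" if t: "\<tau> \<in> T" "\<rho> \<in> R" "\<sigma> \<in> S" "g \<in> carrier G" for \<tau> \<rho> \<sigma> g
  proof (rule tri_swap_inner[OF RTS[OF t] _ closed])
    show c: "\<rho> \<in> carrier G" "\<sigma> \<in> carrier G" "\<tau> \<in> carrier G" "g \<in> carrier G" using t by auto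
    define a w where "a = \<sigma> \<otimes> \<tau> \<otimes> inv \<sigma> \<otimes> inv \<tau>" and "w = \<tau> \<otimes> \<sigma> \<otimes> g"
    have a: "a \<in> S" "a \<in> T" "a \<in> carrier G" using commutator_in_normal[OF S c(2,3)] commutator_in_normal[OF T c(2,3)] t by (auto simp: a_def)
    have w: "w \<in> carrier G" using c by (simp add: w_def)
    have e: "\<rho> \<otimes> \<sigma> \<otimes> \<tau> \<otimes> g = \<rho> \<otimes> a \<otimes> w" "\<tau> \<otimes> \<sigma> \<otimes> g = w" "\<rho> \<otimes> \<tau> \<otimes> \<sigma> \<otimes> g = \<rho> \<otimes> w" "\<sigma> \<otimes> \<tau> \<otimes> g = a \<otimes> w"
      using c by (simp_all add: a_def w_def word_simps)
    have "\<phi> (a \<otimes> w) \<cdot> \<phi> (\<rho> \<otimes> w) = \<phi> (\<rho> \<otimes> a \<otimes> w) \<cdot> \<phi> w"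
      unfolding cR[OF t(2) a(1,2) w] by (rule pR[OF t(2) a(1,2) w])
    then show "\<phi> (\<rho> \<otimes> \<sigma> \<otimes> \<tau> \<otimes> g) \<cdot> \<phi> (\<tau> \<otimes> \<sigma> \<otimes> g) = \<phi> (\<rho> \<otimes> \<tau> \<otimes> \<sigma> \<otimes> g) \<cdot> \<phi> (\<sigma> \<otimes> \<tau> \<otimes> g)"
      unfolding e using closed a w c by (simp add: H.m_comm)
  qed
  have Pi: "\<phi> \<in> carrier G \<rightarrow> carrier H" using closed by blast
  have sub: "aug G N \<subseteq> Z" if "N \<lhd> G" for N using aug_carrier[OF that] by auto
  have kR: "ext \<phi> (group_ring_mult G i j) = \<one>\<^bsub>H\<^esub> \<and> ext \<phi> (group_ring_mult G j i) = \<one>\<^bsub>H\<^esub>"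
    if "i \<in> aug G R" "j \<in> aug G S" "j \<in> aug G T" for i j
    by (intro conjI; rule kills_products[where K = R and L = S and M = T and i = i and j = j])
      (use that in \<open>blast intro: R S T closed cR pR RST STR\<close>)+
  have kS: "ext \<phi> (group_ring_mult G i j) = \<one>\<^bsub>H\<^esub> \<and> ext \<phi> (group_ring_mult G j i) = \<one>\<^bsub>H\<^esub>"
    if "i \<in> aug G S" "j \<in> aug G T" "j \<in> aug G R" for i j
    by (intro conjI; rule kills_products[where K = S and L = T and M = R and i = i and j = j])
      (use that in \<open>blast intro: R S T closed cS pS STR TRS\<close>)+
  have kT: "ext \<phi> (group_ring_mult G i j) = \<one>\<^bsub>H\<^esub> \<and> ext \<phi> (group_ring_mult G j i) = \<one>\<^bsub>H\<^esub>"
    if "i \<in> aug G T" "j \<in> aug G R" "j \<in> aug G S" for i j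
    by (intro conjI; rule kills_products[where K = T and L = R and M = S and i = i and j = j])
      (use that in \<open>blast intro: R S T closed cT pT TRS RST\<close>)+
  have Z: "aug G R \<subseteq> Z" "aug G S \<subseteq> Z" "aug G T \<subseteq> Z" "aug G S \<inter> aug G T \<subseteq> Z" "aug G R \<inter> aug G T \<subseteq> Z" "aug G R \<inter> aug G S \<subseteq> Z"
    using sub[OF R] sub[OF S] sub[OF T] by auto
  note P = ideal_prod_killed[OF Pi]
  have "ideal_triple (group_ring G) (aug G R) (aug G S) (aug G T) \<subseteq> ext_kernel \<phi>"
    unfolding ideal_triple_def
    by (intro set_add_killed[OF Pi] P Z) (use kR kS kT in \<open>simp_all add: Int_iff\<close>)
  then show ?thesis using x by (auto simp: ext_kernel_def)
qed

end

section \<open>The dimension subgroup\<close>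

context group begin

lemma commutator_subgroup_normal:
  assumes "K \<lhd> G" "L \<lhd> G"
  shows "commutator_subgroup G K L \<lhd> G"
  unfolding commutator_subgroup_def
proof (rule normal_generateI)
  interpret K: normal K G by (rule assms)
  interpret L: normal L G by (rule assms)
  show "{a \<otimes> b \<otimes> inv a \<otimes> inv b |a b. a \<in> K \<and> b \<in> L} \<subseteq> carrier G" by auto
  fix h g assume "h \<in> {a \<otimes> b \<otimes> inv a \<otimes> inv b |a b. a \<in> K \<and> b \<in> L}" and g: "g \<in> carrier G"
  then obtain a b where ab: "a \<in> K" "b \<in> L" and h: "h = a \<otimes> b \<otimes> inv a \<otimes> inv b" by blast
  have c: "a \<in> carrier G" "b \<in> carrier G" using ab by auto
  have "g \<otimes> h \<otimes> inv g = (g \<otimes> a \<otimes> inv g) \<otimes> (g \<otimes> b \<otimes> inv g) \<otimes> inv (g \<otimes> a \<otimes> inv g) \<otimes> inv (g \<otimes> b \<otimes> inv g)"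
    unfolding h using c g by (simp add: word_simps)
  moreover have "g \<otimes> a \<otimes> inv g \<in> K" "g \<otimes> b \<otimes> inv g \<in> L"
    using ab g by (simp_all add: K.inv_op_closed2 L.inv_op_closed2)
  ultimately show "g \<otimes> h \<otimes> inv g \<in> {a \<otimes> b \<otimes> inv a \<otimes> inv b |a b. a \<in> K \<and> b \<in> L}" by blast
qed

lemma commutator_subgroup_incl:
  "\<lbrakk>a \<in> K; b \<in> L\<rbrakk> \<Longrightarrow> a \<otimes> b \<otimes> inv a \<otimes> inv b \<in> commutator_subgroup G K L"
  unfolding commutator_subgroup_def by (rule generate.incl) blast

lemma commutator_subgroup_minimal:
  assumes "subgroup P G" "\<And>a b. \<lbrakk>a \<in> K; b \<in> L\<rbrakk> \<Longrightarrow> a \<otimes> b \<otimes> inv a \<otimes> inv b \<in> P"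
  shows "commutator_subgroup G K L \<subseteq> P"
  unfolding commutator_subgroup_def
proof (rule generate_subgroup_incl[OF _ assms(1)])
  show "{a \<otimes> b \<otimes> inv a \<otimes> inv b |a b. a \<in> K \<and> b \<in> L} \<subseteq> P"
    by clarify (rule assms(2))
qed

lemma set_mult_minimal: "\<lbrakk>subgroup P G; K \<subseteq> P; L \<subseteq> P\<rbrakk> \<Longrightarrow> K <#> L \<subseteq> P"
  unfolding set_mult_def by (clarsimp, rule subgroup.m_closed) auto

lemma set_mult_incl:
  assumes "subgroup K G" "subgroup L G"
  shows "K \<subseteq> K <#> L" "L \<subseteq> K <#> L"
proof -
  interpret K: subgroup K G by (rule assms)
  interpret L: subgroup L G by (rule assms)
  show "K \<subseteq> K <#> L"
  proof
    fix k assume "k \<in> K"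
    then have "k = k \<otimes> \<one>" by simp
    then show "k \<in> K <#> L" using \<open>k \<in> K\<close> L.one_closed unfolding set_mult_def by blast
  qed
  show "L \<subseteq> K <#> L"
  proof
    fix k assume "k \<in> L"
    then have "k = \<one> \<otimes> k" by simp
    then show "k \<in> K <#> L" using \<open>k \<in> L\<close> K.one_closed unfolding set_mult_def by blast
  qed
qed

context
  fixes R S T
  assumes R: "R \<lhd> G" and S: "S \<lhd> G" and T: "T \<lhd> G"
begin

lemma triple_factors_normal:
  "commutator_subgroup G R (S \<inter> T) \<lhd> G" "commutator_subgroup G S (R \<inter> T) \<lhd> G"
  "commutator_subgroup G T (R \<inter> S) \<lhd> G"
  by (intro commutator_subgroup_normal normal_subgroup_intersect R S T)+

lemma commutator_triple_normal: "commutator_triple G R S T \<lhd> G"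
  unfolding commutator_triple_def
  by (intro normal_subgroup_set_mult_closed triple_factors_normal)

lemma commutator_triple_incl:
  "commutator_subgroup G R (S \<inter> T) \<subseteq> commutator_triple G R S T"
  "commutator_subgroup G S (R \<inter> T) \<subseteq> commutator_triple G R S T"
  "commutator_subgroup G T (R \<inter> S) \<subseteq> commutator_triple G R S T"
proof -
  note n = triple_factors_normal[THEN normal_imp_subgroup]
  note m = normal_imp_subgroup[OF normal_subgroup_set_mult_closed[OF triple_factors_normal(1,2)]]
  show "commutator_subgroup G R (S \<inter> T) \<subseteq> commutator_triple G R S T"
    "commutator_subgroup G S (R \<inter> T) \<subseteq> commutator_triple G R S T"
    "commutator_subgroup G T (R \<inter> S) \<subseteq> commutator_triple G R S T"
    unfolding commutator_triple_def
    using set_mult_incl[OF n(1,2)] set_mult_incl[OF m n(3)] by blast+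
qed

lemma commutator_triple_minimal:
  assumes P: "subgroup P G"
    and 1: "\<And>a b. \<lbrakk>a \<in> R; b \<in> S; b \<in> T\<rbrakk> \<Longrightarrow> a \<otimes> b \<otimes> inv a \<otimes> inv b \<in> P"
    and 2: "\<And>a b. \<lbrakk>a \<in> S; b \<in> R; b \<in> T\<rbrakk> \<Longrightarrow> a \<otimes> b \<otimes> inv a \<otimes> inv b \<in> P"
    and 3: "\<And>a b. \<lbrakk>a \<in> T; b \<in> R; b \<in> S\<rbrakk> \<Longrightarrow> a \<otimes> b \<otimes> inv a \<otimes> inv b \<in> P"
  shows "commutator_triple G R S T \<subseteq> P"
  unfolding commutator_triple_def
  by (intro set_mult_minimal[OF P] commutator_subgroup_minimal[OF P]) (use 1 2 3 in auto)

lemma commutator_triple_subset: "commutator_triple G R S T \<subseteq> R \<inter> S \<inter> T"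
proof (rule commutator_triple_minimal)
  have n: "R \<inter> S \<inter> T \<lhd> G" by (intro normal_subgroup_intersect R S T)
  show "subgroup (R \<inter> S \<inter> T) G" by (rule normal_imp_subgroup[OF n])
  have c: "a \<in> carrier G" if "a \<in> R \<or> a \<in> S \<or> a \<in> T" for a
    using that subgroup.mem_carrier[OF normal_imp_subgroup[OF R]] subgroup.mem_carrier[OF normal_imp_subgroup[OF S]]
      subgroup.mem_carrier[OF normal_imp_subgroup[OF T]] by auto
  show "a \<otimes> b \<otimes> inv a \<otimes> inv b \<in> R \<inter> S \<inter> T" if "a \<in> R" "b \<in> S" "b \<in> T" for a b
    by (intro IntI commutator_in_normal R S T c) (use that in simp_all)
  show "a \<otimes> b \<otimes> inv a \<otimes> inv b \<in> R \<inter> S \<inter> T" if "a \<in> S" "b \<in> R" "b \<in> T" for a b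
    by (intro IntI commutator_in_normal R S T c) (use that in simp_all)
  show "a \<otimes> b \<otimes> inv a \<otimes> inv b \<in> R \<inter> S \<inter> T" if "a \<in> T" "b \<in> R" "b \<in> S" for a b
    by (intro IntI commutator_in_normal R S T c) (use that in simp_all)
qed

end

section \<open>Ideals of the group ring and their dimension subgroups\<close>

lemma ideal_carrier: "ideal I (group_ring G) \<Longrightarrow> x \<in> I \<Longrightarrow> Poly_Mapping.keys x \<subseteq> carrier G"
  using ideal.Icarr[of I "group_ring G" x] by simp

lemma ideal_zero: "ideal I (group_ring G) \<Longrightarrow> 0 \<in> I"
  using additive_subgroup.zero_closed[OF ideal.axioms(1), of I "group_ring G"] by simp

lemma ideal_diff:
  assumes I: "ideal I (group_ring G)" and x: "x \<in> I" "y \<in> I"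
  shows "x - y \<in> I"
proof -
  have "x \<ominus>\<^bsub>group_ring G\<^esub> y \<in> I"
    using I x additive_subgroup.a_inv_closed[OF ideal.axioms(1)[OF I]]
      additive_subgroup.a_closed[OF ideal.axioms(1)[OF I]] unfolding a_minus_def by metis
  then show ?thesis using group_ring_minus[of x y] ideal_carrier[OF I] x by simp
qed

lemma ideal_mult:
  assumes I: "ideal I (group_ring G)" and x: "x \<in> I" and y: "Poly_Mapping.keys y \<subseteq> carrier G"
  shows "group_ring_mult G x y \<in> I" "group_ring_mult G y x \<in> I"
  using ideal.I_r_closed[OF I x, of y] ideal.I_l_closed[OF I x, of y] y by simp_all

lemma dimension_subgroup_iff:
  "g \<in> dimension_subgroup G I \<longleftrightarrow> g \<in> carrier G \<and> frag_of g - frag_of \<one> \<in> I"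
  unfolding dimension_subgroup_def using frag_minus_one_eq by auto

lemma dimension_subgroupI:
  assumes I: "ideal I (group_ring G)" and c: "g \<in> carrier G" "h \<in> carrier G"
    and d: "frag_of g - frag_of h \<in> I"
  shows "g \<otimes> inv h \<in> dimension_subgroup G I"
  using ideal_mult(1)[OF I d, of "frag_of (inv h)"] c
  by (simp add: dimension_subgroup_iff group_ring_mult_diff_left)

lemma subgroup_dimension_subgroup:
  assumes I: "ideal I (group_ring G)"
  shows "subgroup (dimension_subgroup G I) G"
proof (rule subgroupI)
  have "\<one> \<in> dimension_subgroup G I" using ideal_zero[OF I] by (simp add: dimension_subgroup_iff)
  then show "dimension_subgroup G I \<noteq> {}" by blast
  show "dimension_subgroup G I \<subseteq> carrier G" by (auto simp: dimension_subgroup_iff)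
next
  fix g assume g: "g \<in> dimension_subgroup G I"
  then have c: "g \<in> carrier G" and d: "frag_of g - frag_of \<one> \<in> I" by (simp_all add: dimension_subgroup_iff)
  have "0 - (frag_of g - frag_of \<one>) \<in> I"
    by (rule ideal_diff[OF I ideal_zero[OF I] d])
  then have "frag_of \<one> - frag_of g \<in> I" by simp
  from dimension_subgroupI[OF I one_closed c this] show "inv g \<in> dimension_subgroup G I" using c by simp
next
  fix g h assume gh: "g \<in> dimension_subgroup G I" "h \<in> dimension_subgroup G I"
  then have c: "g \<in> carrier G" "h \<in> carrier G" and d: "frag_of g - frag_of \<one> \<in> I" "frag_of h - frag_of \<one> \<in> I"
    by (simp_all add: dimension_subgroup_iff)
  have "group_ring_mult G (frag_of g - frag_of \<one>) (frag_of h) \<in> I"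
    using ideal_mult(1)[OF I d(1), of "frag_of h"] c by simp
  then have 1: "frag_of (g \<otimes> h) - frag_of h \<in> I" using c by (simp add: group_ring_mult_diff_left)
  have "0 - (frag_of h - frag_of \<one>) \<in> I"
    by (rule ideal_diff[OF I ideal_zero[OF I] d(2)])
  from ideal_diff[OF I 1 this] have "frag_of (g \<otimes> h) - frag_of \<one> \<in> I" by simp
  then show "g \<otimes> h \<in> dimension_subgroup G I" using c by (simp add: dimension_subgroup_iff)
qed

lemma aug_incl: "\<lbrakk>N \<lhd> G; n \<in> N\<rbrakk> \<Longrightarrow> frag_of n - frag_of \<one> \<in> aug G N"
proof -
  assume N: "N \<lhd> G" and n: "n \<in> N"
  interpret N: normal N G by (rule N)
  interpret ZG: ring "group_ring G" by (rule ring_group_ring)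
  have "frag_of m \<ominus>\<^bsub>group_ring G\<^esub> \<one>\<^bsub>group_ring G\<^esub> \<in> carrier (group_ring G)" if "m \<in> N" for m
    using that by (intro ZG.minus_closed ZG.one_closed) simp
  then have "frag_of n \<ominus>\<^bsub>group_ring G\<^esub> \<one>\<^bsub>group_ring G\<^esub> \<in> aug G N"
    unfolding relative_augmentation_ideal_def using n by (intro subsetD[OF ZG.genideal_self]) auto
  then show ?thesis using frag_minus_one_eq[of n] n by simp
qed

text \<open>In the group ring of the quotient the basis elements of the cosets of \<open>g\<close>
  and \<open>\<one>\<close> coincide, so the cosets do.\<close>

lemma dimension_subgroup_aug:
  assumes N: "N \<lhd> G" and g: "g \<in> dimension_subgroup G (aug G N)"
  shows "g \<in> N"
proof -
  interpret N: normal N G by (rule N)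
  have c: "g \<in> carrier G" using g by (simp add: dimension_subgroup_iff)
  have "push N (frag_of g - frag_of \<one>) = 0" using aug_push[OF N] g by (simp add: dimension_subgroup_iff)
  then have "frag_of (N #> g) = frag_of (N #> \<one>)" by (simp add: push_diff)
  then have "Poly_Mapping.keys (frag_of (N #> g)) = Poly_Mapping.keys (frag_of (N #> \<one>))" by simp
  then have "N #> g = N #> \<one>" by simp
  then show ?thesis using rcos_self[OF c N.subgroup_axioms] by (simp add: coset_mult_one N.subset)
qed

lemma set_add_ideals_incl:
  assumes "ideal I (group_ring G)" "ideal J (group_ring G)"
  shows "I \<subseteq> I <+>\<^bsub>group_ring G\<^esub> J" "J \<subseteq> I <+>\<^bsub>group_ring G\<^esub> J"
proof -
  have z: "0 \<in> I" "0 \<in> J"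
    by (rule ideal_zero[OF assms(1)], rule ideal_zero[OF assms(2)])
  show "I \<subseteq> I <+>\<^bsub>group_ring G\<^esub> J" "J \<subseteq> I <+>\<^bsub>group_ring G\<^esub> J"
    using z by (force simp: set_add_def')+
qed

context
  fixes \<rr> \<ss> \<tt>
  assumes r: "ideal \<rr> (group_ring G)" and s: "ideal \<ss> (group_ring G)" and t: "ideal \<tt> (group_ring G)"
begin

interpretation ZG: ring "group_ring G" by (rule ring_group_ring)

lemma intersections: "ideal (\<ss> \<inter> \<tt>) (group_ring G)" "ideal (\<rr> \<inter> \<tt>) (group_ring G)" "ideal (\<rr> \<inter> \<ss>) (group_ring G)"
  by (intro ZG.i_intersect r s t)+

lemmas product_ideals = ZG.ideal_prod_is_ideal[OF r intersections(1)] ZG.ideal_prod_is_ideal[OF intersections(1) r]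
  ZG.ideal_prod_is_ideal[OF s intersections(2)] ZG.ideal_prod_is_ideal[OF intersections(2) s]
  ZG.ideal_prod_is_ideal[OF t intersections(3)] ZG.ideal_prod_is_ideal[OF intersections(3) t]

lemma ideal_ideal_triple: "ideal (ideal_triple (group_ring G) \<rr> \<ss> \<tt>) (group_ring G)"
  unfolding ideal_triple_def by (intro ZG.add_ideals product_ideals)

lemma ideal_triple_incl:
  "ideal_prod (group_ring G) \<rr> (\<ss> \<inter> \<tt>) \<subseteq> ideal_triple (group_ring G) \<rr> \<ss> \<tt>"
  "ideal_prod (group_ring G) (\<ss> \<inter> \<tt>) \<rr> \<subseteq> ideal_triple (group_ring G) \<rr> \<ss> \<tt>"
  "ideal_prod (group_ring G) \<ss> (\<rr> \<inter> \<tt>) \<subseteq> ideal_triple (group_ring G) \<rr> \<ss> \<tt>"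
  "ideal_prod (group_ring G) (\<rr> \<inter> \<tt>) \<ss> \<subseteq> ideal_triple (group_ring G) \<rr> \<ss> \<tt>"
  "ideal_prod (group_ring G) \<tt> (\<rr> \<inter> \<ss>) \<subseteq> ideal_triple (group_ring G) \<rr> \<ss> \<tt>"
  "ideal_prod (group_ring G) (\<rr> \<inter> \<ss>) \<tt> \<subseteq> ideal_triple (group_ring G) \<rr> \<ss> \<tt>"
proof -
  note p = product_ideals
  note a2 = ZG.add_ideals[OF p(1,2)]
  note a3 = ZG.add_ideals[OF a2 p(3)]
  note a4 = ZG.add_ideals[OF a3 p(4)]
  note a5 = ZG.add_ideals[OF a4 p(5)]
  note i = set_add_ideals_incl[OF p(1,2)] set_add_ideals_incl[OF a2 p(3)] set_add_ideals_incl[OF a3 p(4)]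
    set_add_ideals_incl[OF a4 p(5)] set_add_ideals_incl[OF a5 p(6)]
  show "ideal_prod (group_ring G) \<rr> (\<ss> \<inter> \<tt>) \<subseteq> ideal_triple (group_ring G) \<rr> \<ss> \<tt>"
    "ideal_prod (group_ring G) (\<ss> \<inter> \<tt>) \<rr> \<subseteq> ideal_triple (group_ring G) \<rr> \<ss> \<tt>"
    "ideal_prod (group_ring G) \<ss> (\<rr> \<inter> \<tt>) \<subseteq> ideal_triple (group_ring G) \<rr> \<ss> \<tt>"
    "ideal_prod (group_ring G) (\<rr> \<inter> \<tt>) \<ss> \<subseteq> ideal_triple (group_ring G) \<rr> \<ss> \<tt>"
    "ideal_prod (group_ring G) \<tt> (\<rr> \<inter> \<ss>) \<subseteq> ideal_triple (group_ring G) \<rr> \<ss> \<tt>"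
    "ideal_prod (group_ring G) (\<rr> \<inter> \<ss>) \<tt> \<subseteq> ideal_triple (group_ring G) \<rr> \<ss> \<tt>"
    unfolding ideal_triple_def using i by (meson order_trans)+
qed

lemma ideal_triple_subset: "ideal_triple (group_ring G) \<rr> \<ss> \<tt> \<subseteq> \<rr> \<inter> \<ss> \<inter> \<tt>"
proof -
  have X: "ideal (\<rr> \<inter> \<ss> \<inter> \<tt>) (group_ring G)" by (intro ZG.i_intersect r s t)
  have add: "I <+>\<^bsub>group_ring G\<^esub> J \<subseteq> \<rr> \<inter> \<ss> \<inter> \<tt>" if "I \<subseteq> \<rr> \<inter> \<ss> \<inter> \<tt>" "J \<subseteq> \<rr> \<inter> \<ss> \<inter> \<tt>" for I J
    using that additive_subgroup.a_closed[OF ideal.axioms(1)[OF X]] unfolding set_add_def' by blast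
  note p = ZG.ideal_prod_inter[OF r intersections(1)] ZG.ideal_prod_inter[OF intersections(1) r]
    ZG.ideal_prod_inter[OF s intersections(2)] ZG.ideal_prod_inter[OF intersections(2) s]
    ZG.ideal_prod_inter[OF t intersections(3)] ZG.ideal_prod_inter[OF intersections(3) t]
  show ?thesis unfolding ideal_triple_def by (intro add) (use p in blast)+
qed

end

text \<open>Since \<open>a b - b a = (a - 1)(b - 1) - (b - 1)(a - 1)\<close>, the ideal has to
  contain both orders of each product; right multiplication by \<open>(b a)^-1\<close> then yields
  the commutator minus one.\<close>

lemma commutator_triple_subset_dimension:
  assumes R: "R \<lhd> G" and S: "S \<lhd> G" and T: "T \<lhd> G"
  shows "commutator_triple G R S T \<subseteq>
    dimension_subgroup G (ideal_triple (group_ring G) (aug G R) (aug G S) (aug G T))" (is "_ \<subseteq> dimension_subgroup G ?I")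
proof -
  have sub: "N \<subseteq> carrier G" if "N \<lhd> G" for N by (rule subgroup.subset[OF normal_imp_subgroup[OF that]])
  note id = ideal_relative_augmentation_ideal[OF sub]
  note r = id[OF R] id[OF S] id[OF T]
  note I = ideal_ideal_triple[OF r]
  have key: "a \<otimes> b \<otimes> inv a \<otimes> inv b \<in> dimension_subgroup G ?I"
    if c: "a \<in> carrier G" "b \<in> carrier G"
      and m: "group_ring_mult G (frag_of a - frag_of \<one>) (frag_of b - frag_of \<one>) \<in> ?I"
        "group_ring_mult G (frag_of b - frag_of \<one>) (frag_of a - frag_of \<one>) \<in> ?I" for a b
  proof -
    have "frag_of (a \<otimes> b) - frag_of (b \<otimes> a) =
        group_ring_mult G (frag_of a - frag_of \<one>) (frag_of b - frag_of \<one>)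
        - group_ring_mult G (frag_of b - frag_of \<one>) (frag_of a - frag_of \<one>)"
      using c by (simp add: group_ring_mult_diff_left group_ring_mult_diff_right)
    also have "\<dots> \<in> ?I" by (rule ideal_diff[OF I m])
    finally have "(a \<otimes> b) \<otimes> inv (b \<otimes> a) \<in> dimension_subgroup G ?I"
      using c by (intro dimension_subgroupI[OF I]) auto
    then show ?thesis using c by (simp add: inv_mult_group m_assoc)
  qed
  note inc = ideal_triple_incl[OF r]
  have prod: "group_ring_mult G x y \<in> ideal_prod (group_ring G) K L" if "x \<in> K" "y \<in> L" for x y K L
    using ideal_prod.prod[OF that, of "group_ring G"] by simp
  note a = aug_incl[OF R] aug_incl[OF S] aug_incl[OF T]
  have c: "x \<in> carrier G" if "x \<in> R \<or> x \<in> S \<or> x \<in> T" for x using that sub[OF R] sub[OF S] sub[OF T] by auto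
  show ?thesis
  proof (rule commutator_triple_minimal[OF R S T subgroup_dimension_subgroup[OF I]])
    fix x y assume "x \<in> R" "y \<in> S" "y \<in> T"
    then show "x \<otimes> y \<otimes> inv x \<otimes> inv y \<in> dimension_subgroup G ?I"
      using a c by (intro key subsetD[OF inc(1)] subsetD[OF inc(2)] prod) auto
  next
    fix x y assume "x \<in> S" "y \<in> R" "y \<in> T"
    then show "x \<otimes> y \<otimes> inv x \<otimes> inv y \<in> dimension_subgroup G ?I"
      using a c by (intro key subsetD[OF inc(3)] subsetD[OF inc(4)] prod) auto
  next
    fix x y assume "x \<in> T" "y \<in> R" "y \<in> S"
    then show "x \<otimes> y \<otimes> inv x \<otimes> inv y \<in> dimension_subgroup G ?I"
      using a c by (intro key subsetD[OF inc(5)] subsetD[OF inc(6)] prod) auto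
  qed
qed

lemma ex_strict_linear_order:
  "\<exists>lt :: 'c \<Rightarrow> 'c \<Rightarrow> bool. (\<forall>x y. lt x y \<longrightarrow> \<not> lt y x) \<and>
     (\<forall>x y z. lt x y \<longrightarrow> lt y z \<longrightarrow> lt x z) \<and> (\<forall>x y. x \<noteq> y \<longrightarrow> lt x y \<or> lt y x)"
proof -
  obtain r :: "'c rel" where "well_order_on UNIV r"
    using well_order_on by blast
  then have r: "antisym r" "trans r" "total_on UNIV r"
    by (auto simp: well_order_on_def linear_order_on_def partial_order_on_def preorder_on_def)
  show ?thesis
  proof (intro exI[of _ "\<lambda>x y. x \<noteq> y \<and> (x, y) \<in> r"] conjI allI impI)
    fix x y z assume "x \<noteq> y \<and> (x, y) \<in> r" "y \<noteq> z \<and> (y, z) \<in> r"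
    then show "x \<noteq> z" "(x, z) \<in> r" using antisymD[OF r(1)] transD[OF r(2)] by blast+
  next
    fix x y assume "x \<noteq> y \<and> (x, y) \<in> r"
    then show "\<not> (y \<noteq> x \<and> (y, x) \<in> r)" using antisymD[OF r(1)] by blast
  next
    fix x y :: 'c assume "x \<noteq> y"
    then show "(x \<noteq> y \<and> (x, y) \<in> r) \<or> (y \<noteq> x \<and> (y, x) \<in> r)"
      using r(3) by (auto simp: total_on_def)
  qed
qed

text \<open>The function \<open>phi\<close> is built over \<open>G Mod N\<close>, where the
  centralizing relations hold exactly. Comparing its values at \<open>g\<close> and at
  \<open>\<one>\<close> forces \<open>lop\<close> at the class of \<open>g\<close> to be the
  identity.\<close>

lemma dimension_subgroup_square:
  assumes R: "R \<lhd> G" and S: "S \<lhd> G" and T: "T \<lhd> G"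
    and g: "g \<in> dimension_subgroup G (ideal_triple (group_ring G) (aug G R) (aug G S) (aug G T))"
  shows "g \<otimes> g \<in> commutator_triple G R S T"
proof -
  define N where "N = commutator_triple G R S T"
  have N: "N \<lhd> G" unfolding N_def by (rule commutator_triple_normal[OF R S T])
  interpret N: normal N G by (rule N)
  define Q where "Q = G Mod N"
  define \<pi> where "\<pi> x = N #> x" for x
  have homQ: "\<pi> \<in> hom G Q" unfolding \<pi>_def Q_def by (rule N.r_coset_hom_Mod)
  have "group Q" unfolding Q_def by (rule N.factorgroup_is_group)
  then interpret \<pi>: group_hom G Q \<pi> by (intro group_hom.intro group_hom_axioms.intro group_axioms homQ)
  have surj: "\<pi> ` carrier G = carrier Q"
    unfolding \<pi>_def Q_def FactGroup_def RCOSETS_def by auto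
  have eqN: "x \<otimes> inv y \<in> N" if "\<pi> x = \<pi> y" "x \<in> carrier G" "y \<in> carrier G" for x y
  proof -
    have "x \<in> N #> y" using rcos_self[OF that(2) N.subgroup_axioms] that(1) by (simp add: \<pi>_def)
    then obtain n where "n \<in> N" "x = n \<otimes> y" by (auto simp: r_coset_def)
    then show ?thesis using that by (simp add: m_assoc)
  qed
  have eqI: "\<pi> x = \<pi> y" if "x \<otimes> inv y \<in> N" "x \<in> carrier G" "y \<in> carrier G" for x y
  proof -
    have "N #> (x \<otimes> inv y \<otimes> y) = N #> y"
      using coset_mult_assoc[OF N.subset, of "x \<otimes> inv y" y] N.rcos_const[OF is_group that(1)] that by simp
    then show ?thesis using that by (simp add: \<pi>_def m_assoc)
  qed
  have mem: "x \<in> K" if K: "K \<lhd> G" "N \<subseteq> K" and x: "x \<in> carrier G" "\<pi> x \<in> \<pi> ` K" for K x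
  proof -
    interpret K: normal K G by (rule K)
    obtain y where y: "y \<in> K" "\<pi> x = \<pi> y" using x by blast
    have "x \<otimes> inv y \<in> K" using eqN[OF y(2) x(1)] y(1) K(2) by auto
    then have "x \<otimes> inv y \<otimes> y \<in> K" using y(1) by (rule K.m_closed)
    then show ?thesis using x(1) y(1) by (simp add: m_assoc)
  qed
  have sub: "N \<subseteq> R" "N \<subseteq> S" "N \<subseteq> T" using commutator_triple_subset[OF R S T] by (auto simp: N_def)
  note inc = commutator_triple_incl[OF R S T, folded N_def]
  have img: "\<pi> ` K \<lhd> Q" if "K \<lhd> G" for K
    by (rule normal.surj_hom_normal_subgroup[OF that \<pi>.group_hom_axioms surj])
  have carr: "x \<in> carrier G" if "x \<in> R \<or> x \<in> S \<or> x \<in> T" for x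
    using that subgroup.mem_carrier[OF normal_imp_subgroup[OF R]] subgroup.mem_carrier[OF normal_imp_subgroup[OF S]]
      subgroup.mem_carrier[OF normal_imp_subgroup[OF T]] by auto
  have comm_eq: "\<pi> (x \<otimes> a) = \<pi> (a \<otimes> x)"
    if "x \<otimes> a \<otimes> inv x \<otimes> inv a \<in> N" "x \<in> carrier G" "a \<in> carrier G" for x a
    using eqI[of "x \<otimes> a" "a \<otimes> x"] that by (simp add: inv_mult_group m_assoc)
  have cR: "\<pi> (x \<otimes> a) = \<pi> (a \<otimes> x)" if "x \<in> R" "a \<in> S" "a \<in> T" for x a
    by (rule comm_eq[OF subsetD[OF inc(1) commutator_subgroup_incl]]) (use that carr in auto)
  have cS: "\<pi> (x \<otimes> a) = \<pi> (a \<otimes> x)" if "x \<in> S" "a \<in> R" "a \<in> T" for x a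
    by (rule comm_eq[OF subsetD[OF inc(2) commutator_subgroup_incl]]) (use that carr in auto)
  have cT: "\<pi> (x \<otimes> a) = \<pi> (a \<otimes> x)" if "x \<in> T" "a \<in> R" "a \<in> S" for x a
    by (rule comm_eq[OF subsetD[OF inc(3) commutator_subgroup_incl]]) (use that carr in auto)
  \<comment> \<open>Because \<open>K\<close> contains the kernel \<open>N\<close>, an element common
    to both images comes from a single element of \<open>K \<inter> L\<close>.\<close>
  have lift2: "\<exists>y. y \<in> K \<and> y \<in> L \<and> x = \<pi> y"
    if K: "K \<lhd> G" "N \<subseteq> K" and L: "L \<lhd> G" and x: "x \<in> \<pi> ` K" "x \<in> \<pi> ` L" for x K L
  proof -
    obtain y where y: "y \<in> L" "x = \<pi> y" using x(2) by blast
    have "y \<in> carrier G" using subgroup.mem_carrier[OF normal_imp_subgroup[OF L] y(1)] .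
    then have "y \<in> K" using mem[OF K] x(1) y(2) by blast
    then show ?thesis using y by blast
  qed
  interpret CT: commuting_triple Q "\<pi> ` R" "\<pi> ` S" "\<pi> ` T"
  proof (intro commuting_triple.intro commuting_triple_axioms.intro img R S T)
    show "group Q" by fact
    fix r x assume "r \<in> \<pi> ` R" "x \<in> \<pi> ` S" "x \<in> \<pi> ` T"
    then obtain r' x' where "r' \<in> R" "r = \<pi> r'" "x' \<in> S" "x' \<in> T" "x = \<pi> x'"
      using lift2[OF S sub(2) T] by blast
    then show "r \<otimes>\<^bsub>Q\<^esub> x = x \<otimes>\<^bsub>Q\<^esub> r" using cR[of r' x'] carr by (simp flip: \<pi>.hom_mult)
  next
    fix r x assume "r \<in> \<pi> ` S" "x \<in> \<pi> ` R" "x \<in> \<pi> ` T"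
    then obtain r' x' where "r' \<in> S" "r = \<pi> r'" "x' \<in> R" "x' \<in> T" "x = \<pi> x'"
      using lift2[OF R sub(1) T] by blast
    then show "r \<otimes>\<^bsub>Q\<^esub> x = x \<otimes>\<^bsub>Q\<^esub> r" using cS[of r' x'] carr by (simp flip: \<pi>.hom_mult)
  next
    fix r x assume "r \<in> \<pi> ` T" "x \<in> \<pi> ` R" "x \<in> \<pi> ` S"
    then obtain r' x' where "r' \<in> T" "r = \<pi> r'" "x' \<in> R" "x' \<in> S" "x = \<pi> x'"
      using lift2[OF R sub(1) S] by blast
    then show "r \<otimes>\<^bsub>Q\<^esub> x = x \<otimes>\<^bsub>Q\<^esub> r" using cT[of r' x'] carr by (simp flip: \<pi>.hom_mult)
  qed
  obtain lt :: "'a set \<Rightarrow> 'a set \<Rightarrow> bool" where lt: "\<forall>x y. lt x y \<longrightarrow> \<not> lt y x"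
    "\<forall>x y z. lt x y \<longrightarrow> lt y z \<longrightarrow> lt x z" "\<forall>x y. x \<noteq> y \<longrightarrow> lt x y \<or> lt y x"
    using ex_strict_linear_order[where 'c = "'a set"] by (elim exE conjE) (rule that)
  define lift where "lift x = (SOME s. CT.sim s x)" for x
  have lift: "CT.sim (lift x) x" if "x \<in> CT.T0" for x
    using that unfolding CT.T0_iff lift_def by (rule someI_ex)
  interpret O: ordered_commuting_triple Q "\<pi> ` R" "\<pi> ` S" "\<pi> ` T" lt lift
  proof (intro ordered_commuting_triple.intro ordered_commuting_triple_axioms.intro CT.commuting_triple_axioms)
    show "\<not> lt y x" if "lt x y" for x y using lt(1)[rule_format, OF that] .
    show "lt x z" if "lt x y" "lt y z" for x y z using lt(2)[rule_format, OF that] .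
    show "lt x y \<or> lt y x" if "x \<noteq> y" for x y using lt(3)[rule_format, OF that] .
    show "CT.sim (lift x) x" if "x \<in> CT.T0" for x using that by (rule lift)
  qed
  interpret F: group_functionals G O.centre
    by (intro group_functionals.intro group_axioms O.comm_group_centre)
  \<comment> \<open>Pulled back along \<open>\<pi>\<close>, the function lives on \<open>G\<close>,
    so the ideals of the group ring of \<open>G\<close> never have to be transported to the
    quotient.\<close>
  define \<phi> where "\<phi> x = O.phi (\<pi> x)" for x
  have \<pi>m: "\<pi> (x \<otimes> y) = \<pi> x \<otimes>\<^bsub>Q\<^esub> \<pi> y" if "x \<in> carrier G" "y \<in> carrier G" for x y
    using that by simp
  have \<pi>c: "\<pi> x \<in> carrier Q" if "x \<in> carrier G" for x using that by simp
  have \<phi>c: "\<phi> x \<in> carrier O.centre" if "x \<in> carrier G" for x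
    unfolding \<phi>_def by (rule O.phi_closed[OF \<pi>c[OF that]])
  have kill: "F.ext \<phi> x = \<one>\<^bsub>O.centre\<^esub>"
    if "x \<in> ideal_triple (group_ring G) (aug G R) (aug G S) (aug G T)" for x
  proof (rule F.kills_ideal_triple[OF R S T, where \<phi> = \<phi> and U = "\<lambda>\<tau> x. O.phiU (\<pi> \<tau>) (\<pi> x)"
        and V = "\<lambda>\<tau> x. O.phiV (\<pi> \<tau>) (\<pi> x)"])
    show "\<phi> x \<in> carrier O.centre" if "x \<in> carrier G" for x using \<phi>c[OF that] .
    show "\<phi> (x \<otimes> a \<otimes> g) = \<phi> (a \<otimes> x \<otimes> g)" if "x \<in> R" "a \<in> S" "a \<in> T" "g \<in> carrier G" for x a g
      using cR[OF that(1-3)] that carr unfolding \<phi>_def by (simp add: \<pi>m[of "x \<otimes> a"] \<pi>m[of "a \<otimes> x"] del: \<pi>.hom_mult)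
    show "\<phi> (x \<otimes> a \<otimes> g) = \<phi> (a \<otimes> x \<otimes> g)" if "x \<in> S" "a \<in> R" "a \<in> T" "g \<in> carrier G" for x a g
      using cS[OF that(1-3)] that carr unfolding \<phi>_def by (simp add: \<pi>m[of "x \<otimes> a"] \<pi>m[of "a \<otimes> x"] del: \<pi>.hom_mult)
    show "\<phi> (x \<otimes> a \<otimes> g) = \<phi> (a \<otimes> x \<otimes> g)" if "x \<in> T" "a \<in> R" "a \<in> S" "g \<in> carrier G" for x a g
      using cT[OF that(1-3)] that carr unfolding \<phi>_def by (simp add: \<pi>m[of "x \<otimes> a"] \<pi>m[of "a \<otimes> x"] del: \<pi>.hom_mult)
    show "\<phi> (a \<otimes> g) \<otimes>\<^bsub>O.centre\<^esub> \<phi> (x \<otimes> g) = \<phi> (a \<otimes> x \<otimes> g) \<otimes>\<^bsub>O.centre\<^esub> \<phi> g"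
      if "x \<in> R" "a \<in> S" "a \<in> T" "g \<in> carrier G" for x a g
    proof -
      have "a \<in> carrier G" "x \<in> carrier G" using carr that by auto
      moreover have "\<pi> a \<in> \<pi> ` S \<inter> \<pi> ` T" using that by blast
      ultimately show ?thesis
        using O.phi_A[OF \<pi>c[OF that(4)], of "\<pi> a" "\<pi> x"] that by (simp add: \<phi>_def \<pi>.H.m_assoc)
    qed
    show "\<phi> (a \<otimes> g) \<otimes>\<^bsub>O.centre\<^esub> \<phi> (x \<otimes> g) = \<phi> (a \<otimes> x \<otimes> g) \<otimes>\<^bsub>O.centre\<^esub> \<phi> g"
      if "x \<in> S" "a \<in> R" "a \<in> T" "g \<in> carrier G" for x a g
    proof -
      have "a \<in> carrier G" "x \<in> carrier G" using carr that by auto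
      moreover have "\<pi> a \<in> \<pi> ` R \<inter> \<pi> ` T" using that by blast
      ultimately show ?thesis
        using O.phi_B[OF \<pi>c[OF that(4)], of "\<pi> a" "\<pi> x"] that by (simp add: \<phi>_def \<pi>.H.m_assoc)
    qed
    show "\<phi> (a \<otimes> g) \<otimes>\<^bsub>O.centre\<^esub> \<phi> (x \<otimes> g) = \<phi> (a \<otimes> x \<otimes> g) \<otimes>\<^bsub>O.centre\<^esub> \<phi> g"
      if "x \<in> T" "a \<in> R" "a \<in> S" "g \<in> carrier G" for x a g
    proof -
      have "a \<in> carrier G" "x \<in> carrier G" using carr that by auto
      moreover have "\<pi> a \<in> \<pi> ` R \<inter> \<pi> ` S" using that by blast
      ultimately show ?thesis
        using O.phi_E[OF \<pi>c[OF that(4)], of "\<pi> a" "\<pi> x"] that by (simp add: \<phi>_def \<pi>.H.m_assoc)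
    qed
    fix \<tau> g assume t: "\<tau> \<in> T" and g: "g \<in> carrier G"
    have tc: "\<tau> \<in> carrier G" and tQ: "\<pi> \<tau> \<in> \<pi> ` T" using t carr by auto
    show "\<phi> (\<tau> \<otimes> g) = O.phiU (\<pi> \<tau>) (\<pi> g) \<otimes>\<^bsub>O.centre\<^esub> O.phiV (\<pi> \<tau>) (\<pi> g) \<otimes>\<^bsub>O.centre\<^esub> \<phi> g"
      using O.phi_T(1)[OF \<pi>c[OF g] tQ] tc g by (simp add: \<phi>_def)
    show "O.phiU (\<pi> \<tau>) (\<pi> g) \<in> carrier O.centre" "O.phiV (\<pi> \<tau>) (\<pi> g) \<in> carrier O.centre"
      using O.phi_T(2,3)[OF \<pi>c[OF g] tQ] .
    show "O.phiU (\<pi> \<tau>) (\<pi> (\<rho> \<otimes> g)) = O.phiU (\<pi> \<tau>) (\<pi> g)" if "\<rho> \<in> R" for \<rho>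
      using O.phiU_R[OF \<pi>c[OF g] tQ, of "\<pi> \<rho>"] that carr g by simp
    show "O.phiV (\<pi> \<tau>) (\<pi> (\<sigma> \<otimes> g)) = O.phiV (\<pi> \<tau>) (\<pi> g)" if "\<sigma> \<in> S" for \<sigma>
      using O.phiV_S[OF \<pi>c[OF g] tQ, of "\<pi> \<sigma>"] that carr g by simp
  qed (rule that)
  have gc: "g \<in> carrier G" and gI: "frag_of g - frag_of \<one> \<in> ideal_triple (group_ring G) (aug G R) (aug G S) (aug G T)"
    using g by (simp_all add: dimension_subgroup_iff)
  note id = ideal_relative_augmentation_ideal[OF subgroup.subset[OF normal_imp_subgroup]]
  \<comment> \<open>Membership of \<open>g\<close> in all three subgroups is what allows
    \<open>phi_C\<close> to be applied with the class of \<open>g\<close> as the element of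
    \<open>C\<close>.\<close>
  have "frag_of g - frag_of \<one> \<in> aug G R \<inter> aug G S \<inter> aug G T"
    using ideal_triple_subset[OF id[OF R] id[OF S] id[OF T]] gI by blast
  then have gRST: "g \<in> R" "g \<in> S" "g \<in> T"
    using dimension_subgroup_aug[OF R] dimension_subgroup_aug[OF S] dimension_subgroup_aug[OF T] gc
    by (simp_all add: dimension_subgroup_iff)
  have Pi: "\<phi> \<in> carrier G \<rightarrow> carrier O.centre" using \<phi>c by blast
  have "\<phi> g = \<phi> \<one>" using F.ext_diff_one[OF Pi gc kill[OF gI]] .
  have gC: "\<pi> g \<in> \<pi> ` R \<inter> \<pi> ` S \<inter> \<pi> ` T" using gRST by blast
  have "O.phi (\<pi> g \<otimes>\<^bsub>Q\<^esub> \<pi> \<one>) = CT.lop (\<pi> g) (\<pi> g) \<circ> O.phi (\<pi> \<one>)"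
    by (rule O.phi_C[OF \<pi>c[OF one_closed] gC])
  moreover have "\<pi> g \<otimes>\<^bsub>Q\<^esub> \<pi> \<one> = \<pi> g" using gc by simp
  ultimately have eq: "\<phi> \<one> = CT.lop (\<pi> g) (\<pi> g) \<circ> \<phi> \<one>"
    using \<open>\<phi> g = \<phi> \<one>\<close> unfolding \<phi>_def by argo
  have bij: "surj (\<phi> \<one>)"
    using O.central_permutes[OF O.centre_central[OF \<phi>c[OF one_closed]]] by (rule permutes_surj)
  have "CT.lop (\<pi> g) (\<pi> g) = id"
  proof
    fix w
    obtain v where v: "w = \<phi> \<one> v" using bij by (rule surjE)
    show "CT.lop (\<pi> g) (\<pi> g) w = id w" using fun_cong[OF eq, of v] unfolding v comp_def id_def by (rule sym)
  qed
  then have "\<pi> g \<otimes>\<^bsub>Q\<^esub> \<pi> g = \<one>\<^bsub>Q\<^esub>" by (rule O.lop_square[OF gC])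
  then have "\<pi> (g \<otimes> g) = \<pi> \<one>" using gc by simp
  then have "(g \<otimes> g) \<otimes> inv \<one> \<in> N" by (rule eqN) (use gc in simp_all)
  then show ?thesis using gc by (simp add: N_def)
qed

end

theorem theorem1:
  fixes G :: "('a, 'b) monoid_scheme" (structure)
    and R S T D N :: "'a set" and \<rr> \<ss> \<tt> :: "('a \<Rightarrow>\<^sub>0 int) set"
  assumes "group G" and "R \<lhd> G" and "S \<lhd> G" and "T \<lhd> G"
    and "\<rr> = relative_augmentation_ideal G R"
    and "\<ss> = relative_augmentation_ideal G S"
    and "\<tt> = relative_augmentation_ideal G T"
    and "D = dimension_subgroup G (ideal_triple (group_ring G) \<rr> \<ss> \<tt>)"
    and "N = commutator_triple G R S T"
  shows "(\<forall>g \<in> D. g [^] (2::nat) \<in> N) \<and>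
    N \<lhd> G\<lparr>carrier := D\<rparr> \<and>
    module (residue_ring 2) (power_module (G\<lparr>carrier := D\<rparr> Mod N))"
proof -
  interpret group G by fact
  note n = assms(2-4)
  note id = ideal_relative_augmentation_ideal[OF subgroup.subset[OF normal_imp_subgroup]]
  have D: "subgroup D G"
    unfolding assms(5-8) by (intro subgroup_dimension_subgroup ideal_ideal_triple id n)
  have ND: "N \<subseteq> D" unfolding assms(5-9) by (rule commutator_triple_subset_dimension[OF n])
  have sq: "g \<otimes> g \<in> N" if "g \<in> D" for g
    using dimension_subgroup_square[OF n] that unfolding assms(5-9) .
  have normal: "N \<lhd> G\<lparr>carrier := D\<rparr>"
    by (rule normal_restrict_supergroup[OF D _ ND]) (simp only: assms(9) commutator_triple_normal[OF n])
  have "g [^] (2::nat) \<in> N" if "g \<in> D" for g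
    using sq[OF that] subgroup.mem_carrier[OF D that] by (simp add: numeral_2_eq_2)
  moreover have "module (residue_ring 2) (power_module (G\<lparr>carrier := D\<rparr> Mod N))"
  proof -
    interpret N: normal N "G\<lparr>carrier := D\<rparr>" by (rule normal)
    define Q where "Q = G\<lparr>carrier := D\<rparr> Mod N"
    interpret Q: group Q unfolding Q_def by (rule N.factorgroup_is_group)
    have sqQ: "x \<otimes>\<^bsub>Q\<^esub> x = \<one>\<^bsub>Q\<^esub>" if x: "x \<in> carrier Q" for x
    proof -
      obtain g where g: "g \<in> D" "x = N #>\<^bsub>G\<lparr>carrier := D\<rparr>\<^esub> g"
        using x by (auto simp: Q_def FactGroup_def RCOSETS_def)
      have "x \<otimes>\<^bsub>Q\<^esub> x = N #>\<^bsub>G\<lparr>carrier := D\<rparr>\<^esub> (g \<otimes> g)"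
        unfolding g Q_def using N.rcos_sum[of g g] g by simp
      also have "\<dots> = N"
        using N.rcos_const[OF subgroup.subgroup_is_group[OF D is_group] sq[OF g(1)]] .
      finally show ?thesis by (simp add: Q_def)
    qed
    have inv_self: "inv\<^bsub>Q\<^esub> x = x" if "x \<in> carrier Q" for x
      by (rule Q.inv_equality[OF sqQ[OF that] that that])
    \<comment> \<open>In a group of exponent two every element is its own inverse, so reversal of
      products under inversion is commutativity.\<close>
    have comm: "x \<otimes>\<^bsub>Q\<^esub> y = y \<otimes>\<^bsub>Q\<^esub> x" if "x \<in> carrier Q" "y \<in> carrier Q" for x y
      using Q.inv_mult_group[OF that] inv_self that by simp
    have pow: "x [^]\<^bsub>Q\<^esub> (k::int) = (if k = 0 then \<one>\<^bsub>Q\<^esub> else x)" if "k \<in> {0..1}" "x \<in> carrier Q" for k x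
    proof -
      have "k = 0 \<or> k = 1" using that(1) by auto
      then show ?thesis using that(2) by (auto simp: Q.int_pow_1)
    qed
    interpret res: residues 2 "residue_ring 2" by unfold_locales simp_all
    have "module (residue_ring 2) (power_module Q)"
    proof (rule moduleI)
      show "cring (residue_ring 2)" by (rule res.cring)
      show "abelian_group (power_module Q)"
      proof (rule abelian_groupI)
        fix x assume "x \<in> carrier (power_module Q)"
        then show "\<exists>y\<in>carrier (power_module Q). y \<oplus>\<^bsub>power_module Q\<^esub> x = \<zero>\<^bsub>power_module Q\<^esub>"
          using sqQ by (intro bexI[of _ x]) (simp_all add: power_module_def)
      next
        fix x y assume "x \<in> carrier (power_module Q)" "y \<in> carrier (power_module Q)"
        then show "x \<oplus>\<^bsub>power_module Q\<^esub> y = y \<oplus>\<^bsub>power_module Q\<^esub> x"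
          using comm[of x y] by (simp add: power_module_def)
      qed (simp_all add: power_module_def Q.m_assoc)
    next
      fix a b x assume ab: "a \<in> carrier (residue_ring 2)" "b \<in> carrier (residue_ring 2)" "x \<in> carrier (power_module Q)"
      have k: "a = 0 \<or> a = 1" "b = 0 \<or> b = 1" and x: "x \<in> carrier Q"
        using ab by (auto simp: residue_ring_def power_module_def)
      \<comment> \<open>The only residue sum that wraps around is \<open>1 + 1 = 0\<close>, and
        there the module law is \<open>sqQ\<close>.\<close>
      show "(a \<oplus>\<^bsub>residue_ring 2\<^esub> b) \<odot>\<^bsub>power_module Q\<^esub> x = a \<odot>\<^bsub>power_module Q\<^esub> x \<oplus>\<^bsub>power_module Q\<^esub> b \<odot>\<^bsub>power_module Q\<^esub> x"
        "(a \<otimes>\<^bsub>residue_ring 2\<^esub> b) \<odot>\<^bsub>power_module Q\<^esub> x = a \<odot>\<^bsub>power_module Q\<^esub> (b \<odot>\<^bsub>power_module Q\<^esub> x)"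
        using k x sqQ by (auto simp: residue_ring_def power_module_def pow)
    qed (auto simp: residue_ring_def power_module_def pow)
    then show ?thesis by (simp add: Q_def)
  qed
  ultimately show ?thesis using normal by blast
qed

end
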